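(* Let $L$ be an integral hermitian $O_F$-lattice of rank $n$, let $m\ge0$, and let $I_m$ be a unimodular hermitian lattice of rank $m$. Then $$\mathrm{Pden}(I_m,L,X)=\sum_{i=0}^n\mathrm{Pden}^{n-i}(I_m,L,X),$$ where for each $i$, $\mathrm{Pden}^{n-i}(I_m,L,X)\in\mathbb{Q}[X]$ is the polynomial characterized by $$\mathrm{Pden}^{n-i}(I_m,L,q^{-2k})=q^{-2ki}\,\mathrm{Pden}(H^k,0_{n-i})\sum_{V_1\in\mathrm{Gr}(i,\overline L)(\mathbb{F}_q)}q^{(n-i)i}\,\mathrm{Pden}(I_m,L_{V_1})\quad\text{for all integers }k\ge0,$$ where $0_{n-i}$ is a free $O_F$-module of rank $n-i$ with identically zero hermitian form, and for each $i$-dimensional $\mathbb{F}_q$-subspace $V_1\subseteq\overline L=L/\pi L$, $L_{V_1}\subseteq L$ is a sublattice of rank $i$ whose image in $\overline L$ is $V_1$.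
   Context: $F/F_0$ ramified quadratic extension of $p$-adic fields, $p$ odd, residue field $\mathbb{F}_q$, $\pi$ uniformizer of $F$ with $\bar\pi=-\pi$, $\pi_0=\pi^2$. A hermitian lattice $L$ is integral if $(x,y)\in O_F$ for all $x,y\in L$, unimodular if $L$ equals its hermitian dual. $H$ is the rank-2 lattice with Gram matrix $\begin{pmatrix}0&\pi^{-1}\\-\pi^{-1}&0\end{pmatrix}$. For hermitian lattices (possibly with degenerate form) $L$ of rank $n$ and $M$ of rank $m$, a hermitian $O_F$-module homomorphism $\phi:L\otimes O_{F_0}/\pi_0^d\to (M\perp H^k)\otimes O_{F_0}/\pi_0^d$ (i.e. an $\mathcal{O}_{F_0}/\pi_0^d$-point of the scheme of hermitian homomorphisms) is primitive if the image of $\phi(L)$ in $(M\perp H^k)/\pi(M\perp H^k)$ has $\mathbb{F}_q$-dimension $n$. The primitive local density polynomial $\mathrm{Pden}(M,L,X)\in\mathbb{Q}[X]$ satisfies $\mathrm{Pden}(M,L,q^{-2k})=\lim_{d\to\infty}q^{-dn(2(m+2k)-n)}\#\{\text{primitive }\phi\}$ for $k\ge0$; $\mathrm{Pden}(M,L)=\mathrm{Pden}(M,L,1)$, and $\mathrm{Pden}(H^k,N)$ is the analogous limit for target $H^k$. *)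

theory Defs
  imports
    Complex_Main
    "HOL-Library.FuncSet"
    "HOL-Library.Product_Plus"
    "HOL-Library.Function_Algebras"
    "HOL-Computational_Algebra.Polynomial"
    "HOL-Computational_Algebra.Primes"
begin

section \<open>Ramified quadratic extensions of p-adic fields\<close>

definition coset :: "'a::ab_group_add set \<Rightarrow> 'a \<Rightarrow> 'a set" where
  "coset B x = (+) x ` B"

text \<open>The quotient \<open>A / B\<close> as a set of cosets; for \<open>A\<close> not containing \<open>B\<close> this is the image of
  \<open>A\<close> in the quotient by \<open>B\<close>.\<close>

definition quot :: "'a::ab_group_add set \<Rightarrow> 'a set \<Rightarrow> 'a set set" where
  "quot A B = coset B ` A"

definition is_subfield :: "'f::field set \<Rightarrow> bool" where
  "is_subfield K \<longleftrightarrow> 0 \<in> K \<and> 1 \<in> K \<and> (\<forall>x\<in>K. - x \<in> K \<and> inverse x \<in> K) \<and>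
     (\<forall>x\<in>K. \<forall>y\<in>K. x + y \<in> K \<and> x * y \<in> K)"

text \<open>Valuations are normalised and integer valued; their value at \<open>0\<close> is irrelevant, since \<open>0\<close> is
  treated separately throughout.\<close>

definition discrete_valuation :: "'f::field set \<Rightarrow> ('f \<Rightarrow> int) \<Rightarrow> bool" where
  "discrete_valuation K v \<longleftrightarrow>
     (\<forall>x\<in>K - {0}. \<forall>y\<in>K - {0}. v (x * y) = v x + v y) \<and>
     (\<forall>x\<in>K - {0}. \<forall>y\<in>K - {0}. x + y \<noteq> 0 \<longrightarrow> min (v x) (v y) \<le> v (x + y)) \<and>
     v ` (K - {0}) = UNIV"

definition val_ideal :: "'f::field set \<Rightarrow> ('f \<Rightarrow> int) \<Rightarrow> int \<Rightarrow> 'f set" where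
  "val_ideal K v N = {x\<in>K. x = 0 \<or> v x \<ge> N}"

definition complete_valued :: "'f::field set \<Rightarrow> ('f \<Rightarrow> int) \<Rightarrow> bool" where
  "complete_valued K v \<longleftrightarrow> (\<forall>s :: nat \<Rightarrow> 'f. range s \<subseteq> K \<longrightarrow>
     (\<forall>N. \<exists>k. \<forall>i\<ge>k. \<forall>j\<ge>k. s i - s j \<in> val_ideal K v N) \<longrightarrow>
     (\<exists>l\<in>K. \<forall>N. \<exists>k. \<forall>i\<ge>k. s i - l \<in> val_ideal K v N))"

text \<open>A p-adic field is a field of characteristic \<open>0\<close>, complete with respect to a discrete valuation,
  whose residue field is finite of characteristic \<open>p\<close>.\<close>

definition padic_field :: "nat \<Rightarrow> 'f::field_char_0 set \<Rightarrow> ('f \<Rightarrow> int) \<Rightarrow> bool" where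
  "padic_field p K v \<longleftrightarrow> prime p \<and> is_subfield K \<and> discrete_valuation K v \<and> complete_valued K v \<and>
     finite (quot (val_ideal K v 0) (val_ideal K v 1)) \<and> of_nat p \<in> val_ideal K v 1"

text \<open>The field \<open>F\<close> is the whole type, \<open>F\<^sub>0\<close> a subset of it.\<close>

record 'f quad_ext =
  base :: "'f set"
  bval :: "'f \<Rightarrow> int"
  val :: "'f \<Rightarrow> int"
  galconj :: "'f \<Rightarrow> 'f"
  unif :: "'f"

definition ramified_quadratic_ext :: "nat \<Rightarrow> 'f::field_char_0 quad_ext \<Rightarrow> bool" where
  "ramified_quadratic_ext p E \<longleftrightarrow>
     odd p \<and> padic_field p (base E) (bval E) \<and>
     \<comment> \<open>\<open>[F : F\<^sub>0] = 2\<close>\<close>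
     (\<exists>b c. \<forall>x. \<exists>!(s, t). s \<in> base E \<and> t \<in> base E \<and> x = s * b + t * c) \<and>
     \<comment> \<open>ramification index \<open>2\<close>\<close>
     discrete_valuation UNIV (val E) \<and> (\<forall>x\<in>base E - {0}. val E x = 2 * bval E x) \<and>
     \<comment> \<open>the nontrivial automorphism of \<open>F\<close> over \<open>F\<^sub>0\<close>\<close>
     bij (galconj E) \<and> galconj E \<noteq> id \<and> (\<forall>x\<in>base E. galconj E x = x) \<and>
     (\<forall>x y. galconj E (x + y) = galconj E x + galconj E y \<and> galconj E (x * y) = galconj E x * galconj E y) \<and>
     unif E \<noteq> 0 \<and> val E (unif E) = 1 \<and> galconj E (unif E) = - unif E"

definition ringF :: "'f::field quad_ext \<Rightarrow> 'f set" where
  "ringF E = val_ideal UNIV (val E) 0"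

definition pi0 :: "'f::field quad_ext \<Rightarrow> 'f" where
  "pi0 E = (unif E)\<^sup>2"

definition resq :: "'f::field quad_ext \<Rightarrow> nat" where
  "resq E = card (quot (val_ideal (base E) (bval E) 0) (val_ideal (base E) (bval E) 1))"


section \<open>Hermitian lattices\<close>

text \<open>A lattice \<open>pts L\<close> lives in an ambient vector space over \<open>F\<close> with a hermitian form, possibly
  degenerate. The lattice need not span the ambient space, so that sublattices of smaller rank are
  obtained by changing \<open>pts L\<close> only.\<close>

record ('f, 'v) herm =
  smul :: "'f \<Rightarrow> 'v \<Rightarrow> 'v"
  form :: "'v \<Rightarrow> 'v \<Rightarrow> 'f"
  pts :: "'v set"

definition hermitian_lattice :: "'f::field quad_ext \<Rightarrow> ('f, 'v::ab_group_add) herm \<Rightarrow> bool" where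
  "hermitian_lattice E L \<longleftrightarrow> vector_space (smul L) \<and>
     (\<forall>x y z. form L (x + y) z = form L x z + form L y z) \<and>
     (\<forall>a x y. form L (smul L a x) y = a * form L x y) \<and>
     (\<forall>x y. form L y x = galconj E (form L x y)) \<and>
     (\<exists>B. finite B \<and> \<not> module.dependent (smul L) B \<and>
        pts L = {\<Sum>b\<in>B. smul L (c b) b | c. \<forall>b\<in>B. c b \<in> ringF E})"

definition lat_rank :: "('f::field, 'v::ab_group_add) herm \<Rightarrow> nat" where
  "lat_rank L = vector_space.dim (smul L) (pts L)"

definition integral_lattice :: "'f::field quad_ext \<Rightarrow> ('f, 'v::ab_group_add) herm \<Rightarrow> bool" where
  "integral_lattice E L \<longleftrightarrow> (\<forall>x\<in>pts L. \<forall>y\<in>pts L. form L x y \<in> ringF E)"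

definition dual_lattice :: "'f::field quad_ext \<Rightarrow> ('f, 'v::ab_group_add) herm \<Rightarrow> 'v set" where
  "dual_lattice E L = {x \<in> module.span (smul L) (pts L). \<forall>y\<in>pts L. form L x y \<in> ringF E}"

definition unimodular :: "'f::field quad_ext \<Rightarrow> ('f, 'v::ab_group_add) herm \<Rightarrow> bool" where
  "unimodular E L \<longleftrightarrow> pts L = dual_lattice E L"

definition gram_lattice :: "'f::field quad_ext \<Rightarrow> nat \<Rightarrow> (nat \<Rightarrow> nat \<Rightarrow> 'f) \<Rightarrow> ('f, nat \<Rightarrow> 'f) herm" where
  "gram_lattice E r G =
     \<lparr>smul = \<lambda>a x i. a * x i,
      form = \<lambda>x y. \<Sum>i<r. \<Sum>j<r. x i * G i j * galconj E (y j),
      pts = {x. (\<forall>i<r. x i \<in> ringF E) \<and> (\<forall>i\<ge>r. x i = 0)}\<rparr>"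

definition null_lattice :: "'f::field quad_ext \<Rightarrow> nat \<Rightarrow> ('f, nat \<Rightarrow> 'f) herm" where
  "null_lattice E r = gram_lattice E r (\<lambda>_ _. 0)"

definition hyp_plane :: "'f::field quad_ext \<Rightarrow> ('f, nat \<Rightarrow> 'f) herm" where
  "hyp_plane E = gram_lattice E 2
     (\<lambda>i j. if i = 0 \<and> j = 1 then inverse (unif E)
            else if i = 1 \<and> j = 0 then - inverse (unif E) else 0)"

definition herm_sum :: "('f, 'v) herm \<Rightarrow> ('f, 'w) herm \<Rightarrow> ('f::field, 'v \<times> 'w) herm" where
  "herm_sum M N =
     \<lparr>smul = \<lambda>a z. (smul M a (fst z), smul N a (snd z)),
      form = \<lambda>z z'. form M (fst z) (fst z') + form N (snd z) (snd z'),
      pts = pts M \<times> pts N\<rparr>"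

text \<open>The orthogonal sum of \<open>k\<close> copies, realised on sequences so that the type does not depend
  on \<open>k\<close>.\<close>

definition herm_power :: "nat \<Rightarrow> ('f::field, 'v::zero) herm \<Rightarrow> ('f, nat \<Rightarrow> 'v) herm" where
  "herm_power k L =
     \<lparr>smul = \<lambda>a x j. smul L a (x j),
      form = \<lambda>x y. \<Sum>j<k. form L (x j) (y j),
      pts = {x. (\<forall>j<k. x j \<in> pts L) \<and> (\<forall>j\<ge>k. x j = 0)}\<rparr>"

abbreviation hyp_power :: "'f::field quad_ext \<Rightarrow> nat \<Rightarrow> ('f, nat \<Rightarrow> nat \<Rightarrow> 'f) herm" where
  "hyp_power E k \<equiv> herm_power k (hyp_plane E)"


section \<open>Primitive local densities\<close>

definition scaled :: "'f \<Rightarrow> ('f, 'v) herm \<Rightarrow> 'v set" where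
  "scaled a L = smul L a ` pts L"

text \<open>\<open>W \<subseteq> L / \<pi>L\<close> is a subspace of dimension \<open>r\<close> over the residue field \<open>O\<^sub>F / (\<pi>)\<close>, which is also
  the residue field of \<open>F\<^sub>0\<close>: it is spanned by the classes of vectors \<open>b 0, \<dots>, b (r - 1)\<close> of \<open>L\<close> that
  are linearly independent modulo \<open>\<pi>\<close>.\<close>

definition has_residue_dim ::
  "'f::field quad_ext \<Rightarrow> ('f, 'v::ab_group_add) herm \<Rightarrow> 'v set set \<Rightarrow> nat \<Rightarrow> bool" where
  "has_residue_dim E L W r \<longleftrightarrow> (\<exists>b. (\<forall>i<r. b i \<in> pts L) \<and>
     (\<forall>c. (\<forall>i<r. c i \<in> ringF E) \<longrightarrow> (\<Sum>i<r. smul L (c i) (b i)) \<in> scaled (unif E) L \<longrightarrow>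
        (\<forall>i<r. c i \<in> val_ideal UNIV (val E) 1)) \<and>
     W = {coset (scaled (unif E) L) (\<Sum>i<r. smul L (c i) (b i)) | c. \<forall>i<r. c i \<in> ringF E})"

definition Gr :: "'f::field quad_ext \<Rightarrow> nat \<Rightarrow> ('f, 'v::ab_group_add) herm \<Rightarrow> 'v set set set" where
  "Gr E i L = {W. has_residue_dim E L W i}"

definition mod_pi0 :: "'f::field quad_ext \<Rightarrow> nat \<Rightarrow> ('f, 'v::ab_group_add) herm \<Rightarrow> 'v \<Rightarrow> 'v set" where
  "mod_pi0 E d L x = coset (scaled (pi0 E ^ d) L) x"

text \<open>Hermitian \<open>O\<^sub>F\<close>-module homomorphisms between the reductions modulo \<open>\<pi>\<^sub>0\<^sup>d\<close>. The forms take values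
  in the inverse different \<open>\<pi>\<^sup>-\<^sup>1 O\<^sub>F\<close> (this is needed for the hyperbolic plane), so after base change
  to \<open>O\<^sub>F\<^sub>0 / (\<pi>\<^sub>0\<^sup>d)\<close> their values are compared in \<open>\<pi>\<^sup>-\<^sup>1 O\<^sub>F / \<pi>\<^sub>0\<^sup>d \<pi>\<^sup>-\<^sup>1 O\<^sub>F\<close>.\<close>

definition herm_homs ::
  "'f::field quad_ext \<Rightarrow> nat \<Rightarrow> ('f, 'l::ab_group_add) herm \<Rightarrow> ('f, 'm::ab_group_add) herm \<Rightarrow>
   ('l set \<Rightarrow> 'm set) set" where
  "herm_homs E d L M =
     {\<phi> \<in> quot (pts L) (scaled (pi0 E ^ d) L) \<rightarrow>\<^sub>E quot (pts M) (scaled (pi0 E ^ d) M).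
        \<forall>x\<in>pts L. \<forall>y\<in>pts L. \<forall>x'\<in>\<phi> (mod_pi0 E d L x). \<forall>y'\<in>\<phi> (mod_pi0 E d L y).
          \<phi> (mod_pi0 E d L (x + y)) = mod_pi0 E d M (x' + y') \<and>
          (\<forall>a\<in>ringF E. \<phi> (mod_pi0 E d L (smul L a x)) = mod_pi0 E d M (smul M a x')) \<and>
          form M x' y' - form L x y \<in> (\<lambda>a. pi0 E ^ d * inverse (unif E) * a) ` ringF E}"

definition prim_homs ::
  "'f::field quad_ext \<Rightarrow> nat \<Rightarrow> ('f, 'l::ab_group_add) herm \<Rightarrow> ('f, 'm::ab_group_add) herm \<Rightarrow>
   ('l set \<Rightarrow> 'm set) set" where
  "prim_homs E d L M = {\<phi> \<in> herm_homs E d L M.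
     has_residue_dim E M
       {coset (scaled (unif E) M) y | y. \<exists>x\<in>pts L. y \<in> \<phi> (mod_pi0 E d L x)} (lat_rank L)}"

definition prim_seq ::
  "'f::field quad_ext \<Rightarrow> ('f, 'm::ab_group_add) herm \<Rightarrow> ('f, 'l::ab_group_add) herm \<Rightarrow> nat \<Rightarrow> real" where
  "prim_seq E M L d =
     real (resq E) powi (- (int d * int (lat_rank L) * (2 * int (lat_rank M) - int (lat_rank L)))) *
     real (card (prim_homs E d L M))"

definition prim_density ::
  "'f::field quad_ext \<Rightarrow> ('f, 'm::ab_group_add) herm \<Rightarrow> ('f, 'l::ab_group_add) herm \<Rightarrow> real" where
  "prim_density E M L = lim (prim_seq E M L)"

definition is_Pden_poly ::
  "'f::field quad_ext \<Rightarrow> ('f, 'm::ab_group_add) herm \<Rightarrow> ('f, 'l::ab_group_add) herm \<Rightarrow> rat poly \<Rightarrow> bool" where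
  "is_Pden_poly E M L P \<longleftrightarrow> (\<forall>k::nat. prim_seq E (herm_sum M (hyp_power E k)) L
     \<longlonglongrightarrow> poly (map_poly of_rat P) (real (resq E) powi (- 2 * int k)))"

definition Pden_poly ::
  "'f::field quad_ext \<Rightarrow> ('f, 'm::ab_group_add) herm \<Rightarrow> ('f, 'l::ab_group_add) herm \<Rightarrow> rat poly" where
  "Pden_poly E M L = (THE P. is_Pden_poly E M L P)"

definition Pden ::
  "'f::field quad_ext \<Rightarrow> ('f, 'm::ab_group_add) herm \<Rightarrow> ('f, 'l::ab_group_add) herm \<Rightarrow> rat" where
  "Pden E M L = poly (Pden_poly E M L) 1"

definition is_lift ::
  "'f::field quad_ext \<Rightarrow> nat \<Rightarrow> ('f, 'l::ab_group_add) herm \<Rightarrow> 'l set set \<Rightarrow> 'l set \<Rightarrow> bool" where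
  "is_lift E i L V N \<longleftrightarrow> N \<subseteq> pts L \<and> hermitian_lattice E (L\<lparr>pts := N\<rparr>) \<and>
     lat_rank (L\<lparr>pts := N\<rparr>) = i \<and> quot N (scaled (unif E) L) = V"

text \<open>The defining property of \<open>Pden\<^sup>n\<^sup>-\<^sup>i(M, L, X)\<close>, where \<open>n = lat_rank L\<close> and \<open>S V\<close> is the chosen
  sublattice lifting the subspace \<open>V\<close> of \<open>L / \<pi>L\<close>.\<close>

definition is_Pden_part ::
  "'f::field quad_ext \<Rightarrow> ('f, 'm::ab_group_add) herm \<Rightarrow> ('f, 'l::ab_group_add) herm \<Rightarrow>
   ('l set set \<Rightarrow> 'l set) \<Rightarrow> nat \<Rightarrow> rat poly \<Rightarrow> bool" where
  "is_Pden_part E M L S i P \<longleftrightarrow> (\<forall>k::nat.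
     poly (map_poly of_rat P) (real (resq E) powi (- 2 * int k)) =
       real (resq E) powi (- 2 * int k * int i) *
       prim_density E (hyp_power E k) (null_lattice E (lat_rank L - i)) *
       (\<Sum>V\<in>Gr E i L. real (resq E) ^ ((lat_rank L - i) * i) * of_rat (Pden E M (L\<lparr>pts := S V\<rparr>))))"

definition Pden_part ::
  "'f::field quad_ext \<Rightarrow> ('f, 'm::ab_group_add) herm \<Rightarrow> ('f, 'l::ab_group_add) herm \<Rightarrow>
   ('l set set \<Rightarrow> 'l set) \<Rightarrow> nat \<Rightarrow> rat poly" where
  "Pden_part E M L S i = (THE P. is_Pden_part E M L S i P)"

end

theory Submission
  imports Defs
begin

text \<open>
  All densities are computed by counting cosets. A homomorphism \<open>\<phi>\<close> into \<open>I \<bottom> H\<^sup>k\<close> induces a linear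
  map \<open>L / \<pi>L \<rightarrow> H\<^sup>k / \<pi>H\<^sup>k\<close>; let \<open>V\<close> be its kernel and \<open>i\<close> the dimension of \<open>V\<close>. In a basis of \<open>L\<close>
  adapted to \<open>V\<close>, \<open>\<phi>\<close> is primitive with kernel \<open>V\<close> iff the first \<open>i\<close> basis vectors have images whose
  \<open>H\<^sup>k\<close>-components are divisible by \<open>\<pi>\<close> and whose \<open>I\<close>-components are independent modulo \<open>\<pi>\<close>, while the
  \<open>H\<^sup>k\<close>-components of the other images are independent modulo \<open>\<pi>\<close>. Since \<open>I\<close> is unimodular and the form
  of \<open>H\<^sup>k\<close> is perfect with values in \<open>\<pi>\<^sup>-\<^sup>1 O\<^sub>F\<close>, such a frame can be deformed so as to correct its Gram
  matrix; hence refining the congruence for the Gram matrix by one power of \<open>\<pi>\<close> divides the number of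
  solutions by a constant. This is Hensel's lemma in counting form, and completeness is not needed. There
  remain two counts over the residue field: the frames of \<open>I / \<pi>I\<close> with the Gram matrix of \<open>L\<^sub>V\<close>, which
  give \<open>Pden(I, L\<^sub>V)\<close>, and the isotropic frames of the symplectic space \<open>H\<^sup>k / \<pi>H\<^sup>k\<close>, which give
  \<open>Pden(H\<^sup>k, 0)\<close>.
\<close>

section \<open>Counting cosets\<close>

text \<open>The two summands carry forms of different level. On \<open>I\<close>, residues modulo
  \<pi> fix inner products modulo \<pi>; on \<open>H\<^sup>k\<close> they fix them only modulo O_F,
  because the values lie in \<pi>^{-1} O_F. The residues of a frame adapted to \<open>V\<close>
  therefore control its Gram matrix modulo \<pi> among the first i vectors and only modulo O_F
  elsewhere. Lifting starts from these unequal levels (1, 0, 0), equalises them to (1, 1, 1) and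
  climbs uniformly to 2d - 1, the level at which forms are compared modulo
  \<open>\<pi>\<^sub>0\<^sup>d\<close>. Two uniform steps cost q^(n^2), since diagonal entries lie
  in \<open>F\<^sub>0\<close>, where valuations are even. This cancels the dependence on d: every
  density sequence that occurs is constant from d = 1 on, and no limit has to be estimated. The
  factor q^(-2ki) accounts for the i images forced to vanish in
  \<open>H\<^sup>k / \<pi>H\<^sup>k\<close>, which has q^(2k) elements. Polynomials are determined
  by their values at the points q^(-2k), so one count for each k suffices. The value at X = 1 is the
  case k = 0, where \<open>H\<^sup>0\<close> is zero and only V = L / \<pi>L can occur.\<close>

definition subgrp :: "'a::ab_group_add set \<Rightarrow> bool" where
  "subgrp K \<longleftrightarrow> 0 \<in> K \<and> (\<forall>x\<in>K. \<forall>y\<in>K. x - y \<in> K)"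

lemma subgrpI: "0 \<in> K \<Longrightarrow> (\<And>x y. x \<in> K \<Longrightarrow> y \<in> K \<Longrightarrow> x - y \<in> K) \<Longrightarrow> subgrp K"
  by (simp add: subgrp_def)

lemma subgrp_0: "subgrp K \<Longrightarrow> 0 \<in> K"
  and subgrp_diff: "subgrp K \<Longrightarrow> x \<in> K \<Longrightarrow> y \<in> K \<Longrightarrow> x - y \<in> K"
  by (simp_all add: subgrp_def)

lemma subgrp_uminus: "subgrp K \<Longrightarrow> x \<in> K \<Longrightarrow> - x \<in> K"
  using subgrp_diff[of K 0 x] by (simp add: subgrp_0)

lemma subgrp_minus_iff: "subgrp K \<Longrightarrow> - x \<in> K \<longleftrightarrow> x \<in> K"
  using subgrp_uminus[of K "- x"] subgrp_uminus[of K x] by auto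

lemma subgrp_diff_commute: "subgrp K \<Longrightarrow> x - y \<in> K \<Longrightarrow> y - x \<in> K"
  using subgrp_uminus[of K "x - y"] by simp

lemma subgrp_add: "subgrp K \<Longrightarrow> x \<in> K \<Longrightarrow> y \<in> K \<Longrightarrow> x + y \<in> K"
  using subgrp_diff[of K x "- y"] by (simp add: subgrp_uminus)

lemma subgrp_sum: "subgrp K \<Longrightarrow> (\<And>j. j \<in> J \<Longrightarrow> f j \<in> K) \<Longrightarrow> sum f J \<in> K"
  by (induction J rule: infinite_finite_induct) (auto simp: subgrp_0 subgrp_add)

lemma subgrp_add_cancel: "subgrp K \<Longrightarrow> y \<in> K \<Longrightarrow> x + y \<in> K \<longleftrightarrow> x \<in> K"
  using subgrp_diff[of K "x + y" y] subgrp_add[of K x y] by auto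

lemma subgrp_cong_iff: "subgrp K \<Longrightarrow> x - y \<in> K \<Longrightarrow> x \<in> K \<longleftrightarrow> y \<in> K"
  using subgrp_add_cancel[of K "x - y" y] subgrp_diff[of K x "x - y"] subgrp_add[of K "x - y" y]
  by auto

lemma subgrp_cancel_left: "subgrp K \<Longrightarrow> y + x \<in> K \<Longrightarrow> y \<in> K \<Longrightarrow> x \<in> K"
  using subgrp_diff[of K "y + x" y] by simp

lemma subgrp_cancel_right: "subgrp K \<Longrightarrow> y + x \<in> K \<Longrightarrow> x \<in> K \<Longrightarrow> y \<in> K"
  using subgrp_diff[of K "y + x" x] by simp

lemma subgrp_Times: "subgrp K \<Longrightarrow> subgrp L \<Longrightarrow> subgrp (K \<times> L)"
  by (auto simp: subgrp_def zero_prod_def)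

lemma mem_coset: "y \<in> coset K x \<longleftrightarrow> y - x \<in> K"
  unfolding coset_def image_iff by (metis add.commute add_diff_cancel diff_add_cancel)

lemma coset_eq_iff:
  assumes K: "subgrp K"
  shows "coset K x = coset K y \<longleftrightarrow> x - y \<in> K"
proof
  show "x - y \<in> K" if "coset K x = coset K y"
    using that mem_coset[of x K x] mem_coset[of x K y] subgrp_0[OF K] by simp
  assume xy: "x - y \<in> K"
  have "z - x \<in> K \<longleftrightarrow> z - y \<in> K" for z
    using subgrp_cong_iff[OF K, of "z - y" "z - x"] xy by simp
  then show "coset K x = coset K y" by (auto simp: mem_coset)
qed

lemma coset_self: "subgrp K \<Longrightarrow> x \<in> coset K x"
  by (simp add: mem_coset subgrp_0)

text \<open>Applying \<open>f\<close> to chosen representatives gives a bijection of cosets: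
  \<open>iff\<close> makes it well defined and injective, \<open>onto\<close> makes it surjective.
  Neither \<open>A\<close> nor \<open>A'\<close> has to be a union of cosets.\<close>

lemma card_quot_eqI:
  assumes K: "subgrp K" and K': "subgrp K'"
    and f: "\<And>x. x \<in> A \<Longrightarrow> f x \<in> A'"
    and onto: "\<And>y. y \<in> A' \<Longrightarrow> \<exists>x\<in>A. f x - y \<in> K'"
    and iff: "\<And>x y. x \<in> A \<Longrightarrow> y \<in> A \<Longrightarrow> f x - f y \<in> K' \<longleftrightarrow> x - y \<in> K"
  shows "card (quot A K) = card (quot A' K')"
proof -
  define r where "r X = (SOME x. x \<in> A \<and> coset K x = X)" for X
  have r: "r X \<in> A" "coset K (r X) = X" if "X \<in> quot A K" for X
    using that someI_ex[of "\<lambda>x. x \<in> A \<and> coset K x = X"] by (auto simp: r_def quot_def)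
  have "bij_betw (\<lambda>X. coset K' (f (r X))) (quot A K) (quot A' K')"
  proof (intro bij_betw_imageI inj_onI equalityI[of "_ ` _"] subsetI)
    fix X Y assume X: "X \<in> quot A K" and Y: "Y \<in> quot A K"
      and eq: "coset K' (f (r X)) = coset K' (f (r Y))"
    then have "r X - r Y \<in> K"
      using iff[OF r(1)[OF X] r(1)[OF Y]] coset_eq_iff[OF K'] by simp
    then show "X = Y" using coset_eq_iff[OF K] r(2)[OF X] r(2)[OF Y] by metis
  next
    fix Y assume "Y \<in> (\<lambda>X. coset K' (f (r X))) ` quot A K"
    then show "Y \<in> quot A' K'" using f r by (auto simp: quot_def)
  next
    fix Y assume "Y \<in> quot A' K'"
    then obtain y where y: "y \<in> A'" "Y = coset K' y" by (auto simp: quot_def)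
    obtain x where x: "x \<in> A" "f x - y \<in> K'" using onto[OF y(1)] by blast
    have X: "coset K x \<in> quot A K" using x by (auto simp: quot_def)
    have "r (coset K x) - x \<in> K" using r(2)[OF X] coset_eq_iff[OF K] by blast
    then have "f (r (coset K x)) - f x \<in> K'" using iff r(1)[OF X] x(1) by blast
    then have "f (r (coset K x)) - y \<in> K'" using subgrp_add[OF K' _ x(2)] by fastforce
    then show "Y \<in> (\<lambda>X. coset K' (f (r X))) ` quot A K"
      using X y(2) coset_eq_iff[OF K'] by blast
  qed
  then show ?thesis by (rule bij_betw_same_card)
qed

lemma card_quot_Times:
  assumes "subgrp K" "subgrp L"
  shows "card (quot (A \<times> B) (K \<times> L)) = card (quot A K) * card (quot B L)"
proof -
  have eq: "coset (K \<times> L) (a, b) = coset K a \<times> coset L b" for a b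
    by (auto simp: mem_coset)
  have ne: "X \<noteq> {}" if "X \<in> quot A K" for X
    using that coset_self[OF assms(1)] by (auto simp: quot_def)
  have ne': "X \<noteq> {}" if "X \<in> quot B L" for X
    using that coset_self[OF assms(2)] by (auto simp: quot_def)
  have "bij_betw (\<lambda>(X, Y). X \<times> Y) (quot A K \<times> quot B L) (quot (A \<times> B) (K \<times> L))"
    unfolding bij_betw_def
  proof
    show "inj_on (\<lambda>(X, Y). X \<times> Y) (quot A K \<times> quot B L)"
      using ne ne' by (auto simp: inj_on_def times_eq_iff)
    show "(\<lambda>(X, Y). X \<times> Y) ` (quot A K \<times> quot B L) = quot (A \<times> B) (K \<times> L)"
      by (force simp: quot_def eq)
  qed
  then show ?thesis by (metis bij_betw_same_card card_cartesian_product)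
qed

text \<open>An element of \<open>A\<close> amounts to its \<open>B\<close>-coset together with its
  offset from the representative of that coset chosen by \<open>r\<close>. Periodicity of
  \<open>A\<close> under \<open>B\<close> lets every pair of coset and offset occur.\<close>

lemma card_quot_mult:
  assumes K: "subgrp K" and B: "subgrp B" and KB: "K \<subseteq> B"
    and per: "\<And>a b. a \<in> A \<Longrightarrow> b \<in> B \<Longrightarrow> a + b \<in> A"
  shows "card (quot A K) = card (quot A B) * card (quot B K)"
proof -
  define r where "r X = (SOME x. x \<in> X)" for X :: "'a set"
  have r: "r (coset B x) - x \<in> B" for x
    using someI[of "\<lambda>y. y \<in> coset B x", OF coset_self[OF B]] by (simp add: r_def mem_coset)
  have per': "a - b \<in> A" if "a \<in> A" "b \<in> B" for a b
    using per[OF that(1) subgrp_uminus[OF B that(2)]] by simp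
  have "card (quot A K) = card (quot (A \<times> B) (B \<times> K))"
  proof (rule card_quot_eqI[where f = "\<lambda>x. (x, x - r (coset B x))"])
    show "subgrp K" "subgrp (B \<times> K)" using K B by (auto intro: subgrp_Times)
    show "(x, x - r (coset B x)) \<in> A \<times> B" if "x \<in> A" for x
      using that subgrp_diff_commute[OF B r] by simp
    show "\<exists>x\<in>A. (x, x - r (coset B x)) - y \<in> B \<times> K" if y: "y \<in> A \<times> B" for y
    proof -
      obtain a b where ab: "y = (a, b)" "a \<in> A" "b \<in> B" using y by auto
      \<comment> \<open>The element with the coset of \<open>a\<close> and the offset
        \<open>b\<close>.\<close>
      define x where "x = r (coset B a) + b"
      have x: "x - a \<in> B" using subgrp_add[OF B r ab(3), of a] by (simp add: x_def algebra_simps)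
      have "coset B x = coset B a" using x coset_eq_iff[OF B] by blast
      then have "(x, x - r (coset B x)) - y \<in> B \<times> K"
        using x by (simp add: ab x_def subgrp_0[OF K])
      moreover have "x \<in> A" using per[OF ab(2) x] by simp
      ultimately show ?thesis by (rule rev_bexI[rotated])
    qed
    show "(x, x - r (coset B x)) - (y, y - r (coset B y)) \<in> B \<times> K \<longleftrightarrow> x - y \<in> K" for x y
    proof (cases "x - y \<in> B")
      case True
      then have "coset B x = coset B y" using coset_eq_iff[OF B] by blast
      then show ?thesis using True by simp
    qed (use KB in auto)
  qed
  then show ?thesis using card_quot_Times[OF B K] by simp
qed

lemma card_quot_self: "subgrp K \<Longrightarrow> card (quot K K) = 1"
proof -
  assume K: "subgrp K"
  have "quot K K = {coset K 0}"
    using coset_eq_iff[OF K] subgrp_0[OF K] by (fastforce simp: quot_def)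
  then show ?thesis by simp
qed

lemma card_quot_second_iso:
  assumes G: "subgrp G" and K: "subgrp K"
  shows "card (quot {x + y | x y. x \<in> G \<and> y \<in> K} K) = card (quot G (G \<inter> K))"
proof (rule card_quot_eqI[where f = id, symmetric])
  show "subgrp (G \<inter> K)" using G K by (auto simp: subgrp_def)
  show "id x \<in> {x + y | x y. x \<in> G \<and> y \<in> K}" if "x \<in> G" for x
    using that subgrp_0[OF K] by force
  show "\<exists>x\<in>G. id x - z \<in> K" if "z \<in> {x + y | x y. x \<in> G \<and> y \<in> K}" for z
    using that subgrp_uminus[OF K] by force
  show "id x - id y \<in> K \<longleftrightarrow> x - y \<in> G \<inter> K" if "x \<in> G" "y \<in> G" for x y
    using subgrp_diff[OF G that] by simp
qed (rule K)

lemma card_quot_direct_sum: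
  assumes G: "subgrp G" and H: "subgrp H" and GH: "G \<inter> H = {0}"
    and K: "subgrp K" "K \<subseteq> G" and L: "subgrp L" "L \<subseteq> H"
    and A: "A \<subseteq> G" and B: "B \<subseteq> H"
  shows "card (quot {x + y | x y. x \<in> A \<and> y \<in> B} {x + y | x y. x \<in> K \<and> y \<in> L}) =
    card (quot A K) * card (quot B L)"
proof -
  have sg: "subgrp {x + y | x y. x \<in> K \<and> y \<in> L}" (is "subgrp ?S")
  proof (rule subgrpI)
    show "0 \<in> ?S" using subgrp_0[OF K(1)] subgrp_0[OF L(1)] by force
    fix u v assume "u \<in> ?S" "v \<in> ?S"
    then obtain x y x' y' where "u = x + y" "v = x' + y'" "x \<in> K" "x' \<in> K" "y \<in> L" "y' \<in> L"
      by auto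
    then have "u - v = (x - x') + (y - y')" "x - x' \<in> K" "y - y' \<in> L"
      using K(1) L(1) by (simp_all add: subgrp_diff)
    then show "u - v \<in> ?S" by blast
  qed
  have "card (quot (A \<times> B) (K \<times> L)) =
    card (quot {x + y | x y. x \<in> A \<and> y \<in> B} {x + y | x y. x \<in> K \<and> y \<in> L})"
  proof (rule card_quot_eqI[where f = "\<lambda>z. fst z + snd z"])
    show "subgrp (K \<times> L)" using K L by (simp add: subgrp_Times)
    show "fst z + snd z \<in> {x + y | x y. x \<in> A \<and> y \<in> B}" if "z \<in> A \<times> B" for z
      using that by (cases z) auto
    show "\<exists>z\<in>A \<times> B. fst z + snd z - y \<in> ?S" if y: "y \<in> {x + y | x y. x \<in> A \<and> y \<in> B}" for y
    proof -
      obtain a b where "y = a + b" "a \<in> A" "b \<in> B" using y by auto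
      then show ?thesis using subgrp_0[OF sg] by (intro bexI[of _ "(a, b)"]) auto
    qed
    show "fst z + snd z - (fst w + snd w) \<in> ?S \<longleftrightarrow> z - w \<in> K \<times> L"
      if z: "z \<in> A \<times> B" and w: "w \<in> A \<times> B" for z w
    proof
      assume "fst z + snd z - (fst w + snd w) \<in> ?S"
      then obtain x y where xy: "fst z + snd z - (fst w + snd w) = x + y" "x \<in> K" "y \<in> L" by auto
      have e: "fst z - fst w - x = y - (snd z - snd w)" using xy(1) by (simp add: algebra_simps)
      have "fst z - fst w - x \<in> G" using z w A xy(2) K G by (auto intro!: subgrp_diff[OF G])
      moreover have "fst z - fst w - x \<in> H" unfolding e using z w B xy(3) L H by (auto intro!: subgrp_diff[OF H])
      ultimately have "fst z - fst w - x \<in> G \<inter> H" by (rule IntI)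
      then have "fst z - fst w - x = 0" using GH by blast
      then have "fst z - fst w = x" "snd z - snd w = y" using e by auto
      then show "z - w \<in> K \<times> L" using xy by (auto simp: mem_Times_iff)
    next
      assume "z - w \<in> K \<times> L"
      then have "fst z - fst w \<in> K" "snd z - snd w \<in> L" by (auto simp: mem_Times_iff)
      moreover have "fst z + snd z - (fst w + snd w) = (fst z - fst w) + (snd z - snd w)" by simp
      ultimately show "fst z + snd z - (fst w + snd w) \<in> ?S" by blast
    qed
  qed (rule sg)
  then show ?thesis using card_quot_Times[OF K(1) L(1)] by simp
qed

text \<open>The value 0 outside \<open>J\<close> makes families over different index sets elements
  of one function type, so that \<open>quot\<close> and pointwise addition apply and a vector is
  dropped by updating it to 0.\<close>

definition FS :: "'i set \<Rightarrow> ('i \<Rightarrow> 'a::zero set) \<Rightarrow> ('i \<Rightarrow> 'a) set" where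
  "FS J A = {t. (\<forall>j\<in>J. t j \<in> A j) \<and> (\<forall>j. j \<notin> J \<longrightarrow> t j = 0)}"

lemma FS_D: "t \<in> FS J A \<Longrightarrow> j \<in> J \<Longrightarrow> t j \<in> A j"
  and FS_out: "t \<in> FS J A \<Longrightarrow> j \<notin> J \<Longrightarrow> t j = 0"
  and FS_I: "(\<And>j. j \<in> J \<Longrightarrow> t j \<in> A j) \<Longrightarrow> (\<And>j. j \<notin> J \<Longrightarrow> t j = 0) \<Longrightarrow> t \<in> FS J A"
  by (auto simp: FS_def)

lemma subgrp_FS: "(\<And>j. j \<in> J \<Longrightarrow> subgrp (A j)) \<Longrightarrow> subgrp (FS J A)"
  by (auto simp: subgrp_def FS_def)

lemma FS_mono: "(\<And>j. j \<in> J \<Longrightarrow> A j \<subseteq> B j) \<Longrightarrow> FS J A \<subseteq> FS J B"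
  by (auto simp: FS_def)

lemma card_quot_FS:
  assumes "finite J" "\<And>j. j \<in> J \<Longrightarrow> subgrp (B j)"
  shows "card (quot (FS J A) (FS J B)) = (\<Prod>j\<in>J. card (quot (A j) (B j)))"
  using assms
proof (induction J rule: finite_induct)
  case empty
  have "FS {} A = {0}" "FS {} B = {0}" by (auto simp: FS_def)
  then show ?case by (simp add: quot_def)
next
  case (insert i J)
  have "card (quot (FS (insert i J) A) (FS (insert i J) B)) =
    card (quot (A i \<times> FS J A) (B i \<times> FS J B))"
  proof (rule card_quot_eqI[where f = "\<lambda>t. (t i, t(i := 0))"])
    show "subgrp (FS (insert i J) B)" "subgrp (B i \<times> FS J B)"
      using insert by (auto intro!: subgrp_FS subgrp_Times)
    show "(t i, t(i := 0)) \<in> A i \<times> FS J A" if "t \<in> FS (insert i J) A" for t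
      using that insert.hyps by (auto simp: FS_def)
    show "\<exists>t\<in>FS (insert i J) A. (t i, t(i := 0)) - y \<in> B i \<times> FS J B" if "y \<in> A i \<times> FS J A" for y
    proof -
      obtain a s where y: "y = (a, s)" "a \<in> A i" "s \<in> FS J A" using \<open>y \<in> _\<close> by auto
      have "s(i := a) \<in> FS (insert i J) A" using y by (auto simp: FS_def)
      moreover have "((s(i := a)) i, (s(i := a))(i := 0)) - y = 0"
        using y insert.hyps by (auto simp: FS_def fun_eq_iff zero_prod_def)
      moreover have "0 \<in> B i \<times> FS J B"
        using insert by (intro subgrp_0 subgrp_Times subgrp_FS) auto
      ultimately show ?thesis by (metis (full_types))
    qed
    show "(t i, t(i := 0)) - (s i, s(i := 0)) \<in> B i \<times> FS J B \<longleftrightarrow> t - s \<in> FS (insert i J) B"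
      if "t \<in> FS (insert i J) A" "s \<in> FS (insert i J) A" for t s
      using that insert.hyps by (auto simp: FS_def fun_diff_def)
  qed
  then show ?case using insert by (subst (asm) card_quot_Times) (auto intro: subgrp_FS)
qed

text \<open>The counting form of Hensel's lemma: since the shift \<open>b\<close> may be chosen to depend only on the
  \<open>B\<close>-coset of \<open>a\<close>, adding it is a bijection between the fibres of \<open>f\<close> modulo \<open>C\<close>.\<close>

lemma card_quot_equidistributed:
  assumes K: "subgrp K" and B: "subgrp B" and KB: "K \<subseteq> B" and C: "subgrp C"
    and D: "subgrp D" and CD: "C \<subseteq> D"
    and per: "\<And>a b. a \<in> A \<Longrightarrow> b \<in> B \<Longrightarrow> a + b \<in> A"
    and fD: "\<And>a. a \<in> A \<Longrightarrow> f a \<in> D"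
    and inv: "\<And>a k. a \<in> A \<Longrightarrow> k \<in> K \<Longrightarrow> f (a + k) - f a \<in> C"
    and shift: "\<And>a t. a \<in> A \<Longrightarrow> t \<in> D \<Longrightarrow> \<exists>b\<in>B. \<forall>b'\<in>B. f (a + b' + b) - f (a + b') - t \<in> C"
  shows "card (quot A K) = card (quot D C) * card (quot {a \<in> A. f a \<in> C} K)"
proof -
  \<comment> \<open>For \<open>X\<close> the \<open>B\<close>-coset of \<open>a\<close> and
    \<open>Y\<close> the \<open>C\<close>-coset of \<open>t\<close>, one shift that lowers
    \<open>f\<close> by \<open>t\<close> modulo \<open>C\<close> on all of \<open>X\<close>. It is
    applied with \<open>t\<close> equal to \<open>f a\<close>.\<close>
  define \<beta> where "\<beta> X Y = (SOME b. b \<in> B \<and> (\<forall>a\<in>X. \<forall>t\<in>Y. f (a + b) - f a + t \<in> C))" for X Y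
  have \<beta>: "\<beta> (coset B a) (coset C t) \<in> B"
    "f (a + \<beta> (coset B a) (coset C t)) - f a + t \<in> C" if at: "a \<in> A" "t \<in> D" for a t
  proof -
    have "- t \<in> D" using D at by (simp add: subgrp_uminus)
    then obtain b where b: "b \<in> B" "\<And>b'. b' \<in> B \<Longrightarrow> f (a + b' + b) - f (a + b') + t \<in> C"
      using shift[OF at(1), of "- t"] by (metis diff_minus_eq_add)
    have "b \<in> B \<and> (\<forall>x\<in>coset B a. \<forall>s\<in>coset C t. f (x + b) - f x + s \<in> C)"
    proof (intro conjI ballI)
      show "b \<in> B" by (rule b)
      fix x s assume "x \<in> coset B a" "s \<in> coset C t"
      then have x: "x - a \<in> B" and s: "s - t \<in> C" by (auto simp: mem_coset)
      show "f (x + b) - f x + s \<in> C" using subgrp_add[OF C b(2)[OF x] s] by simp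
    qed
    then have "\<beta> (coset B a) (coset C t) \<in> B \<and> (\<forall>x\<in>coset B a. \<forall>s\<in>coset C t.
      f (x + \<beta> (coset B a) (coset C t)) - f x + s \<in> C)"
      unfolding \<beta>_def by (rule someI)
    then show "\<beta> (coset B a) (coset C t) \<in> B"
      "f (a + \<beta> (coset B a) (coset C t)) - f a + t \<in> C"
      using coset_self[OF B] coset_self[OF C] by blast+
  qed
  \<comment> \<open>Recording \<open>f a\<close> and then moving \<open>a\<close> into the zero
    fibre loses nothing: the shift is a function of two cosets, and as it lies in \<open>B\<close>
    it does not change the first of them, so it can be undone.\<close>
  have "card (quot A K) = card (quot (D \<times> {a \<in> A. f a \<in> C}) (C \<times> K))"
  proof (rule card_quot_eqI[where f = "\<lambda>a. (f a, a + \<beta> (coset B a) (coset C (f a)))"])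
    show "subgrp K" "subgrp (C \<times> K)" using C K by (auto intro: subgrp_Times)
    show "(f a, a + \<beta> (coset B a) (coset C (f a))) \<in> D \<times> {a \<in> A. f a \<in> C}" if a: "a \<in> A" for a
      using \<beta>[OF a fD[OF a]] fD[OF a] per[OF a] by simp
    show "\<exists>x\<in>A. (f x, x + \<beta> (coset B x) (coset C (f x))) - y \<in> C \<times> K"
      if y: "y \<in> D \<times> {a \<in> A. f a \<in> C}" for y
    proof -
      obtain t a where ta: "y = (t, a)" "t \<in> D" "a \<in> A" "f a \<in> C" using y by auto
      define b where "b = \<beta> (coset B a) (coset C t)"
      have bB: "b \<in> B" unfolding b_def by (rule \<beta>[OF ta(3,2)])
      have x: "a - b \<in> A" using per[OF ta(3) subgrp_uminus[OF B bB]] by simp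
      have c: "coset B (a - b) = coset B a"
        using coset_eq_iff[OF B, of "a - b" a] subgrp_uminus[OF B bB] by simp
      have "f a - f (a - b) + t \<in> C" using \<beta>(2)[OF x ta(2)] c by (simp add: b_def)
      then have ft: "f (a - b) - t \<in> C" using subgrp_diff[OF C ta(4)] by (fastforce simp: algebra_simps)
      then have "coset C (f (a - b)) = coset C t" using coset_eq_iff[OF C] by blast
      then have "(f (a - b), a - b + \<beta> (coset B (a - b)) (coset C (f (a - b)))) - y \<in> C \<times> K"
        using c ft by (simp add: ta b_def[symmetric] subgrp_0[OF K])
      then show ?thesis using x by (rule bexI)
    qed
    show "(f x, x + \<beta> (coset B x) (coset C (f x))) - (f y, y + \<beta> (coset B y) (coset C (f y)))
        \<in> C \<times> K \<longleftrightarrow> x - y \<in> K" if x: "x \<in> A" and y: "y \<in> A" for x y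
    proof
      assume xy: "x - y \<in> K"
      then have "coset B x = coset B y" using coset_eq_iff[OF B] KB by blast
      moreover have fxy: "f x - f y \<in> C" using inv[OF y xy] by simp
      then have "coset C (f x) = coset C (f y)" using coset_eq_iff[OF C] by blast
      ultimately show "(f x, x + \<beta> (coset B x) (coset C (f x))) -
        (f y, y + \<beta> (coset B y) (coset C (f y))) \<in> C \<times> K" using xy fxy by simp
    next
      assume "(f x, x + \<beta> (coset B x) (coset C (f x))) -
        (f y, y + \<beta> (coset B y) (coset C (f y))) \<in> C \<times> K"
      then have fxy: "f x - f y \<in> C" and
        k: "x + \<beta> (coset B x) (coset C (f x)) - (y + \<beta> (coset B y) (coset C (f y))) \<in> K" by auto
      have e: "x - y = (x + \<beta> (coset B x) (coset C (f x)) - (y + \<beta> (coset B y) (coset C (f y))))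
        - \<beta> (coset B x) (coset C (f x)) + \<beta> (coset B y) (coset C (f y))" by simp
      have "x - y \<in> B"
        using subgrp_add[OF B subgrp_diff[OF B subsetD[OF KB k] \<beta>(1)[OF x fD[OF x]]]
          \<beta>(1)[OF y fD[OF y]]] by (simp only: e)
      then have "coset B x = coset B y" using coset_eq_iff[OF B] by blast
      moreover have "coset C (f x) = coset C (f y)" using fxy coset_eq_iff[OF C] by blast
      ultimately show "x - y \<in> K" using k by simp
    qed
  qed
  then show ?thesis using card_quot_Times[OF C K] by simp
qed

section \<open>The ramified quadratic extension\<close>

locale ramified_ext =
  fixes p :: nat and E :: "'f::field_char_0 quad_ext"
  assumes ramified: "ramified_quadratic_ext p E"
begin

text \<open>The fractional ideal \<pi>^e O_F for any integer e: \<open>pw 0\<close> is O_F,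
  \<open>pw 1\<close> its maximal ideal, and \<open>pw (- 1)\<close> the inverse different, where
  the form of the hyperbolic plane takes its values.\<close>

abbreviation "pw \<equiv> val_ideal UNIV (val E)"
abbreviation "cj \<equiv> galconj E"
abbreviation "\<pi> \<equiv> unif E"

lemma ringF_eq: "ringF E = pw 0"
  by (simp add: ringF_def)

lemma val_mult: "x \<noteq> 0 \<Longrightarrow> y \<noteq> 0 \<Longrightarrow> val E (x * y) = val E x + val E y"
  using ramified by (simp add: ramified_quadratic_ext_def discrete_valuation_def)

lemma val_add: "x \<noteq> 0 \<Longrightarrow> y \<noteq> 0 \<Longrightarrow> x + y \<noteq> 0 \<Longrightarrow> min (val E x) (val E y) \<le> val E (x + y)"
  using ramified by (simp add: ramified_quadratic_ext_def discrete_valuation_def)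

lemma val_one: "val E 1 = 0"
  using val_mult[of 1 1] by simp

lemma val_uminus: "val E (- x) = val E x"
proof (cases "x = 0")
  case False
  have "val E (- 1) = 0" using val_mult[of "-1" "-1"] val_one by simp
  then show ?thesis using val_mult[of "- 1" x] False by simp
qed simp

lemma val_inverse: "x \<noteq> 0 \<Longrightarrow> val E (inverse x) = - val E x"
  using val_mult[of x "inverse x"] val_one by simp

lemma mem_pw: "x \<in> pw e \<longleftrightarrow> x = 0 \<or> e \<le> val E x"
  by (simp add: val_ideal_def)

lemma zero_pw [simp]: "0 \<in> pw e" by (simp add: mem_pw)

lemma pw_add: "x \<in> pw e \<Longrightarrow> y \<in> pw e \<Longrightarrow> x + y \<in> pw e"
  by (cases "x = 0 \<or> y = 0 \<or> x + y = 0") (use val_add[of x y] in \<open>auto simp: mem_pw\<close>)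

lemma pw_uminus [simp]: "- x \<in> pw e \<longleftrightarrow> x \<in> pw e"
  by (simp add: mem_pw val_uminus)

lemma subgrp_pw: "subgrp (pw e)"
  using pw_add[of _ e "- _"] by (auto intro!: subgrpI)

lemmas pw_diff = subgrp_diff[OF subgrp_pw]

lemmas pw_sum = subgrp_sum[OF subgrp_pw]

lemma pw_mono: "x \<in> pw e \<Longrightarrow> f \<le> e \<Longrightarrow> x \<in> pw f"
  by (auto simp: mem_pw)

lemma pw_mult: "x \<in> pw e \<Longrightarrow> y \<in> pw f \<Longrightarrow> x * y \<in> pw (e + f)"
  by (cases "x = 0 \<or> y = 0") (use val_mult[of x y] in \<open>auto simp: mem_pw\<close>)

lemma pw_mult_le: "x \<in> pw e \<Longrightarrow> y \<in> pw f \<Longrightarrow> g \<le> e + f \<Longrightarrow> x * y \<in> pw g"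
  using pw_mult pw_mono by blast

lemma pw_mult_iff: "a \<noteq> 0 \<Longrightarrow> a * x \<in> pw e \<longleftrightarrow> x \<in> pw (e - val E a)"
  by (cases "x = 0") (auto simp: mem_pw val_mult)

lemma one_pw [simp]: "1 \<in> pw 0" by (simp add: mem_pw val_one)

lemma pi_nz [simp]: "\<pi> \<noteq> 0" and val_pi: "val E \<pi> = 1" and cj_pi: "cj \<pi> = - \<pi>"
  using ramified by (simp_all add: ramified_quadratic_ext_def)

lemma val_pi_power: "val E (\<pi> ^ k) = int k"
  by (induction k) (simp_all add: val_one val_mult val_pi)

lemma pi_power_pw: "\<pi> ^ k \<in> pw (int k)"
  by (simp add: mem_pw val_pi_power)

lemma pi_inverse_pw: "inverse \<pi> \<in> pw (- 1)"
  by (simp add: mem_pw val_inverse val_pi)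

lemma pi0_power: "pi0 E ^ d = \<pi> ^ (2 * d)"
  by (simp add: pi0_def power_mult)

text \<open>An element of O_F outside the maximal ideal has valuation exactly 0, hence is a
  unit.\<close>

lemma pw_nonunit: "x \<in> pw 0 \<Longrightarrow> x \<notin> pw 1 \<Longrightarrow> x \<noteq> 0 \<and> inverse x \<in> pw 0"
  by (auto simp: mem_pw val_inverse)

lemma cj_add: "cj (x + y) = cj x + cj y" and cj_mult: "cj (x * y) = cj x * cj y"
  and cj_base: "x \<in> base E \<Longrightarrow> cj x = x" and inj_cj: "inj cj"
  using ramified by (simp_all add: ramified_quadratic_ext_def bij_def)

lemma subfield: "is_subfield (base E)"
  using ramified by (simp add: ramified_quadratic_ext_def padic_field_def)

lemma base_closed: "0 \<in> base E" "1 \<in> base E" "x \<in> base E \<Longrightarrow> - x \<in> base E"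
  "x \<in> base E \<Longrightarrow> inverse x \<in> base E" "x \<in> base E \<Longrightarrow> y \<in> base E \<Longrightarrow> x + y \<in> base E"
  "x \<in> base E \<Longrightarrow> y \<in> base E \<Longrightarrow> x * y \<in> base E"
  using subfield by (simp_all add: is_subfield_def)

lemma base_diff: "x \<in> base E \<Longrightarrow> y \<in> base E \<Longrightarrow> x - y \<in> base E"
  using base_closed(5)[of x "- y"] base_closed(3) by simp

lemma base_divide: "x \<in> base E \<Longrightarrow> y \<in> base E \<Longrightarrow> x / y \<in> base E"
  using base_closed(6)[of x "inverse y"] base_closed(4) by (simp add: divide_inverse)

lemma cj_0: "cj 0 = 0" and cj_1: "cj 1 = 1"
  by (simp_all add: cj_base base_closed)

lemma cj_uminus: "cj (- x) = - cj x"
  using cj_add[of x "- x"] by (simp add: cj_0 add_eq_0_iff2)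

lemma cj_diff: "cj (x - y) = cj x - cj y"
  using cj_add[of x "- y"] by (simp add: cj_uminus)

lemma cj_inverse: "cj (inverse x) = inverse (cj x)"
proof (cases "x = 0")
  case False
  then have "cj x * cj (inverse x) = 1" using cj_mult[of x "inverse x"] by (simp add: cj_1)
  then show ?thesis by (metis inverse_unique)
qed (simp add: cj_0)

lemma cj_sum: "cj (sum f J) = (\<Sum>j\<in>J. cj (f j))"
  by (induction J rule: infinite_finite_induct) (simp_all add: cj_0 cj_add)

lemma pi_not_base: "\<pi> \<notin> base E"
  using cj_base[of \<pi>] cj_pi by (auto simp: eq_neg_iff_add_eq_0 simp flip: mult_2)

text \<open>The extension comes with an arbitrary basis b, c over \<open>F\<^sub>0\<close>; Cramer's
  rule changes it to 1, \<pi>. The behaviour of conjugation and the residue field of F are read off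
  from this decomposition.\<close>

lemma base_decomp: "\<exists>s\<in>base E. \<exists>t\<in>base E. x = s + t * \<pi>"
proof -
  obtain b c where bc: "\<And>x. \<exists>!(s, t). s \<in> base E \<and> t \<in> base E \<and> x = s * b + t * c"
    using ramified unfolding ramified_quadratic_ext_def by blast
  have ex: "\<exists>s t. s \<in> base E \<and> t \<in> base E \<and> x = s * b + t * c" for x
    using ex1_implies_ex[OF bc[of x]] by auto
  obtain s0 t0 where 0: "s0 \<in> base E" "t0 \<in> base E" "1 = s0 * b + t0 * c" using ex by blast
  obtain s1 t1 where 1: "s1 \<in> base E" "t1 \<in> base E" "\<pi> = s1 * b + t1 * c" using ex by blast
  \<comment> \<open>The determinant of 1, \<pi> in terms of b, c. If it vanished, either \<pi> would
    lie in \<open>F\<^sub>0\<close> or s0 = t0 = 0, contrary to 1 = s0 b + t0 c.\<close>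
  define \<Delta> where "\<Delta> = s0 * t1 - s1 * t0"
  have eqb: "t1 - t0 * \<pi> = \<Delta> * b"
  proof -
    have "t1 - t0 * \<pi> = t1 * (s0 * b + t0 * c) - t0 * (s1 * b + t1 * c)" using 0 1 by simp
    then show ?thesis by (simp add: \<Delta>_def algebra_simps)
  qed
  have eqc: "s0 * \<pi> - s1 = \<Delta> * c"
  proof -
    have "s0 * \<pi> - s1 = s0 * (s1 * b + t1 * c) - s1 * (s0 * b + t0 * c)" using 0 1 by simp
    then show ?thesis by (simp add: \<Delta>_def algebra_simps)
  qed
  have \<Delta>: "\<Delta> \<noteq> 0"
  proof
    assume z: "\<Delta> = 0"
    have "s0 = 0"
    proof (rule ccontr)
      assume "s0 \<noteq> 0"
      then have "\<pi> = s1 / s0" using eqc z by (simp add: field_simps)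
      then show False using pi_not_base base_divide[OF 1(1) 0(1)] by simp
    qed
    moreover have "t0 = 0"
    proof (rule ccontr)
      assume "t0 \<noteq> 0"
      then have "\<pi> = t1 / t0" using eqb z by (simp add: field_simps)
      then show False using pi_not_base base_divide[OF 1(2) 0(2)] by simp
    qed
    ultimately show False using 0(3) by simp
  qed
  have \<Delta>b: "\<Delta> \<in> base E" unfolding \<Delta>_def using 0 1 by (simp add: base_closed base_diff)
  obtain s t where st: "s \<in> base E" "t \<in> base E" "x = s * b + t * c" using ex by blast
  have b: "b = (t1 - t0 * \<pi>) / \<Delta>" and c: "c = (s0 * \<pi> - s1) / \<Delta>"
    using eqb eqc \<Delta> by (simp_all add: field_simps)
  have "x = (s * t1 - t * s1) / \<Delta> + (t * s0 - s * t0) / \<Delta> * \<pi>"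
    unfolding st(3) using \<Delta> by (subst b, subst c) (simp add: field_simps)
  moreover have "(s * t1 - t * s1) / \<Delta> \<in> base E" "(t * s0 - s * t0) / \<Delta> \<in> base E"
    using st 0 1 \<Delta>b by (simp_all add: base_divide base_diff base_closed)
  ultimately show ?thesis by blast
qed

lemma cj_decomp: "s \<in> base E \<Longrightarrow> t \<in> base E \<Longrightarrow> cj (s + t * \<pi>) = s - t * \<pi>"
  by (simp add: cj_add cj_mult cj_base cj_pi)

text \<open>Involutivity follows from the decomposition, on which conjugation sends s + t \<pi> to s
  - t \<pi>.\<close>

lemma cj_cj [simp]: "cj (cj x) = x"
  using base_decomp[of x] by (auto simp: cj_add cj_mult cj_diff cj_base cj_pi)

lemma cj_fixed_iff: "cj x = x \<longleftrightarrow> x \<in> base E"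
proof
  assume x: "cj x = x"
  obtain s t where st: "s \<in> base E" "t \<in> base E" "x = s + t * \<pi>" using base_decomp by blast
  have "t * \<pi> = 0" using x st cj_decomp[OF st(1,2)] by (simp add: neg_eq_iff_add_eq_0 flip: mult_2)
  then show "x \<in> base E" using st by simp
qed (rule cj_base)

lemma val_base: "x \<in> base E \<Longrightarrow> x \<noteq> 0 \<Longrightarrow> val E x = 2 * bval E x"
  using ramified by (simp add: ramified_quadratic_ext_def)

text \<open>No cancellation is possible between s and t \<pi>: nonzero elements of
  \<open>F\<^sub>0\<close> have even valuation, so the two valuations differ in parity.\<close>

lemma decomp_pw:
  assumes st: "s \<in> base E" "t \<in> base E" and x: "s + t * \<pi> \<in> pw e"
  shows "s \<in> pw e" "t * \<pi> \<in> pw e"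
proof -
  have ne: "val E s \<noteq> val E (t * \<pi>)" if "s \<noteq> 0" "t \<noteq> 0"
  proof -
    have "val E (t * \<pi>) = 2 * bval E t + 1" using that val_base st by (simp add: val_mult val_pi)
    then show ?thesis using val_base[OF st(1)] that by presburger
  qed
  show s: "s \<in> pw e"
  proof (rule ccontr)
    assume s: "s \<notin> pw e"
    then have s': "s \<noteq> 0" "val E s < e" by (auto simp: mem_pw)
    show False
    proof (cases "t = 0 \<or> val E s < val E (t * \<pi>)")
      case True
      then have "t * \<pi> \<in> pw (val E s + 1)" by (auto simp: mem_pw)
      then have "s + t * \<pi> - t * \<pi> \<in> pw (val E s + 1)" using s' by (intro pw_diff pw_mono[OF x]) auto
      then show False using s' by (simp add: mem_pw)
    next
      case False
      then have t: "t \<noteq> 0" "val E (t * \<pi>) < val E s" using ne s' by auto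
      then have "s \<in> pw (val E (t * \<pi>) + 1)" by (simp add: mem_pw)
      then have "s + t * \<pi> - s \<in> pw (val E (t * \<pi>) + 1)"
        using s' t by (intro pw_diff pw_mono[OF x]) auto
      then show False using t by (simp add: mem_pw)
    qed
  qed
  show "t * \<pi> \<in> pw e" using pw_diff[OF x s] by simp
qed

text \<open>Conjugation only changes the sign of t \<pi> in s + t \<pi>, and both terms lie in
  \<open>pw e\<close> as soon as the sum does.\<close>

lemma cj_pw: "cj x \<in> pw e \<longleftrightarrow> x \<in> pw e"
proof -
  have *: "cj x \<in> pw e" if "x \<in> pw e" for x
  proof -
    obtain s t where st: "s \<in> base E" "t \<in> base E" "x = s + t * \<pi>" using base_decomp by blast
    show ?thesis using decomp_pw[OF st(1,2)] that cj_decomp[OF st(1,2)] by (simp add: st pw_diff)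
  qed
  show ?thesis using *[of x] *[of "cj x"] by auto
qed

section \<open>Residue fields of F and \<open>F\<^sub>0\<close>\<close>

abbreviation "q \<equiv> resq E"

lemma val_ideal_base: "val_ideal (base E) (bval E) f = base E \<inter> pw (2 * f)"
proof -
  have "x = 0 \<or> f \<le> bval E x \<longleftrightarrow> x = 0 \<or> 2 * f \<le> val E x" if "x \<in> base E" for x
    using val_base[OF that] by (cases "x = 0") auto
  then show ?thesis by (auto simp: val_ideal_def)
qed

text \<open>Valuations on \<open>F\<^sub>0\<close> are even. This makes the form of
  \<open>H\<^sup>k\<close> alternating modulo \<pi> and frees diagonal Gram entries from every
  second condition.\<close>

lemma base_pw_even: "base E \<inter> pw (2 * f - 1) = base E \<inter> pw (2 * f)"
proof -
  have "x \<in> pw (2 * f - 1) \<longleftrightarrow> x \<in> pw (2 * f)" if "x \<in> base E" for x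
    using val_base[OF that] by (cases "x = 0") (auto simp: mem_pw)
  then show ?thesis by blast
qed

lemma base_pw_odd: "odd e \<Longrightarrow> base E \<inter> pw e = base E \<inter> pw (e + 1)"
  using base_pw_even[of "(e + 1) div 2"] by (elim oddE) (simp add: algebra_simps)

lemma card_quot_scale:
  fixes a :: 'f
  assumes "a \<noteq> 0" "subgrp B"
  shows "card (quot ((*) a ` A) ((*) a ` B)) = card (quot A B)"
proof (rule card_quot_eqI[where f = "(*) a", symmetric])
  show "subgrp ((*) a ` B)"
  proof (rule subgrpI)
    show "0 \<in> (*) a ` B" using subgrp_0[OF assms(2)] by force
    show "x - y \<in> (*) a ` B" if "x \<in> (*) a ` B" "y \<in> (*) a ` B" for x y
      using that subgrp_diff[OF assms(2)] by (auto simp flip: right_diff_distrib)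
  qed
  then show "\<exists>x\<in>A. a * x - y \<in> (*) a ` B" if "y \<in> (*) a ` A" for y
    using that subgrp_0 by force
  show "a * x - a * y \<in> (*) a ` B \<longleftrightarrow> x - y \<in> B" for x y
    using assms(1) inj_image_mem_iff[of "(*) a" "x - y" B]
    by (simp add: inj_def flip: right_diff_distrib)
qed (use assms in auto)

lemma subgrp_base_pw: "subgrp (base E \<inter> pw e)"
  using base_diff pw_diff by (auto intro!: subgrpI simp: base_closed)

lemma resq_eq: "q = card (quot (base E \<inter> pw 0) (base E \<inter> pw 2))"
  by (simp add: resq_def val_ideal_base)

text \<open>For even e, multiplication by an element of valuation e reduces to the residue field of
  \<open>F\<^sub>0\<close>; for odd e the two ideals have the same trace on
  \<open>F\<^sub>0\<close>.\<close>

lemma card_quot_base_pw: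
  "card (quot (base E \<inter> pw e) (base E \<inter> pw (e + 1))) = (if even e then q else 1)"
proof (cases "even e")
  case True
  then obtain f where f: "e = 2 * f" by blast
  have "bval E ` (base E - {0}) = UNIV"
    using ramified by (simp add: ramified_quadratic_ext_def padic_field_def discrete_valuation_def)
  then have "f \<in> bval E ` (base E - {0})" by simp
  then obtain a where a: "a \<in> base E" "a \<noteq> 0" "bval E a = f" by blast
  have im: "(*) a ` (base E \<inter> pw g) = base E \<inter> pw (g + e)" for g
  proof (intro equalityI subsetI)
    fix x assume "x \<in> (*) a ` (base E \<inter> pw g)"
    then show "x \<in> base E \<inter> pw (g + e)" using a f by (auto simp: base_closed pw_mult_iff val_base)
  next
    fix x assume x: "x \<in> base E \<inter> pw (g + e)"
    have "x / a \<in> base E \<inter> pw g"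
      using x a f pw_mult_iff[OF a(2), of "x / a" "g + e"] by (simp add: base_divide val_base)
    then show "x \<in> (*) a ` (base E \<inter> pw g)" using a(2) by (intro image_eqI[of _ _ "x / a"]) auto
  qed
  have "base E \<inter> pw (e + 1) = base E \<inter> pw (2 + e)" using base_pw_odd[of "e + 1"] True by (simp add: add.commute)
  then show ?thesis
    using True resq_eq card_quot_scale[OF a(2) subgrp_base_pw, of "base E \<inter> pw 0" 2] by (simp add: im)
next
  case False
  then show ?thesis using base_pw_odd[of e] card_quot_self[OF subgrp_base_pw] by simp
qed

text \<open>Total ramification: an integer of F is congruent modulo \<pi> to one of
  \<open>F\<^sub>0\<close>, so both fields have the same residue field.\<close>

lemma card_quot_pw: "card (quot (pw e) (pw (e + 1))) = q"
proof -
  have "val E ` (UNIV - {0}) = UNIV"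
    using ramified by (simp add: ramified_quadratic_ext_def discrete_valuation_def)
  then have "e \<in> val E ` (UNIV - {0})" by simp
  then obtain a where a: "a \<noteq> 0" "val E a = e" by blast
  have im: "(*) a ` pw g = pw (g + e)" for g
  proof (intro equalityI subsetI)
    fix x assume "x \<in> (*) a ` pw g"
    then show "x \<in> pw (g + e)" using a by (auto simp: pw_mult_iff)
  next
    fix x assume x: "x \<in> pw (g + e)"
    have "x / a \<in> pw g"
      using x a pw_mult_iff[OF a(1), of "x / a" "g + e"] by simp
    then show "x \<in> (*) a ` pw g" using a(1) by (intro image_eqI[of _ _ "x / a"]) auto
  qed
  have sum: "pw 0 = {x + y | x y. x \<in> base E \<inter> pw 0 \<and> y \<in> pw 1}"
  proof (intro equalityI subsetI)
    fix x assume x: "x \<in> pw 0"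
    obtain s t where st: "s \<in> base E" "t \<in> base E" "x = s + t * \<pi>" using base_decomp by blast
    have "s \<in> pw 0" "t * \<pi> \<in> pw 0" using decomp_pw[OF st(1,2)] x st(3) by auto
    \<comment> \<open>The valuation of t \<pi> is odd, so integrality already gives divisibility by
      \<pi>.\<close>
    moreover have "t * \<pi> \<in> pw 1"
    proof (cases "t = 0")
      case False
      then show ?thesis using \<open>t * \<pi> \<in> pw 0\<close> val_base[OF st(2)] by (auto simp: mem_pw val_mult val_pi)
    qed simp
    ultimately show "x \<in> {x + y | x y. x \<in> base E \<inter> pw 0 \<and> y \<in> pw 1}" using st by blast
  qed (auto intro!: pw_add intro: pw_mono)
  have "card (quot (pw e) (pw (e + 1))) = card (quot (pw 0) (pw 1))"
    using card_quot_scale[OF a(1) subgrp_pw, of "pw 0" 1] im[of 0] im[of 1] by (simp add: add.commute)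
  also have "\<dots> = card (quot (base E \<inter> pw 0) (base E \<inter> pw 0 \<inter> pw 1))"
    by (subst sum) (rule card_quot_second_iso[OF subgrp_base_pw subgrp_pw])
  also have "base E \<inter> pw 0 \<inter> pw 1 = base E \<inter> pw 1" by (auto intro: pw_mono)
  finally show ?thesis using card_quot_base_pw[of 0] by simp
qed

text \<open>The classes of 0 and 1 differ. Finiteness of the residue field enters because
  \<open>card\<close> is 0 on infinite sets; conversely, a cardinality equal to a power of q later
  certifies that a quotient is finite.\<close>

lemma q_gt_1: "q > 1"
proof -
  have fin: "finite (quot (base E \<inter> pw 0) (base E \<inter> pw 2))"
    using ramified by (simp add: ramified_quadratic_ext_def padic_field_def val_ideal_base)
  have "coset (base E \<inter> pw 2) 1 \<noteq> coset (base E \<inter> pw 2) 0"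
    by (simp add: coset_eq_iff[OF subgrp_base_pw] mem_pw val_one)
  moreover have "{coset (base E \<inter> pw 2) 1, coset (base E \<inter> pw 2) 0} \<subseteq> quot (base E \<inter> pw 0) (base E \<inter> pw 2)"
    by (auto simp: quot_def base_closed)
  ultimately have "card {coset (base E \<inter> pw 2) 1, coset (base E \<inter> pw 2) 0} = 2"
    "card {coset (base E \<inter> pw 2) 1, coset (base E \<inter> pw 2) 0} \<le> q"
    using card_mono[OF fin] unfolding resq_eq by (simp, blast)
  then show ?thesis by linarith
qed

text \<open>The odd prime p lies in the maximal ideal; if 2 did too, so would 1. Halving a diagonal
  Gram defect therefore preserves its level.\<close>

lemma half_pw: "x / 2 \<in> pw e \<longleftrightarrow> x \<in> pw e"
proof -
  have nat: "of_nat k \<in> pw 0" for k by (induction k) (auto intro: pw_add)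
  have "(of_nat p :: 'f) \<in> base E \<inter> pw 2"
    using ramified unfolding ramified_quadratic_ext_def padic_field_def val_ideal_base by simp
  then have p: "(of_nat p :: 'f) \<in> pw 1" by (auto intro: pw_mono)
  have "odd p" using ramified by (simp add: ramified_quadratic_ext_def)
  then obtain j where j: "p = 2 * j + 1" by (elim oddE)
  have "(2::'f) \<notin> pw 1"
  proof
    assume 2: "(2::'f) \<in> pw 1"
    have "of_nat p - 2 * of_nat j \<in> pw 1" using pw_diff[OF p pw_mult[OF 2 nat[of j], simplified]] .
    then show False by (simp add: j mem_pw val_one)
  qed
  moreover have "(2::'f) \<in> pw 0" using nat[of 2] by simp
  ultimately have "val E 2 = 0" by (simp add: mem_pw)
  then show ?thesis using pw_mult_iff[of 2 "x / 2" e] by simp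
qed

end

section \<open>Lattices and residual independence\<close>

text \<open>Linear independence over the residue field of the classes modulo \<pi>, with
  coefficients lifted to O_F. Arbitrary index sets are allowed because the two blocks of a frame are
  indexed by \<open>{..<i}\<close> and \<open>{i..<n}\<close>.\<close>

definition residue_indep :: "'f::field quad_ext \<Rightarrow> ('f, 'v::ab_group_add) herm \<Rightarrow> 'i set \<Rightarrow> ('i \<Rightarrow> 'v) \<Rightarrow> bool" where
  "residue_indep E M J x \<longleftrightarrow> (\<forall>c. (\<forall>j\<in>J. c j \<in> ringF E) \<longrightarrow>
     (\<Sum>j\<in>J. smul M (c j) (x j)) \<in> scaled (unif E) M \<longrightarrow> (\<forall>j\<in>J. c j \<in> val_ideal UNIV (val E) 1))"

definition lat_basis :: "'f::field quad_ext \<Rightarrow> ('f, 'v::ab_group_add) herm \<Rightarrow> nat \<Rightarrow> (nat \<Rightarrow> 'v) \<Rightarrow> bool" where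
  "lat_basis E M n e \<longleftrightarrow> pts M = {\<Sum>l<n. smul M (c l) (e l) | c. \<forall>l<n. c l \<in> ringF E} \<and>
     (\<forall>c. (\<Sum>l<n. smul M (c l) (e l)) = 0 \<longrightarrow> (\<forall>l<n. c l = 0))"

text \<open>The closure properties of a hermitian lattice without its basis, so that orthogonal sums
  and powers qualify directly; bases are supplied through \<open>lat_basis\<close>.\<close>

locale herm_module = ramified_ext p E for p and E :: "'f::field_char_0 quad_ext" +
  fixes M :: "('f, 'v::ab_group_add) herm"
  assumes vector_space: "vector_space (smul M)"
    and form_add_left: "form M (x + y) z = form M x z + form M y z"
    and form_smul_left: "form M (smul M a x) y = a * form M x y"
    and form_conj: "form M y x = cj (form M x y)"
    and pts_0: "0 \<in> pts M"
    and pts_add: "x \<in> pts M \<Longrightarrow> y \<in> pts M \<Longrightarrow> x + y \<in> pts M"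
    and pts_smul: "a \<in> pw 0 \<Longrightarrow> x \<in> pts M \<Longrightarrow> smul M a x \<in> pts M"
begin

sublocale V: vector_space "smul M" by (rule vector_space)

abbreviation lc :: "'i set \<Rightarrow> ('i \<Rightarrow> 'f) \<Rightarrow> ('i \<Rightarrow> 'v) \<Rightarrow> 'v" where
  "lc J c x \<equiv> \<Sum>j\<in>J. smul M (c j) (x j)"

abbreviation "pM \<equiv> scaled \<pi> M"

abbreviation "pm k \<equiv> scaled (\<pi> ^ k) M"

abbreviation "rind \<equiv> residue_indep E M"

lemma form_add_right: "form M x (y + z) = form M x y + form M x z"
  using form_conj[of x "y + z"] form_conj[of x y] form_conj[of x z] form_add_left
  by (simp add: cj_add)

lemma form_smul_right: "form M x (smul M a y) = cj a * form M x y"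
  using form_conj[of x "smul M a y"] form_conj[of x y] form_smul_left by (simp add: cj_mult)

lemma form_0_left [simp]: "form M 0 y = 0" and form_0_right [simp]: "form M y 0 = 0"
  using form_smul_left[of 0 0 y] form_smul_right[of y 0 0] by (simp_all add: cj_0)

lemma form_uminus_left: "form M (- x) y = - form M x y"
  using form_smul_left[of "- 1" x y] by simp

lemma form_uminus_right: "form M x (- y) = - form M x y"
  using form_smul_right[of x "- 1" y] by (simp add: cj_uminus cj_1)

lemma form_diff_left: "form M (x - y) z = form M x z - form M y z"
  using form_add_left[of x "- y" z] by (simp add: form_uminus_left)

lemma form_diff_right: "form M x (y - z) = form M x y - form M x z"
  using form_add_right[of x y "- z"] by (simp add: form_uminus_right)

lemma form_sum_left: "form M (sum f J) y = (\<Sum>j\<in>J. form M (f j) y)"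
  by (induction J rule: infinite_finite_induct) (simp_all add: form_add_left)

lemma form_sum_right: "form M x (sum f J) = (\<Sum>j\<in>J. form M x (f j))"
  by (induction J rule: infinite_finite_induct) (simp_all add: form_add_right)

lemma form_lc_left: "form M (lc J c x) y = (\<Sum>j\<in>J. c j * form M (x j) y)"
  by (simp add: form_sum_left form_smul_left)

lemma form_lc_right: "form M y (lc J c x) = (\<Sum>j\<in>J. cj (c j) * form M y (x j))"
  by (simp add: form_sum_right form_smul_right)

lemma lc_diff: "lc J c x - lc J c' x = lc J (\<lambda>j. c j - c' j) x"
  by (simp add: sum_subtractf V.scale_left_diff_distrib)

lemma lc_diff_right: "lc J c x - lc J c x' = lc J c (\<lambda>j. x j - x' j)"
  by (simp add: sum_subtractf V.scale_right_diff_distrib)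

lemma lc_add: "lc J c x + lc J c' x = lc J (\<lambda>j. c j + c' j) x"
  by (simp add: sum.distrib V.scale_left_distrib)

lemma lc_smul: "smul M a (lc J c x) = lc J (\<lambda>j. a * c j) x"
  by (simp add: V.scale_sum_right)

lemma subgrp_pts: "subgrp (pts M)"
  using pts_0 pts_add[of _ "- _"] pts_smul[of "- 1"] by (auto intro!: subgrpI)

definition submod :: "'v set \<Rightarrow> bool" where
  "submod N \<longleftrightarrow> subgrp N \<and> (\<forall>a\<in>pw 0. \<forall>x\<in>N. smul M a x \<in> N)"

lemma submod_subgrp: "submod N \<Longrightarrow> subgrp N"
  and submod_smul: "submod N \<Longrightarrow> a \<in> pw 0 \<Longrightarrow> x \<in> N \<Longrightarrow> smul M a x \<in> N"
  by (simp_all add: submod_def)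

lemma submod_lc: "submod N \<Longrightarrow> (\<And>j. j \<in> J \<Longrightarrow> c j \<in> pw 0) \<Longrightarrow> (\<And>j. j \<in> J \<Longrightarrow> x j \<in> N) \<Longrightarrow> lc J c x \<in> N"
  by (intro subgrp_sum submod_subgrp submod_smul)

lemma submod_pts: "submod (pts M)"
  by (simp add: submod_def subgrp_pts pts_smul)

lemmas pts_lc = submod_lc[OF submod_pts]

lemma mem_scaled: "a \<noteq> 0 \<Longrightarrow> x \<in> scaled a M \<longleftrightarrow> smul M (inverse a) x \<in> pts M"
proof -
  assume a: "a \<noteq> 0"
  have "x = smul M a (smul M (inverse a) x)" using a by simp
  then show ?thesis using a by (force simp: scaled_def)
qed

lemma submod_scaled: "a \<noteq> 0 \<Longrightarrow> submod (scaled a M)"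
  unfolding submod_def
proof (intro conjI subgrpI ballI)
  assume a: "a \<noteq> 0"
  show "0 \<in> scaled a M" using a by (simp add: mem_scaled pts_0)
  show "x - y \<in> scaled a M" if "x \<in> scaled a M" "y \<in> scaled a M" for x y
    using a that subgrp_diff[OF subgrp_pts] by (simp add: mem_scaled V.scale_right_diff_distrib)
  show "smul M b x \<in> scaled a M" if "b \<in> pw 0" "x \<in> scaled a M" for b x
    using a pts_smul[OF that(1), of "smul M (inverse a) x"] that(2) by (simp add: mem_scaled mult.commute)
qed

lemma submod_pm: "submod (pm k)" and submod_pM: "submod pM"
  by (simp_all add: submod_scaled)

lemmas subgrp_pm = submod_subgrp[OF submod_pm]

lemmas subgrp_pM = submod_subgrp[OF submod_pM]

lemma pm_0: "pm 0 = pts M" by (auto simp: scaled_def)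

lemma pm_1: "pm 1 = pM" by simp

lemma pm_mono: "j \<le> k \<Longrightarrow> pm k \<subseteq> pm j"
proof
  fix x assume "j \<le> k" "x \<in> pm k"
  then obtain y where y: "y \<in> pts M" "x = smul M (\<pi> ^ k) y" by (auto simp: scaled_def)
  have "smul M (\<pi> ^ (k - j)) y \<in> pts M" using y pts_smul pw_mono[OF pi_power_pw] by simp
  moreover have "x = smul M (\<pi> ^ j) (smul M (\<pi> ^ (k - j)) y)"
    using \<open>j \<le> k\<close> by (simp add: y flip: power_add)
  ultimately show "x \<in> pm j"
    unfolding scaled_def by (intro image_eqI[of x _ "smul M (\<pi> ^ (k - j)) y"])
qed

lemma pm_subset_pts: "pm k \<subseteq> pts M"
  using pm_mono[of 0 k] pm_0 by simp

lemma pM_subset_pts: "pM \<subseteq> pts M"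
  using pm_subset_pts[of 1] by simp

lemma smul_pm: "a \<in> pw (int k) \<Longrightarrow> x \<in> pts M \<Longrightarrow> smul M a x \<in> pm k"
  using pts_smul[of "inverse (\<pi> ^ k) * a" x] pw_mult_iff[of "inverse (\<pi> ^ k)" a 0]
  by (simp add: mem_scaled val_inverse val_pi_power)

lemma smul_pM: "a \<in> pw 1 \<Longrightarrow> x \<in> pts M \<Longrightarrow> smul M a x \<in> pM"
  using smul_pm[of a 1 x] by simp

lemma lc_pM: "(\<And>j. j \<in> J \<Longrightarrow> c j \<in> pw 1) \<Longrightarrow> (\<And>j. j \<in> J \<Longrightarrow> x j \<in> pts M) \<Longrightarrow> lc J c x \<in> pM"
  by (intro subgrp_sum subgrp_pM smul_pM)

lemma rindI: "(\<And>c. (\<And>j. j \<in> J \<Longrightarrow> c j \<in> pw 0) \<Longrightarrow> lc J c x \<in> pM \<Longrightarrow> \<forall>j\<in>J. c j \<in> pw 1) \<Longrightarrow> rind J x"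
  by (simp add: residue_indep_def ringF_eq)

lemma rindD: "rind J x \<Longrightarrow> (\<And>j. j \<in> J \<Longrightarrow> c j \<in> pw 0) \<Longrightarrow> lc J c x \<in> pM \<Longrightarrow> j \<in> J \<Longrightarrow> c j \<in> pw 1"
  by (simp add: residue_indep_def ringF_eq)

lemma rind_subset:
  assumes "rind J x" "finite J" "J' \<subseteq> J"
  shows "rind J' x"
proof (rule rindI)
  fix c assume c: "\<And>j. j \<in> J' \<Longrightarrow> c j \<in> pw 0" and s: "lc J' c x \<in> pM"
  define c' where "c' j = (if j \<in> J' then c j else 0)" for j
  have "lc J c' x = lc J' c x"
    by (rule sum.mono_neutral_cong_right) (use assms in \<open>auto simp: c'_def\<close>)
  then have "\<forall>j\<in>J. c' j \<in> pw 1" using rindD[OF assms(1), of c'] c s by (auto simp: c'_def)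
  then show "\<forall>j\<in>J'. c j \<in> pw 1" using assms(3) by (auto simp: c'_def dest!: subsetD)
qed

lemma rind_cong_mod:
  assumes "rind J x" "\<And>j. j \<in> J \<Longrightarrow> x j - y j \<in> pM"
  shows "rind J y"
proof (rule rindI)
  fix c assume c: "\<And>j. j \<in> J \<Longrightarrow> c j \<in> pw 0" and s: "lc J c y \<in> pM"
  have "lc J c x - lc J c y \<in> pM"
    unfolding lc_diff_right using c assms(2) by (intro submod_lc submod_pM)
  then have "lc J c x \<in> pM" using subgrp_cong_iff[OF subgrp_pM] s by blast
  then show "\<forall>j\<in>J. c j \<in> pw 1" using rindD[OF assms(1)] c by blast
qed

text \<open>Independence says that the class of a combination determines its coefficients modulo
  \<pi>, so there are as many classes as coefficient vectors.\<close>

lemma card_span_mod: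
  assumes x: "\<And>l. l < r \<Longrightarrow> x l \<in> pts M" and ind: "rind {..<r} x"
  shows "card {coset pM (lc {..<r} c x) | c. \<forall>l<r. c l \<in> pw 0} = q ^ r"
proof -
  have "card (quot (FS {..<r} (\<lambda>_. pw 0)) (FS {..<r} (\<lambda>_. pw 1))) =
      card (quot {lc {..<r} c x | c. \<forall>l<r. c l \<in> pw 0} pM)"
  proof (rule card_quot_eqI[where f = "\<lambda>c. lc {..<r} c x"])
    show "subgrp (FS {..<r} (\<lambda>_. pw 1))" by (simp add: subgrp_FS subgrp_pw)
    show "\<exists>c\<in>FS {..<r} (\<lambda>_. pw 0). lc {..<r} c x - y \<in> pM"
      if y: "y \<in> {lc {..<r} c x | c. \<forall>l<r. c l \<in> pw 0}" for y
    proof -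
      obtain c where c: "y = lc {..<r} c x" "\<forall>l<r. c l \<in> pw 0" using y by blast
      then show ?thesis
        by (intro bexI[of _ "\<lambda>l. if l < r then c l else 0"]) (auto simp: FS_def subgrp_0[OF subgrp_pM])
    qed
    show "lc {..<r} c x - lc {..<r} c' x \<in> pM \<longleftrightarrow> c - c' \<in> FS {..<r} (\<lambda>_. pw 1)"
      if c: "c \<in> FS {..<r} (\<lambda>_. pw 0)" "c' \<in> FS {..<r} (\<lambda>_. pw 0)" for c c'
    proof
      assume "lc {..<r} c x - lc {..<r} c' x \<in> pM"
      then have "lc {..<r} (\<lambda>l. c l - c' l) x \<in> pM" by (simp only: lc_diff)
      then have "\<forall>l\<in>{..<r}. c l - c' l \<in> pw 1"
        using rindD[OF ind, of "\<lambda>l. c l - c' l"] c by (auto intro: pw_diff dest: FS_D)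
      then show "c - c' \<in> FS {..<r} (\<lambda>_. pw 1)" using c by (auto simp: FS_def)
    next
      assume "c - c' \<in> FS {..<r} (\<lambda>_. pw 1)"
      then show "lc {..<r} c x - lc {..<r} c' x \<in> pM"
        unfolding lc_diff using x by (intro lc_pM) (auto dest: FS_D)
    qed
  qed (auto simp: subgrp_pM dest: FS_D)
  moreover have "card (quot (FS {..<r} (\<lambda>_. pw 0)) (FS {..<r} (\<lambda>_. pw 1))) = q ^ r"
    using card_quot_pw[of 0] by (subst card_quot_FS) (simp_all add: subgrp_pw)
  moreover have "quot {lc {..<r} c x | c. \<forall>l<r. c l \<in> pw 0} pM =
      {coset pM (lc {..<r} c x) | c. \<forall>l<r. c l \<in> pw 0}"
    by (auto simp: quot_def)
  ultimately show ?thesis by simp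
qed

text \<open>The q^r coefficient vectors modulo \<pi> map onto the span. If the span also has q^r
  classes, this surjection between finite sets of equal size is injective, so independence is
  detected by counting.\<close>

lemma rind_of_card:
  assumes x: "\<And>l. l < r \<Longrightarrow> x l \<in> pts M"
    and card: "card {coset pM (lc {..<r} c x) | c. \<forall>l<r. c l \<in> pw 0} = q ^ r"
  shows "rind {..<r} x"
proof (rule rindI)
  let ?O = "FS {..<r} (\<lambda>_. pw 0)" and ?P = "FS {..<r} (\<lambda>_. pw 1)"
  let ?W = "{coset pM (lc {..<r} c x) | c. \<forall>l<r. c l \<in> pw 0}"
  have sg: "subgrp ?P" by (simp add: subgrp_FS subgrp_pw)
  define g where "g C = coset pM (lc {..<r} (SOME c. c \<in> C) x)" for C
  have g: "g (coset ?P c) = coset pM (lc {..<r} c x)" for c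
  proof -
    have "(SOME c'. c' \<in> coset ?P c) \<in> coset ?P c"
      by (rule someI[of "\<lambda>c'. c' \<in> coset ?P c", OF coset_self[OF sg]])
    then have "(SOME c'. c' \<in> coset ?P c) - c \<in> ?P" by (simp add: mem_coset)
    then have "lc {..<r} (SOME c'. c' \<in> coset ?P c) x - lc {..<r} c x \<in> pM"
      unfolding lc_diff using x by (intro lc_pM) (auto dest: FS_D)
    then show ?thesis by (simp add: g_def coset_eq_iff[OF subgrp_pM])
  qed
  have cardO: "card (quot ?O ?P) = q ^ r"
    using card_quot_pw[of 0] by (subst card_quot_FS) (simp_all add: subgrp_pw)
  then have fin: "finite (quot ?O ?P)" using q_gt_1 by (intro card_ge_0_finite) simp
  have "g ` quot ?O ?P = ?W"
  proof (intro equalityI subsetI)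
    fix X assume "X \<in> g ` quot ?O ?P"
    then show "X \<in> ?W" using g by (auto simp: quot_def dest: FS_D)
  next
    fix X assume "X \<in> ?W"
    then obtain c where c: "X = coset pM (lc {..<r} c x)" "\<forall>l<r. c l \<in> pw 0" by blast
    define c' where "c' l = (if l < r then c l else 0)" for l
    have "X = g (coset ?P c')" using c by (simp add: g c'_def)
    moreover have "coset ?P c' \<in> quot ?O ?P" using c by (auto simp: quot_def c'_def FS_def)
    ultimately show "X \<in> g ` quot ?O ?P" by blast
  qed
  then have inj: "inj_on g (quot ?O ?P)" using card cardO fin by (intro eq_card_imp_inj_on) auto
  fix c assume c: "\<And>l. l \<in> {..<r} \<Longrightarrow> c l \<in> pw 0" and s: "lc {..<r} c x \<in> pM"
  define c' where "c' l = (if l < r then c l else 0)" for l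
  have "lc {..<r} c' x = lc {..<r} c x" by (simp add: c'_def)
  then have "g (coset ?P c') = g (coset ?P 0)" using s by (simp add: g coset_eq_iff[OF subgrp_pM])
  moreover have "coset ?P c' \<in> quot ?O ?P" "coset ?P 0 \<in> quot ?O ?P"
    using c by (auto simp: quot_def c'_def FS_def)
  ultimately have "coset ?P c' = coset ?P 0" using inj by (auto dest: inj_onD)
  then have "c' \<in> ?P" using coset_eq_iff[OF sg, of c' 0] by simp
  then show "\<forall>l\<in>{..<r}. c l \<in> pw 1" by (auto simp: c'_def FS_def)
qed

section \<open>Lattice bases and their residues\<close>

lemma basis_zero: "lat_basis E M n e \<Longrightarrow> lc {..<n} c e = 0 \<Longrightarrow> l < n \<Longrightarrow> c l = 0"
  by (simp add: lat_basis_def)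

lemma basis_pts_eq: "lat_basis E M n e \<Longrightarrow> pts M = {lc {..<n} c e | c. \<forall>l<n. c l \<in> pw 0}"
  by (simp add: lat_basis_def ringF_eq)

lemma basis_pts: "lat_basis E M n e \<Longrightarrow> l < n \<Longrightarrow> e l \<in> pts M"
proof -
  assume b: "lat_basis E M n e" and l: "l < n"
  have "e l = lc {..<n} (\<lambda>j. if j = l then 1 else 0) e"
    using l by (simp add: if_distrib[of "\<lambda>a. smul M a _"] cong: if_cong)
  moreover have "\<forall>j<n. (if j = l then 1 else 0) \<in> pw 0" by simp
  ultimately have "e l = lc {..<n} (\<lambda>j. if j = l then 1 else 0) e \<and>
    (\<forall>j<n. (if j = l then 1 else 0 :: 'f) \<in> pw 0)" by (rule conjI)
  then show ?thesis unfolding basis_pts_eq[OF b] by (intro CollectI exI)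
qed

lemma basis_expand: "lat_basis E M n e \<Longrightarrow> x \<in> pts M \<Longrightarrow> \<exists>c. (\<forall>l<n. c l \<in> pw 0) \<and> x = lc {..<n} c e"
  using basis_pts_eq[of n e] by blast

lemma basis_unique: "lat_basis E M n e \<Longrightarrow> lc {..<n} c e = lc {..<n} c' e \<Longrightarrow> l < n \<Longrightarrow> c l = c' l"
proof -
  assume b: "lat_basis E M n e" and "lc {..<n} c e = lc {..<n} c' e" and l: "l < n"
  then have "lc {..<n} (\<lambda>l. c l - c' l) e = 0" by (simp flip: lc_diff)
  then show ?thesis using basis_zero[OF b _ l] by fastforce
qed

lemma basis_pm:
  assumes b: "lat_basis E M n e" and s: "lc {..<n} c e \<in> pm k" and l: "l < n"
  shows "c l \<in> pw (int k)"
proof -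
  obtain y where y: "y \<in> pts M" "lc {..<n} c e = smul M (\<pi> ^ k) y" using s by (auto simp: scaled_def)
  obtain c' where c': "\<forall>l<n. c' l \<in> pw 0" "y = lc {..<n} c' e" using basis_expand[OF b y(1)] by blast
  have "lc {..<n} c e = lc {..<n} (\<lambda>l. \<pi> ^ k * c' l) e" using y c' by (simp only: lc_smul)
  then have "c l = \<pi> ^ k * c' l" by (rule basis_unique[OF b _ l])
  then show ?thesis using pw_mult[OF pi_power_pw[of k], of "c' l" 0] c' l by simp
qed

lemma basis_rind: "lat_basis E M n e \<Longrightarrow> rind {..<n} e"
  using basis_pm[of n e _ 1] by (intro rindI) auto

text \<open>Since \<open>c s\<close> is a unit, \<open>e s\<close> can be solved for in terms of
  \<open>x\<close> and the other basis vectors with integral coefficients.\<close>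

lemma basis_replace:
  assumes b: "lat_basis E M n e" and s: "s < n" and x: "x \<in> pts M"
    and c: "\<And>l. l < n \<Longrightarrow> c l \<in> pw 0" "x = lc {..<n} c e" and u: "c s \<notin> pw 1"
  shows "lat_basis E M n (e(s := x))"
proof -
  have cs: "c s \<noteq> 0" "inverse (c s) \<in> pw 0" using pw_nonunit[OF c(1)[OF s] u] by auto
  have ee: "lc {..<n} d (e(s := x)) = lc {..<n} (\<lambda>l. (if l = s then 0 else d l) + d s * c l) e" for d
  proof -
    have "lc {..<n} d (e(s := x)) = smul M (d s) x + lc ({..<n} - {s}) d e"
      using s by (subst sum.remove[of _ s]) (auto intro!: sum.cong)
    also have "lc ({..<n} - {s}) d e = lc {..<n} (\<lambda>l. if l = s then 0 else d l) e"
      by (rule sum.mono_neutral_cong_left) auto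
    finally show ?thesis unfolding c(2) lc_smul by (subst (asm) add.commute) (simp only: lc_add)
  qed
  show ?thesis unfolding lat_basis_def ringF_eq
  proof (intro conjI allI impI equalityI subsetI)
    fix y assume "y \<in> pts M"
    then obtain d where d: "\<forall>l<n. d l \<in> pw 0" "y = lc {..<n} d e" using basis_expand[OF b] by blast
    define a where "a = d s * inverse (c s)"
    have a: "a \<in> pw 0" using d s cs pw_mult[of "d s" 0 "inverse (c s)" 0] by (simp add: a_def)
    define d' where "d' l = (if l = s then a else d l - a * c l)" for l
    have "y = lc {..<n} d' (e(s := x))"
      unfolding ee d(2) by (rule sum.cong) (use cs in \<open>auto simp: d'_def a_def\<close>)
    moreover have "\<forall>l<n. d' l \<in> pw 0"
      using a d c pw_mult[OF a, of _ 0] by (auto simp: d'_def intro!: pw_diff)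
    ultimately show "y \<in> {lc {..<n} d (e(s := x)) | d. \<forall>l<n. d l \<in> pw 0}" by blast
  next
    fix y assume "y \<in> {lc {..<n} d (e(s := x)) | d. \<forall>l<n. d l \<in> pw 0}"
    then show "y \<in> pts M" using basis_pts[OF b] x by (auto intro!: pts_lc)
  next
    fix d l assume z: "lc {..<n} d (e(s := x)) = 0" and l: "l < n"
    have z': "(if l = s then 0 else d l) + d s * c l = 0" if "l < n" for l
      using basis_zero[OF b z[unfolded ee] that] .
    have "d s = 0" using z'[OF s] cs by simp
    then show "d l = 0" using z'[OF l] by (cases "l = s") auto
  qed
qed

lemma basis_swap:
  assumes b: "lat_basis E M n e" and rs: "r < n" "s < n"
  shows "lat_basis E M n (\<lambda>l. e (if l = r then s else if l = s then r else l))"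
proof -
  define f where "f l = (if l = r then s else if l = s then r else l)" for l
  have f: "bij_betw f {..<n} {..<n}"
    by (rule bij_betw_byWitness[where f' = f]) (use rs in \<open>auto simp: f_def\<close>)
  have ff: "f (f l) = l" and fn: "l < n \<Longrightarrow> f l < n" for l using rs by (auto simp: f_def)
  have eq: "lc {..<n} c (\<lambda>l. e (f l)) = lc {..<n} (\<lambda>l. c (f l)) e" for c
    using sum.reindex_bij_betw[OF f, of "\<lambda>l. smul M (c (f l)) (e l)"] by (simp add: ff)
  have "lat_basis E M n (\<lambda>l. e (f l))" unfolding lat_basis_def ringF_eq
  proof (intro conjI allI impI equalityI subsetI)
    fix y assume "y \<in> pts M"
    then obtain d where "\<forall>l<n. d l \<in> pw 0" "y = lc {..<n} d e" using basis_expand[OF b] by blast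
    then have "y = lc {..<n} (\<lambda>l. d (f l)) (\<lambda>l. e (f l)) \<and> (\<forall>l<n. d (f l) \<in> pw 0)"
      by (simp add: eq ff fn)
    then show "y \<in> {lc {..<n} d (\<lambda>l. e (f l)) | d. \<forall>l<n. d l \<in> pw 0}"
      by (intro CollectI exI[of _ "\<lambda>l. d (f l)"])
  next
    fix y assume "y \<in> {lc {..<n} d (\<lambda>l. e (f l)) | d. \<forall>l<n. d l \<in> pw 0}"
    then show "y \<in> pts M" using basis_pts[OF b] fn by (auto intro!: pts_lc)
  next
    fix d l assume "lc {..<n} d (\<lambda>l. e (f l)) = 0" "l < n"
    then have "d (f (f l)) = 0" using basis_zero[OF b, of "\<lambda>l. d (f l)" "f l"] fn unfolding eq by blast
    then show "d l = 0" by (simp add: ff)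
  qed
  then show ?thesis by (simp add: f_def)
qed

text \<open>Nakayama's lemma made explicit: vectors independent modulo \<pi> are exchanged one by
  one into the basis. This yields lattice bases adapted to a subspace of L / \<pi>L.\<close>

lemma basis_extension:
  assumes b: "lat_basis E M n e" and x: "\<And>l. l < r \<Longrightarrow> x l \<in> pts M" and ind: "rind {..<r} x"
  shows "r \<le> n \<and> (\<exists>e'. lat_basis E M n e' \<and> (\<forall>l<r. e' l = x l))"
  using x ind
proof (induction r)
  case (Suc r)
  have "rind {..<r} x" by (rule rind_subset[OF Suc.prems(2)]) auto
  then obtain e' where e': "lat_basis E M n e'" "\<And>l. l < r \<Longrightarrow> e' l = x l" and rn: "r \<le> n"
    using Suc.IH Suc.prems(1) by force
  obtain c where c: "\<And>l. l < n \<Longrightarrow> c l \<in> pw 0" "x r = lc {..<n} c e'"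
    using basis_expand[OF e'(1) Suc.prems(1)[of r]] by auto
  \<comment> \<open>If all coordinates of \<open>x r\<close> from r on were divisible by \<pi>, then
    \<open>x r\<close> would depend modulo \<pi> on the earlier vectors.\<close>
  have "\<exists>s<n. r \<le> s \<and> c s \<notin> pw 1"
  proof (rule ccontr)
    assume "\<not> ?thesis"
    then have h: "c s \<in> pw 1" if "s < n" "r \<le> s" for s using that by blast
    have "lc {..<n} c e' = lc {..<r} c e' + lc {r..<n} c e'"
      using rn by (simp add: lessThan_atLeast0 sum.atLeastLessThan_concat)
    moreover have "lc {r..<n} c e' \<in> pM" using h basis_pts[OF e'(1)] by (intro lc_pM) auto
    moreover have "lc {..<Suc r} (\<lambda>l. if l = r then 1 else - c l) x = x r - lc {..<r} c e'"
      using e'(2) by (simp add: sum_negf)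
    ultimately have "lc {..<Suc r} (\<lambda>l. if l = r then 1 else - c l) x \<in> pM"
      using c(2) by (metis add_diff_cancel_left')
    then have "(if r = r then 1 else - c r) \<in> pw 1"
      using c(1) rn by (intro rindD[OF Suc.prems(2), of "\<lambda>l. if l = r then 1 else - c l"]) auto
    then show False by (simp add: mem_pw val_one)
  qed
  then obtain s where s: "s < n" "r \<le> s" "c s \<notin> pw 1" by blast
  have r: "r < n" using s by simp
  have b1: "lat_basis E M n (e'(s := x r))"
    by (rule basis_replace[OF e'(1) s(1) Suc.prems(1) c s(3)]) auto
  show ?case
  proof (intro conjI exI)
    show "Suc r \<le> n" using r by simp
    \<comment> \<open>The new vector entered at place s; the transposition moves it to place r and
      leaves the earlier places alone.\<close>
    show "lat_basis E M n (\<lambda>l. (e'(s := x r)) (if l = r then s else if l = s then r else l))"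
      by (rule basis_swap[OF b1 r s(1)])
    show "\<forall>l<Suc r. (e'(s := x r)) (if l = r then s else if l = s then r else l) = x l"
      using s(2) e'(2) by auto
  qed
qed (use b in auto)

text \<open>A residually independent family in \<open>U\<close> of maximal length spans
  \<open>U\<close> modulo \<open>pM\<close>; \<open>basis_extension\<close> bounds that length by
  n.\<close>

lemma submod_residue_span:
  assumes b: "lat_basis E M n e" and U: "submod U" "pM \<subseteq> U" "U \<subseteq> pts M"
  shows "\<exists>r\<le>n. \<exists>x. (\<forall>l<r. x l \<in> U) \<and> rind {..<r} x \<and>
    quot U pM = {coset pM (lc {..<r} c x) | c. \<forall>l<r. c l \<in> pw 0}"
proof -
  define R where "R r \<longleftrightarrow> (\<exists>x. (\<forall>l<r. x l \<in> U) \<and> rind {..<r} x)" for r :: nat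
  have bd: "r \<le> n" if "R r" for r
    using that basis_extension[OF b] U(3) unfolding R_def by blast
  have "R 0" by (simp add: R_def residue_indep_def)
  define r where "r = Greatest R"
  have r: "R r" unfolding r_def using \<open>R 0\<close> bd by (rule GreatestI_nat)
  have max: "\<not> R (Suc r)" using Greatest_le_nat[of R "Suc r" n] bd unfolding r_def by force
  obtain x where x: "\<And>l. l < r \<Longrightarrow> x l \<in> U" "rind {..<r} x" using r unfolding R_def by blast
  have "\<exists>c. (\<forall>l<r. c l \<in> pw 0) \<and> u - lc {..<r} c x \<in> pM" if u: "u \<in> U" for u
  proof -
    \<comment> \<open>Maximality gives a nontrivial relation. Its coefficient at \<open>u\<close> is
      a unit, since otherwise the family \<open>x\<close> itself would be dependent, and the
      relation can be solved for \<open>u\<close>.\<close>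
    have "\<not> rind {..<Suc r} (x(r := u))"
    proof
      assume "rind {..<Suc r} (x(r := u))"
      then have "R (Suc r)" unfolding R_def using u x by (intro exI[of _ "x(r := u)"]) (auto simp: less_Suc_eq)
      then show False using max by simp
    qed
    then obtain c where c: "\<forall>l<Suc r. c l \<in> pw 0" "lc {..<Suc r} c (x(r := u)) \<in> pM"
      and nc: "\<not> (\<forall>l<Suc r. c l \<in> pw 1)"
      unfolding residue_indep_def ringF_eq by auto
    have eq: "lc {..<Suc r} c (x(r := u)) = lc {..<r} c x + smul M (c r) u" by simp
    have cr: "c r \<notin> pw 1"
    proof
      assume cr: "c r \<in> pw 1"
      then have "smul M (c r) u \<in> pM" using u U(3) by (auto intro: smul_pM)
      then have "lc {..<r} c x \<in> pM" using c(2) unfolding eq by (simp add: subgrp_add_cancel[OF subgrp_pM])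
      then have "\<forall>l<r. c l \<in> pw 1" using rindD[OF x(2), of c] c(1) by auto
      then show False using nc cr by (auto simp: less_Suc_eq)
    qed
    then have i: "c r \<noteq> 0" "inverse (c r) \<in> pw 0" using pw_nonunit c(1) by auto
    have "smul M (inverse (c r)) (lc {..<r} c x + smul M (c r) u) \<in> pM"
      using submod_smul[OF submod_pM i(2)] c(2) eq by simp
    moreover have "smul M (inverse (c r)) (lc {..<r} c x + smul M (c r) u)
      = u - lc {..<r} (\<lambda>l. - (inverse (c r) * c l)) x"
      using i(1) by (simp add: V.scale_right_distrib lc_smul sum_negf)
    ultimately have "u - lc {..<r} (\<lambda>l. - (inverse (c r) * c l)) x \<in> pM" by simp
    moreover have "\<forall>l<r. - (inverse (c r) * c l) \<in> pw 0"
      using pw_mult[OF i(2), of _ 0] c(1) by simp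
    ultimately show ?thesis by (intro exI[of _ "\<lambda>l. - (inverse (c r) * c l)"] conjI)
  qed
  then have "\<exists>c. coset pM u = coset pM (lc {..<r} c x) \<and> (\<forall>l<r. c l \<in> pw 0)" if "u \<in> U" for u
    using that coset_eq_iff[OF subgrp_pM] by meson
  then have "quot U pM \<subseteq> {coset pM (lc {..<r} c x) | c. \<forall>l<r. c l \<in> pw 0}"
    unfolding quot_def by (intro image_subsetI CollectI)
  moreover have "{coset pM (lc {..<r} c x) | c. \<forall>l<r. c l \<in> pw 0} \<subseteq> quot U pM"
    using x(1) by (auto simp: quot_def intro!: imageI submod_lc[OF U(1)])
  ultimately show ?thesis using bd[OF r] x by blast
qed

text \<open>A Gram-Schmidt argument in which \<open>w\<close> generates the values of the form: 1 on
  the unimodular summand, \<open>inverse \<pi>\<close> on the other. Modularity supplies a partner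
  for the part of a new vector that is orthogonal to the duals already built.\<close>

lemma dual_system:
  assumes fin: "finite J" and N: "submod N" and w: "w \<noteq> 0"
    and bound: "\<And>x y. x \<in> N \<Longrightarrow> y \<in> N \<Longrightarrow> form M x y / w \<in> pw 0"
    and modular: "\<And>a. a \<in> N \<Longrightarrow> a \<notin> pM \<Longrightarrow> \<exists>y\<in>N. form M y a = w"
    and x: "\<And>j. j \<in> J \<Longrightarrow> x j \<in> N" and ind: "rind J x"
  shows "\<exists>\<delta>. (\<forall>j\<in>J. \<delta> j \<in> N) \<and> (\<forall>j\<in>J. \<forall>l\<in>J. form M (\<delta> j) (x l) = (if j = l then w else 0))"
  using fin x ind
proof (induction J rule: finite_induct)
  case (insert i J)
  have "rind J x" by (rule rind_subset[OF insert.prems(2)]) (use insert in auto)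
  then obtain \<delta> where \<delta>: "\<And>j. j \<in> J \<Longrightarrow> \<delta> j \<in> N"
    "\<And>j l. j \<in> J \<Longrightarrow> l \<in> J \<Longrightarrow> form M (\<delta> j) (x l) = (if j = l then w else 0)"
    using insert by force
  have xN: "x l \<in> N" if "l \<in> insert i J" for l using insert.prems that by blast
  define c where "c j = form M (\<delta> j) (x i) / w" for j
  have c: "c j \<in> pw 0" if "j \<in> J" for j unfolding c_def using that by (intro bound \<delta> xN) auto
  \<comment> \<open>The part of \<open>x i\<close> orthogonal to the earlier duals; the conjugates
    come from semilinearity in the second argument. Independence keeps it outside
    \<open>pM\<close>.\<close>
  define a where "a = x i - lc J (\<lambda>j. cj (c j)) x"
  have aN: "a \<in> N" unfolding a_def using c cj_pw xN
    by (intro subgrp_diff submod_subgrp submod_lc N) auto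
  have "a \<notin> pM"
  proof
    assume "a \<in> pM"
    moreover have "a = lc (insert i J) (\<lambda>j. if j = i then 1 else - cj (c j)) x"
    proof -
      have "lc J (\<lambda>j. if j = i then 1 else - cj (c j)) x = - lc J (\<lambda>j. cj (c j)) x"
        unfolding sum_negf[symmetric] using insert.hyps by (intro sum.cong) auto
      then show ?thesis using insert.hyps by (simp add: a_def)
    qed
    ultimately have "(if i = i then 1 else - cj (c i)) \<in> pw 1"
      using c cj_pw by (intro rindD[OF insert.prems(2), of "\<lambda>j. if j = i then 1 else - cj (c j)"]) auto
    then show False by (simp add: mem_pw val_one)
  qed
  then obtain y where y: "y \<in> N" "form M y a = w" using modular aN by blast
  \<comment> \<open>Corrected to be orthogonal to the earlier \<open>x l\<close>. The pairing with
    \<open>a\<close> is unchanged, because \<open>a\<close> is orthogonal to the earlier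
    duals.\<close>
  define \<eta> where "\<eta> = y - lc J (\<lambda>j. form M y (x j) / w) \<delta>"
  have \<eta>N: "\<eta> \<in> N" unfolding \<eta>_def using y xN \<delta>
    by (intro subgrp_diff submod_subgrp submod_lc N bound) auto
  have \<eta>x: "form M \<eta> (x l) = 0" if "l \<in> J" for l
  proof -
    have "form M (lc J (\<lambda>j. form M y (x j) / w) \<delta>) (x l)
        = (\<Sum>j\<in>J. if j = l then form M y (x l) else 0)"
      unfolding form_lc_left by (rule sum.cong) (use \<delta>(2) w that in auto)
    then show ?thesis using that insert.hyps by (simp add: \<eta>_def form_diff_left)
  qed
  have \<delta>a: "form M (\<delta> j) a = 0" if "j \<in> J" for j
  proof -
    have "form M (\<delta> j) (lc J (\<lambda>j. cj (c j)) x) = (\<Sum>l\<in>J. if j = l then c j * w else 0)"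
      unfolding form_lc_right by (rule sum.cong) (use \<delta>(2) that in auto)
    then show ?thesis using that insert.hyps w by (simp add: a_def form_diff_right c_def)
  qed
  have "form M \<eta> a = w"
    using y \<delta>a by (simp add: \<eta>_def form_diff_left form_lc_left)
  then have \<eta>i: "form M \<eta> (x i) = w"
    using \<eta>x by (simp add: a_def form_diff_right form_lc_right)
  \<comment> \<open>The earlier duals become orthogonal to \<open>x i\<close>; their other pairings
    survive, because \<eta> is orthogonal to the earlier \<open>x l\<close>.\<close>
  define \<delta>' where "\<delta>' j = (if j = i then \<eta> else \<delta> j - smul M (c j) \<eta>)" for j
  have "\<forall>j\<in>insert i J. \<delta>' j \<in> N"
    using \<eta>N \<delta> c by (auto simp: \<delta>'_def intro!: subgrp_diff submod_subgrp submod_smul N)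
  moreover have "form M (\<delta>' j) (x l) = (if j = l then w else 0)"
    if "j \<in> insert i J" "l \<in> insert i J" for j l
    using that \<eta>i \<eta>x \<delta>(2) insert.hyps w
    by (auto simp: \<delta>'_def form_diff_left form_smul_left c_def)
  ultimately show ?case by blast
qed simp

end

section \<open>Gram congruences and deformations\<close>

text \<open>Hermitian symmetry determines the remaining Gram entries, so conditions are counted on
  and above the diagonal only. The lower bound \<open>a\<close> isolates the block of the last
  vectors.\<close>

definition upper_pairs :: "nat \<Rightarrow> nat \<Rightarrow> (nat \<times> nat) set" where
  "upper_pairs a n = {(j, l). a \<le> j \<and> j \<le> l \<and> l < n}"

lemma finite_upper_pairs: "finite (upper_pairs a n)"
  by (rule finite_subset[of _ "{..<n} \<times> {..<n}"]) (auto simp: upper_pairs_def)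

lemma upper_pairs_Suc: "a \<le> n \<Longrightarrow> upper_pairs a (Suc n) = upper_pairs a n \<union> {a..n} \<times> {n}"
  by (auto simp: upper_pairs_def)

lemma sum_upper_pairs_Suc:
  "a \<le> n \<Longrightarrow> sum f (upper_pairs a (Suc n)) = sum f (upper_pairs a n) + (\<Sum>j=a..n. f (j, n))"
proof -
  assume "a \<le> n"
  moreover have "upper_pairs a n \<inter> {a..n} \<times> {n} = {}" by (auto simp: upper_pairs_def)
  moreover have "sum f ({a..n} \<times> {n}) = (\<Sum>j=a..n. f (j, n))"
    by (rule sum.reindex_cong[of "\<lambda>j. (j, n)"]) (auto simp: inj_on_def)
  ultimately show ?thesis
    by (simp add: upper_pairs_Suc sum.union_disjoint finite_upper_pairs)
qed

lemma card_upper_pairs: "a \<le> n \<Longrightarrow> 2 * card (upper_pairs a n) = (n - a) * (n - a + 1)"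
proof (induction n rule: dec_induct)
  case base
  have "upper_pairs a a = {}" by (auto simp: upper_pairs_def)
  then show ?case by simp
next
  case (step n)
  obtain k where "n = a + k" using step.hyps le_Suc_ex by blast
  then show ?case using step sum_upper_pairs_Suc[of a n "\<lambda>_. 1::nat"] by simp
qed

text \<open>The dimension over \<open>F\<^sub>0\<close> of hermitian matrices of size n: a diagonal
  entry lies in \<open>F\<^sub>0\<close>, every other one in F, of degree 2.\<close>

lemma sum_upper_pairs_sq: "(\<Sum>(j, l)\<in>upper_pairs 0 n. if j = l then 1 else 2) = n\<^sup>2"
proof (induction n)
  case 0
  have "upper_pairs 0 0 = {}" by (auto simp: upper_pairs_def)
  then show ?case by simp
next
  case (Suc n)
  have "(\<Sum>j<n. if j = n then 1 else 2::nat) = (\<Sum>j<n. 2)" by (rule sum.cong) auto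
  moreover have "{0..n} = insert n {..<n}" by auto
  ultimately have "(\<Sum>j=0..n. if j = n then 1 else 2::nat) = 2 * n + 1" by simp
  moreover have "(\<Sum>(j, l)\<in>upper_pairs 0 (Suc n). if j = l then 1 else 2::nat) =
      n\<^sup>2 + (\<Sum>j=0..n. if j = n then 1 else 2)"
    using Suc sum_upper_pairs_Suc[of 0 n "\<lambda>(j, l). if j = l then 1 else 2::nat"] by simp
  ultimately show ?case by (simp add: power2_eq_square)
qed

context herm_module
begin

lemma form_diag_base: "form M x x \<in> base E"
  unfolding cj_fixed_iff[symmetric] using form_conj[of x x] by (rule sym)

text \<open>On the diagonal the values lie in \<open>F\<^sub>0\<close>, where the valuation is even, so that no condition is gained
  from an odd level \<open>g\<close> to the next.\<close>

lemma gram_step: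
  fixes J :: "(nat \<times> nat) set" and T :: "nat \<Rightarrow> nat \<Rightarrow> 'f"
  assumes J: "finite J" "\<And>j l. (j, l) \<in> J \<Longrightarrow> j < n \<and> l < n"
    and T: "\<And>j. j < n \<Longrightarrow> T j j \<in> base E"
    and \<beta>: "\<And>j. j < n \<Longrightarrow> submod (\<beta> j) \<and> \<kappa> \<subseteq> \<beta> j" and \<kappa>: "submod \<kappa>"
    and per: "\<And>x b. x \<in> A \<Longrightarrow> b \<in> FS {..<n} \<beta> \<Longrightarrow> x + b \<in> A"
    and lev: "\<And>x j l. x \<in> A \<Longrightarrow> (j, l) \<in> J \<Longrightarrow> form M (x j) (x l) - T j l \<in> pw g"
    and solve: "\<And>x u. x \<in> A \<Longrightarrow> (\<And>j l. u j l \<in> pw g) \<Longrightarrow> (\<And>j. u j j \<in> base E) \<Longrightarrow>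
      \<exists>b\<in>FS {..<n} \<beta>. \<forall>(j, l)\<in>J. form M (b j) (x l) + form M (x j) (b l) - u j l \<in> pw (g + 1)"
    and small: "\<And>x y j l. (j, l) \<in> J \<Longrightarrow> x \<in> \<beta> j \<Longrightarrow> y \<in> \<beta> l \<Longrightarrow> form M x y \<in> pw (g + 1)"
    and smallK: "\<And>x y. x \<in> \<kappa> \<Longrightarrow> y \<in> pts M \<Longrightarrow> form M x y \<in> pw (g + 1)"
    and \<kappa>_pts: "\<kappa> \<subseteq> pts M" and A_pts: "\<And>x j. x \<in> A \<Longrightarrow> j < n \<Longrightarrow> x j \<in> pts M"
  shows "card (quot A (FS {..<n} (\<lambda>_. \<kappa>))) = (\<Prod>(j, l)\<in>J. if j = l \<and> odd g then 1 else q) *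
    card (quot {x \<in> A. \<forall>(j, l)\<in>J. form M (x j) (x l) - T j l \<in> pw (g + 1)} (FS {..<n} (\<lambda>_. \<kappa>)))"
proof -
  define f where "f x = (\<lambda>(j, l). if (j, l) \<in> J then form M (x j) (x l) - T j l else 0)" for x
  \<comment> \<open>The group in which defects of level e live; hermitian symmetry confines its
    diagonal entries to \<open>F\<^sub>0\<close>.\<close>
  define D where "D e = FS J (\<lambda>(j, l). if j = l then base E \<inter> pw e else pw e)" for e
  have sgD: "subgrp (D e)" for e
    unfolding D_def by (intro subgrp_FS) (auto simp: subgrp_pw subgrp_base_pw)
  have sgK: "subgrp (FS {..<n} (\<lambda>_. \<kappa>))" by (simp add: \<kappa> subgrp_FS submod_subgrp)
  have memD: "f x - f y - t \<in> D e \<longleftrightarrow>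
      (\<forall>(j, l)\<in>J. form M (x j) (x l) - form M (y j) (y l) - t (j, l) \<in> pw e)"
    if "t \<in> D g" for x y t e
  proof -
    have "f x - f y - t \<in> D e" if h: "\<forall>(j, l)\<in>J. form M (x j) (x l) - form M (y j) (y l) - t (j, l) \<in> pw e"
      unfolding D_def
    proof (rule FS_I)
      fix z assume z: "z \<in> J"
      obtain j l where jl: "z = (j, l)" by (cases z)
      have "t z \<in> (if j = l then base E \<inter> pw g else pw g)"
        using FS_D[OF \<open>t \<in> D g\<close>[unfolded D_def] z] by (simp add: jl)
      then have "j = l \<Longrightarrow> form M (x j) (x l) - form M (y j) (y l) - t z \<in> base E"
        by (auto intro!: base_diff form_diag_base)
      then show "(f x - f y - t) z \<in> (case z of (j, l) \<Rightarrow> if j = l then base E \<inter> pw e else pw e)"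
        using h z by (auto simp: f_def jl)
    next
      fix z assume "z \<notin> J"
      then show "(f x - f y - t) z = 0" using FS_out[OF \<open>t \<in> D g\<close>[unfolded D_def]]
        by (cases z) (auto simp: f_def)
    qed
    moreover have "form M (x j) (x l) - form M (y j) (y l) - t (j, l) \<in> pw e"
      if h: "f x - f y - t \<in> D e" and jl: "(j, l) \<in> J" for j l
      using FS_D[OF h[unfolded D_def] jl] jl by (auto simp: f_def split: if_splits)
    ultimately show ?thesis by blast
  qed
  have fD: "f x \<in> D e \<longleftrightarrow> (\<forall>(j, l)\<in>J. form M (x j) (x l) - T j l \<in> pw e)" for x e
  proof -
    have "f x \<in> D e" if h: "\<forall>(j, l)\<in>J. form M (x j) (x l) - T j l \<in> pw e"
      unfolding D_def
    proof (rule FS_I)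
      fix z assume z: "z \<in> J"
      then show "f x z \<in> (case z of (j, l) \<Rightarrow> if j = l then base E \<inter> pw e else pw e)"
        using h J(2) T form_diag_base by (cases z) (auto simp: f_def intro!: base_diff)
    qed (auto simp: f_def)
    moreover have "form M (x j) (x l) - T j l \<in> pw e" if h: "f x \<in> D e" and jl: "(j, l) \<in> J" for j l
      using FS_D[OF h[unfolded D_def] jl] jl by (auto simp: f_def split: if_splits)
    ultimately show ?thesis by blast
  qed
  have "card (quot A (FS {..<n} (\<lambda>_. \<kappa>))) = card (quot (D g) (D (g + 1))) *
    card (quot {x \<in> A. f x \<in> D (g + 1)} (FS {..<n} (\<lambda>_. \<kappa>)))"
  proof (rule card_quot_equidistributed[where B = "FS {..<n} \<beta>"])
    show "subgrp (FS {..<n} \<beta>)" using \<beta> by (intro subgrp_FS submod_subgrp) auto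
    show "FS {..<n} (\<lambda>_. \<kappa>) \<subseteq> FS {..<n} \<beta>" using \<beta> by (intro FS_mono) auto
    have "pw (g + 1) \<subseteq> pw g" by (rule subsetI, erule pw_mono) simp
    then have "(if b then base E \<inter> pw (g + 1) else pw (g + 1)) \<subseteq> (if b then base E \<inter> pw g else pw g)" for b
      by (simp only: split: if_split) blast
    then show "D (g + 1) \<subseteq> D g" unfolding D_def by (intro FS_mono) (simp only: split_beta)
    show "f a \<in> D g" if "a \<in> A" for a using lev[OF that] by (auto simp: fD)
    show "f (a + k) - f a \<in> D (g + 1)" if a: "a \<in> A" and k: "k \<in> FS {..<n} (\<lambda>_. \<kappa>)" for a k
    proof -
      have "form M ((a + k) j) ((a + k) l) - form M (a j) (a l) - 0 (j, l) \<in> pw (g + 1)"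
        if jl: "(j, l) \<in> J" for j l
      proof -
        have kk: "k j \<in> \<kappa>" "k l \<in> \<kappa>" "k l \<in> pts M" "a j \<in> pts M" "a l \<in> pts M"
          using k J(2)[OF jl] \<kappa>_pts A_pts[OF a] by (auto dest: FS_D)
        have "form M (k j) (a l) + cj (form M (k l) (a j)) + form M (k j) (k l) \<in> pw (g + 1)"
          using smallK kk cj_pw by (intro pw_add) auto
        moreover have "form M ((a + k) j) ((a + k) l) - form M (a j) (a l) - 0 (j, l) =
          form M (k j) (a l) + cj (form M (k l) (a j)) + form M (k j) (k l)"
          using form_conj[of "a j" "k l"] form_conj[of "k l" "a j"]
          by (simp add: form_add_left form_add_right)
        ultimately show ?thesis by (simp only:)
      qed
      then have "f (a + k) - f a - 0 \<in> D (g + 1)"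
        using memD[OF subgrp_0[OF sgD], of "a + k" a] by auto
      then show ?thesis by simp
    qed
    show "\<exists>b\<in>FS {..<n} \<beta>. \<forall>b'\<in>FS {..<n} \<beta>. f (a + b' + b) - f (a + b') - t \<in> D (g + 1)"
      if a: "a \<in> A" and t: "t \<in> D g" for a t
    proof -
      define u where "u j l = (if (j, l) \<in> J then t (j, l) else 0)" for j l
      have u: "u j l \<in> pw g" "u j j \<in> base E" for j l
        using FS_D[OF t[unfolded D_def], of "(j, l)"] FS_D[OF t[unfolded D_def], of "(j, j)"]
        by (auto simp: u_def base_closed split: if_splits)
      obtain b where b: "b \<in> FS {..<n} \<beta>"
        and sol: "\<And>j l. (j, l) \<in> J \<Longrightarrow> form M (b j) (a l) + form M (a j) (b l) - u j l \<in> pw (g + 1)"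
        using solve[OF a, of u] u by blast
      have "form M ((a + b' + b) j) ((a + b' + b) l) - form M ((a + b') j) ((a + b') l) - t (j, l) \<in> pw (g + 1)"
        if b': "b' \<in> FS {..<n} \<beta>" and jl: "(j, l) \<in> J" for b' j l
      proof -
        have bb: "b j \<in> \<beta> j" "b l \<in> \<beta> l" "b' j \<in> \<beta> j" "b' l \<in> \<beta> l"
          using b b' J(2)[OF jl] by (auto dest: FS_D)
        \<comment> \<open>The defect changes by the linear term solved for at \<open>a\<close> and
          by terms in which two shifts meet, which \<open>small\<close> absorbs. Hence one
          \<open>b\<close> serves the whole coset of \<open>a\<close>.\<close>
        have "(form M (b j) (a l) + form M (a j) (b l) - u j l) + form M (b j) (b' l)
            + form M (b' j) (b l) + form M (b j) (b l) \<in> pw (g + 1)"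
          by (intro pw_add sol small[OF jl] jl bb)
        then show ?thesis using jl by (simp add: form_add_left form_add_right u_def algebra_simps)
      qed
      then show ?thesis using b memD[OF t] by (intro bexI[of _ b]) auto
    qed
  qed (use per sgD sgK in auto)
  moreover have "card (quot (D g) (D (g + 1))) = (\<Prod>(j, l)\<in>J. if j = l \<and> odd g then 1 else q)"
    unfolding D_def using J(1)
    by (subst card_quot_FS) (auto simp: subgrp_pw subgrp_base_pw card_quot_base_pw card_quot_pw intro!: prod.cong)
  ultimately show ?thesis by (simp add: fD)
qed

end

text \<open>\<open>P\<close> is the projection of \<open>M\<close> onto a unimodular summand of rank \<open>m\<close> along a summand of rank \<open>h\<close>
  whose form is perfect with values in \<open>\<pi>\<^sup>-\<^sup>1 O\<^sub>F\<close>. It is applied to \<open>I \<bottom> H\<^sup>k\<close>, and to \<open>H\<^sup>k\<close> with \<open>P = 0\<close>.\<close>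

locale split_module = herm_module p E M for p and E :: "'f::field_char_0 quad_ext"
    and M :: "('f, 'v::ab_group_add) herm" +
  fixes P :: "'v \<Rightarrow> 'v" and m h :: nat
  assumes P_add: "P (x + y) = P x + P y"
    and P_smul: "P (smul M a x) = smul M a (P x)"
    and P_P: "P (P x) = P x"
    and P_pts: "x \<in> pts M \<Longrightarrow> P x \<in> pts M"
    and P_orth: "form M (P x) (y - P y) = 0"
    and form_P: "x \<in> pts M \<Longrightarrow> y \<in> pts M \<Longrightarrow> form M (P x) (P y) \<in> pw 0"
    and form_pts: "x \<in> pts M \<Longrightarrow> y \<in> pts M \<Longrightarrow> form M x y \<in> pw (- 1)"
    and modular_P: "x \<in> pts M \<Longrightarrow> P x \<notin> pM \<Longrightarrow> \<exists>y\<in>pts M. form M (P y) (P x) = 1"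
    and modular_Q: "x \<in> pts M \<Longrightarrow> x - P x \<notin> pM \<Longrightarrow>
      \<exists>y\<in>pts M. form M (y - P y) (x - P x) = inverse \<pi>"
    and card_P: "card (quot {x \<in> pts M. P x = x} ({x \<in> pts M. P x = x} \<inter> pM)) = q ^ m"
    and card_Q: "card (quot {x \<in> pts M. P x = 0} ({x \<in> pts M. P x = 0} \<inter> pM)) = q ^ h"
begin

definition "Q x = x - P x"
definition "MP = {x \<in> pts M. P x = x}"
definition "MQ = {x \<in> pts M. P x = 0}"
text \<open>The multiple by \<pi>^\<alpha> of the unimodular part plus the multiple by \<pi>^\<beta>
  of the other part. Two exponents are kept because the form on the second part has one more \<pi>
  in the denominator, so that the admissible deformations differ.\<close>

definition "lev \<alpha> \<beta> = {x \<in> pts M. P x \<in> pm \<alpha> \<and> Q x \<in> pm \<beta>}"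

lemma P_0: "P 0 = 0" using P_smul[of 0 0] by simp

lemma P_uminus: "P (- x) = - P x" using P_smul[of "- 1" x] by simp

lemma P_diff: "P (x - y) = P x - P y" using P_add[of x "- y"] by (simp add: P_uminus)

lemma Q_add: "Q (x + y) = Q x + Q y" and Q_diff: "Q (x - y) = Q x - Q y" and Q_0: "Q 0 = 0"
  and Q_smul: "Q (smul M a x) = smul M a (Q x)" and P_Q: "P (Q x) = 0" and Q_P: "Q (P x) = 0"
  and Q_Q: "Q (Q x) = Q x" and P_plus_Q: "P x + Q x = x"
  by (simp_all add: Q_def P_add P_diff P_0 P_smul P_P V.scale_right_diff_distrib)

lemma P_sum: "P (sum f J) = (\<Sum>j\<in>J. P (f j))"
  by (induction J rule: infinite_finite_induct) (simp_all add: P_add P_0)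

lemma Q_sum: "Q (sum f J) = (\<Sum>j\<in>J. Q (f j))"
  by (induction J rule: infinite_finite_induct) (simp_all add: Q_add Q_0)

lemma P_lc: "P (lc J c x) = lc J c (\<lambda>j. P (x j))" and Q_lc: "Q (lc J c x) = lc J c (\<lambda>j. Q (x j))"
  by (simp_all add: P_sum Q_sum P_smul Q_smul)

lemma Q_pts: "x \<in> pts M \<Longrightarrow> Q x \<in> pts M"
  by (simp add: Q_def subgrp_diff[OF subgrp_pts] P_pts)

lemma P_MP: "x \<in> pts M \<Longrightarrow> P x \<in> MP" and Q_MQ: "x \<in> pts M \<Longrightarrow> Q x \<in> MQ"
  by (simp_all add: MP_def MQ_def P_pts P_P Q_pts P_Q)

lemma MP_D: "x \<in> MP \<Longrightarrow> x \<in> pts M" "x \<in> MP \<Longrightarrow> P x = x" "x \<in> MP \<Longrightarrow> Q x = 0"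
  and MQ_D: "x \<in> MQ \<Longrightarrow> x \<in> pts M" "x \<in> MQ \<Longrightarrow> P x = 0" "x \<in> MQ \<Longrightarrow> Q x = x"
  by (simp_all add: MP_def MQ_def Q_def)

lemma submod_MP: "submod MP" and submod_MQ: "submod MQ"
  using subgrp_diff[OF subgrp_pts]
  by (auto simp: submod_def subgrp_def MP_def MQ_def pts_0 P_0 P_diff P_smul pts_smul)

lemma P_pm: "x \<in> pm k \<Longrightarrow> P x \<in> pm k" and Q_pm: "x \<in> pm k \<Longrightarrow> Q x \<in> pm k"
  by (auto simp: scaled_def P_smul Q_smul P_pts Q_pts)

lemma P_pM: "x \<in> pM \<Longrightarrow> P x \<in> pM" and Q_pM: "x \<in> pM \<Longrightarrow> Q x \<in> pM"
  using P_pm[of x 1] Q_pm[of x 1] by simp_all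

lemma pM_iff: "x \<in> pM \<longleftrightarrow> P x \<in> pM \<and> Q x \<in> pM"
  using subgrp_add[OF subgrp_pM, of "P x" "Q x"] P_pM Q_pM by (auto simp: P_plus_Q)

lemma submod_lev: "submod (lev \<alpha> \<beta>)"
  using subgrp_diff[OF subgrp_pts] subgrp_diff[OF subgrp_pm] submod_smul[OF submod_pm] subgrp_0[OF subgrp_pm]
  by (auto simp: submod_def subgrp_def lev_def pts_0 P_0 Q_0 P_diff Q_diff P_smul Q_smul pts_smul)

lemma lev_mono: "\<alpha>' \<le> \<alpha> \<Longrightarrow> \<beta>' \<le> \<beta> \<Longrightarrow> lev \<alpha> \<beta> \<subseteq> lev \<alpha>' \<beta>'"
  using pm_mono by (auto simp: lev_def)

lemma pm_lev: "pm k = lev k k"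
proof (intro equalityI subsetI)
  show "x \<in> lev k k" if "x \<in> pm k" for x
    using that P_pm Q_pm subsetD[OF pm_subset_pts that] by (simp add: lev_def)
  show "x \<in> pm k" if "x \<in> lev k k" for x
    using that subgrp_add[OF subgrp_pm, of "P x" k "Q x"] by (simp add: lev_def P_plus_Q)
qed

lemma pM_lev: "pM = lev 1 1" and pts_lev: "pts M = lev 0 0"
  using pm_lev[of 1] pm_lev[of 0] by (simp_all only: pm_0 pm_1)

lemma lev_0_1: "lev 0 1 = {x \<in> pts M. Q x \<in> pM}"
  unfolding lev_def pm_0 pm_1 by (auto simp: P_pts)

lemma form_PQ: "form M x y = form M (P x) (P y) + form M (Q x) (Q y)"
proof -
  have 1: "form M (P x) (Q y) = 0" for x y using P_orth by (simp add: Q_def)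
  have 2: "form M (Q x) (P y) = 0" using form_conj[of "Q x" "P y"] 1 by (simp add: cj_0)
  have "form M x y = form M (P x + Q x) (P y + Q y)" by (simp add: P_plus_Q)
  then show ?thesis using 1 2 by (simp add: form_add_left form_add_right)
qed

text \<open>\<open>R\<close> stands for \<open>P\<close> with c = 0 or for \<open>Q\<close> with c =
  -1.\<close>

lemma form_scaled:
  assumes N: "\<And>x y. x \<in> pts M \<Longrightarrow> y \<in> pts M \<Longrightarrow> form M (R x) (R y) \<in> pw c"
    and R: "\<And>a x. R (smul M a x) = smul M a (R x)" "\<And>x. R (R x) = R x"
    and x: "R x \<in> pm \<alpha>" and y: "R y \<in> pm \<gamma>"
  shows "form M (R x) (R y) \<in> pw (int \<alpha> + int \<gamma> + c)"
proof -
  obtain x' y' where x': "R x = smul M (\<pi> ^ \<alpha>) x'" "x' \<in> pts M" and y': "R y = smul M (\<pi> ^ \<gamma>) y'" "y' \<in> pts M"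
    using x y by (auto simp: scaled_def)
  have "form M (R (R x)) (R (R y)) = \<pi> ^ \<alpha> * (cj (\<pi> ^ \<gamma>) * form M (R x') (R y'))"
    by (simp only: x' y' R(1) form_smul_left form_smul_right mult.left_commute)
  moreover have "cj (\<pi> ^ \<gamma>) \<in> pw (int \<gamma>)" by (simp add: cj_pw pi_power_pw)
  ultimately show ?thesis using pw_mult[OF pi_power_pw[of \<alpha>] pw_mult[OF _ N[OF x'(2) y'(2)]]]
    by (simp add: R(2) add.assoc)
qed

lemma form_Q: "x \<in> pts M \<Longrightarrow> y \<in> pts M \<Longrightarrow> form M (Q x) (Q y) \<in> pw (- 1)"
  by (simp add: form_pts Q_pts)

text \<open>By orthogonality the \<open>P\<close>-parts contribute the exponent \<alpha> + \<gamma>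
  and the \<open>Q\<close>-parts \<beta> + \<delta> - 1, as the form on \<open>MQ\<close> reaches
  down to \<pi>^{-1}. The level conditions imposed on deformations below all come from these two
  inequalities.\<close>

lemma form_lev:
  assumes "x \<in> lev \<alpha> \<beta>" "y \<in> lev \<gamma> \<delta>" "g \<le> int \<alpha> + int \<gamma>" "g + 1 \<le> int \<beta> + int \<delta>"
  shows "form M x y \<in> pw g"
proof -
  have "form M (P x) (P y) \<in> pw (int \<alpha> + int \<gamma> + 0)"
    using assms form_P by (intro form_scaled) (auto simp: lev_def P_smul P_P)
  moreover have "form M (Q x) (Q y) \<in> pw (int \<beta> + int \<delta> + - 1)"
    using assms form_Q by (intro form_scaled) (auto simp: lev_def Q_smul Q_Q)
  ultimately have "form M (P x) (P y) \<in> pw g" "form M (Q x) (Q y) \<in> pw g"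
    using assms(3,4) by (auto elim!: pw_mono)
  then show ?thesis by (subst form_PQ) (rule pw_add)
qed

lemma card_quot_pts_pM: "card (quot (pts M) pM) = q ^ (m + h)"
proof -
  have pts: "pts M = {x + y | x y. x \<in> MP \<and> y \<in> MQ}"
  proof (intro equalityI subsetI)
    fix x assume "x \<in> pts M"
    then show "x \<in> {x + y | x y. x \<in> MP \<and> y \<in> MQ}"
      using P_MP Q_MQ P_plus_Q[of x] by (metis (mono_tags, lifting) mem_Collect_eq)
  qed (auto simp: MP_def MQ_def pts_add)
  have pM: "pM = {x + y | x y. x \<in> MP \<inter> pM \<and> y \<in> MQ \<inter> pM}"
  proof (intro equalityI subsetI)
    fix x assume x: "x \<in> pM"
    then have "P x \<in> MP \<inter> pM" "Q x \<in> MQ \<inter> pM" "x = P x + Q x"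
      using pM_subset_pts P_MP Q_MQ P_pM Q_pM by (auto simp: P_plus_Q)
    then show "x \<in> {x + y | x y. x \<in> MP \<inter> pM \<and> y \<in> MQ \<inter> pM}" by blast
  qed (auto intro: subgrp_add[OF subgrp_pM])
  have "card (quot {x + y | x y. x \<in> MP \<and> y \<in> MQ} {x + y | x y. x \<in> MP \<inter> pM \<and> y \<in> MQ \<inter> pM}) =
    card (quot MP (MP \<inter> pM)) * card (quot MQ (MQ \<inter> pM))"
  proof (rule card_quot_direct_sum)
    show "MP \<inter> MQ = {0}" by (auto simp: MP_def MQ_def pts_0 P_0)
    show "subgrp (MP \<inter> pM)" "subgrp (MQ \<inter> pM)"
      using submod_subgrp[OF submod_MP] submod_subgrp[OF submod_MQ] subgrp_pM
      by (auto simp: subgrp_def)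
  qed (auto simp: submod_subgrp submod_MP submod_MQ)
  then show ?thesis using card_P card_Q unfolding pts[symmetric] pM[symmetric]
    by (simp add: MP_def MQ_def power_add)
qed

lemma card_quot_pts_pm: "card (quot (pts M) (pm e)) = q ^ (e * (m + h))"
proof (induction e)
  case 0
  show ?case using card_quot_self[OF subgrp_pts] by (simp only: pm_0) simp
next
  case (Suc e)
  have "card (quot (pts M) pM) = card (quot (pm e) (pm (Suc e)))"
  proof (rule card_quot_eqI[where f = "smul M (\<pi> ^ e)"])
    show "smul M (\<pi> ^ e) x \<in> pm e" if "x \<in> pts M" for x using that by (simp add: scaled_def)
    show "\<exists>x\<in>pts M. smul M (\<pi> ^ e) x - y \<in> pm (Suc e)" if y: "y \<in> pm e" for y
    proof -
      obtain x where "x \<in> pts M" "y = smul M (\<pi> ^ e) x" using y by (auto simp: scaled_def)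
      then show ?thesis using subgrp_0[OF subgrp_pm[of "Suc e"]] by (intro bexI[of _ x]) auto
    qed
    show "smul M (\<pi> ^ e) x - smul M (\<pi> ^ e) y \<in> pm (Suc e) \<longleftrightarrow> x - y \<in> pM" for x y
      by (subst (1 2) mem_scaled) (simp_all add: mult.assoc flip: V.scale_right_diff_distrib)
  qed (rule subgrp_pM subgrp_pm)+
  moreover have "card (quot (pts M) (pm (Suc e))) = card (quot (pts M) (pm e)) * card (quot (pm e) (pm (Suc e)))"
    using pm_subset_pts pm_mono[of e "Suc e"]
    by (intro card_quot_mult subgrp_pm) (auto intro: pts_add)
  ultimately show ?case using Suc card_quot_pts_pM by (simp add: power_add mult.commute)
qed

text \<open>Only the residue of the \<open>Q\<close>-part survives modulo \<open>lev 0 1\<close>, so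
  the quotient is that of \<open>MQ\<close> by its multiples of \<pi>.\<close>

lemma card_quot_pts_lev: "card (quot (pts M) (lev 0 1)) = q ^ h"
proof -
  have pts: "pts M = {x + y | x y. x \<in> MQ \<and> y \<in> lev 0 1}"
  proof (intro equalityI subsetI)
    fix x assume x: "x \<in> pts M"
    then have "P x \<in> lev 0 1" unfolding lev_0_1 by (simp add: P_pts Q_P subgrp_0[OF subgrp_pM])
    moreover have "Q x \<in> MQ" "x = Q x + P x"
      using x Q_MQ P_plus_Q[of x] by (simp_all add: add.commute)
    ultimately have "Q x \<in> MQ" "P x \<in> lev 0 1" "x = Q x + P x" by auto
    then show "x \<in> {x + y | x y. x \<in> MQ \<and> y \<in> lev 0 1}" by blast
  qed (auto simp: MQ_def lev_def pts_add)
  have "card (quot (pts M) (lev 0 1)) = card (quot MQ (MQ \<inter> lev 0 1))"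
    by (subst pts) (intro card_quot_second_iso submod_subgrp submod_MQ submod_lev)
  moreover have "MQ \<inter> lev 0 1 = MQ \<inter> pM" unfolding lev_0_1 by (auto simp: MQ_def Q_def)
  ultimately show ?thesis using card_Q by (simp add: MQ_def)
qed

end

section \<open>Frames and the deformations that correct their Gram matrices\<close>

context split_module
begin

definition frames :: "nat \<Rightarrow> nat \<Rightarrow> (nat \<Rightarrow> 'v) set" where
  "frames i n = {x \<in> FS {..<n} (\<lambda>_. pts M). (\<forall>l<i. Q (x l) \<in> pM) \<and>
     rind {..<i} (\<lambda>l. P (x l)) \<and> rind {i..<n} (\<lambda>l. Q (x l))}"

text \<open>The Gram congruences are imposed at three levels: \<open>g1\<close> among the first \<open>i\<close> vectors, \<open>g3\<close> among the
  others and \<open>g2\<close> between the two groups.\<close>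

definition gram_frames :: "nat \<Rightarrow> nat \<Rightarrow> (nat \<Rightarrow> nat \<Rightarrow> 'f) \<Rightarrow> int \<Rightarrow> int \<Rightarrow> int \<Rightarrow> (nat \<Rightarrow> 'v) set" where
  "gram_frames i n T g1 g2 g3 = {x \<in> frames i n. \<forall>(j, l)\<in>upper_pairs 0 n.
     form M (x j) (x l) - T j l \<in> pw (if l < i then g1 else if j < i then g2 else g3)}"

lemma gram_framesI:
  assumes "x \<in> frames i n" "\<And>j l. (j, l) \<in> upper_pairs 0 n \<Longrightarrow>
    form M (x j) (x l) - T j l \<in> pw (if l < i then g1 else if j < i then g2 else g3)"
  shows "x \<in> gram_frames i n T g1 g2 g3"
  using assms by (auto simp: gram_frames_def split del: if_split)

lemma gram_framesD:
  assumes "x \<in> gram_frames i n T g1 g2 g3"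
  shows "x \<in> frames i n" "(j, l) \<in> upper_pairs 0 n \<Longrightarrow>
    form M (x j) (x l) - T j l \<in> pw (if l < i then g1 else if j < i then g2 else g3)"
  using assms by (auto simp: gram_frames_def split del: if_split)

lemma frames_pts: "x \<in> frames i n \<Longrightarrow> l < n \<Longrightarrow> x l \<in> pts M"
  by (auto simp: frames_def dest: FS_D)

lemma frames_lev: "x \<in> frames i n \<Longrightarrow> l < n \<Longrightarrow> x l \<in> lev 0 (if l < i then 1 else 0)"
proof -
  assume x: "x \<in> frames i n" and l: "l < n"
  show ?thesis
  proof (cases "l < i")
    case True
    then have "x l \<in> lev 0 1" using frames_pts[OF x l] x unfolding lev_0_1 by (auto simp: frames_def)
    then show ?thesis using True by simp
  next
    case False
    then show ?thesis using frames_pts[OF x l] pts_lev by simp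
  qed
qed

lemma lev_Q_pM: "b \<in> lev \<alpha> \<beta> \<Longrightarrow> 1 \<le> \<beta> \<Longrightarrow> Q b \<in> pM"
  and lev_P_pM: "b \<in> lev \<alpha> \<beta> \<Longrightarrow> 1 \<le> \<alpha> \<Longrightarrow> P b \<in> pM"
  using pm_mono[of 1 \<beta>] pm_mono[of 1 \<alpha>] by (auto simp: lev_def)

text \<open>Being a frame depends on residues only, and for the vectors from i on only on the
  residue of the \<open>Q\<close>-part. Their \<open>P\<close>-parts may be shifted freely, which
  \<open>gram_frames_cross\<close> exploits.\<close>

lemma frames_add:
  assumes x: "x \<in> frames i n" and b: "b \<in> FS {..<n} (\<lambda>l. lev (\<alpha> l) (\<beta> l))" and i: "i \<le> n"
    and \<alpha>: "\<And>l. l < i \<Longrightarrow> 1 \<le> \<alpha> l" and \<beta>: "\<And>l. l < n \<Longrightarrow> 1 \<le> \<beta> l"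
  shows "x + b \<in> frames i n"
proof -
  have bl: "b l \<in> lev (\<alpha> l) (\<beta> l)" if "l < n" for l using FS_D[OF b] that by simp
  have Qb: "Q (b l) \<in> pM" if "l < n" for l using lev_Q_pM[OF bl \<beta>] that by simp
  have Pb: "P (b l) \<in> pM" if "l < i" for l using lev_P_pM[OF bl \<alpha>] that i by simp
  show ?thesis unfolding frames_def
  proof (intro CollectI conjI allI impI)
    show "x + b \<in> FS {..<n} (\<lambda>_. pts M)"
      using x b by (auto simp: frames_def FS_def lev_def intro: pts_add)
    show "Q ((x + b) l) \<in> pM" if "l < i" for l
      using x that Qb[of l] i by (auto simp: frames_def Q_add intro: subgrp_add[OF subgrp_pM])
    show "rind {..<i} (\<lambda>l. P ((x + b) l))"
    proof (rule rind_cong_mod)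
      show "rind {..<i} (\<lambda>l. P (x l))" using x by (simp add: frames_def)
      show "P (x l) - P ((x + b) l) \<in> pM" if "l \<in> {..<i}" for l
        using Pb[of l] that by (simp add: P_add subgrp_minus_iff[OF subgrp_pM])
    qed
    show "rind {i..<n} (\<lambda>l. Q ((x + b) l))"
    proof (rule rind_cong_mod)
      show "rind {i..<n} (\<lambda>l. Q (x l))" using x by (simp add: frames_def)
      show "Q (x l) - Q ((x + b) l) \<in> pM" if "l \<in> {i..<n}" for l
        using Qb[of l] that by (simp add: Q_add subgrp_minus_iff[OF subgrp_pM])
    qed
  qed
qed

text \<open>The bounds on \<alpha> and \<beta> are those of \<open>form_lev\<close> for a shift
  against a frame vector. The extra 1 appears when the index of that vector is below i, since its
  \<open>Q\<close>-part is then divisible by \<pi>. The quantified g only names the level at the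
  pair.\<close>

lemma gram_frames_add:
  assumes x: "x \<in> gram_frames i n T g1 g2 g3" and b: "b \<in> FS {..<n} (\<lambda>l. lev (\<alpha> l) (\<beta> l))" and i: "i \<le> n"
    and \<alpha>: "\<And>l. l < i \<Longrightarrow> 1 \<le> \<alpha> l" and \<beta>: "\<And>l. l < n \<Longrightarrow> 1 \<le> \<beta> l"
    and g: "\<And>j l. (j, l) \<in> upper_pairs 0 n \<Longrightarrow>
      \<exists>g. g = (if l < i then g1 else if j < i then g2 else g3) \<and> g \<le> int (\<alpha> j) \<and> g \<le> int (\<alpha> l) \<and>
        g + 1 \<le> int (\<beta> j) + (if l < i then 1 else 0) \<and> g + 1 \<le> int (\<beta> l) + (if j < i then 1 else 0)"
  shows "x + b \<in> gram_frames i n T g1 g2 g3"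
proof -
  have xF: "x \<in> frames i n" using x by (simp add: gram_frames_def)
  have bl: "b l \<in> lev (\<alpha> l) (\<beta> l)" if "l < n" for l using FS_D[OF b] that by simp
  have "form M ((x + b) j) ((x + b) l) - T j l \<in> pw (if l < i then g1 else if j < i then g2 else g3)"
    if jl: "(j, l) \<in> upper_pairs 0 n" for j l
  proof -
    obtain g where gd: "g = (if l < i then g1 else if j < i then g2 else g3)" and
      g: "g \<le> int (\<alpha> j)" "g \<le> int (\<alpha> l)" "g + 1 \<le> int (\<beta> j) + (if l < i then 1 else 0)"
         "g + 1 \<le> int (\<beta> l) + (if j < i then 1 else 0)"
      using g[OF jl] by blast
    have n: "j < n" "l < n" "j \<le> l" using jl by (auto simp: upper_pairs_def)
    have 0: "form M (x j) (x l) - T j l \<in> pw g" using x jl by (auto simp: gram_frames_def gd)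
    have 1: "form M (b j) (x l) \<in> pw g"
      by (rule form_lev[OF bl[OF n(1)] frames_lev[OF xF n(2)]]) (use g in auto)
    have 2: "form M (b l) (x j) \<in> pw g"
      by (rule form_lev[OF bl[OF n(2)] frames_lev[OF xF n(1)]]) (use g in auto)
    have 3: "form M (b j) (b l) \<in> pw g"
      by (rule form_lev[OF bl[OF n(1)] bl[OF n(2)]]) (use g \<beta>[OF n(1)] \<beta>[OF n(2)] in \<open>auto split: if_splits\<close>)
    have "(form M (x j) (x l) - T j l) + form M (b j) (x l) + cj (form M (b l) (x j)) + form M (b j) (b l) \<in> pw g"
      using 0 1 2 3 by (intro pw_add) (simp_all add: cj_pw)
    moreover have "form M ((x + b) j) ((x + b) l) - T j l =
      (form M (x j) (x l) - T j l) + form M (b j) (x l) + form M (x j) (b l) + form M (b j) (b l)"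
      by (simp add: form_add_left form_add_right)
    ultimately show ?thesis using form_conj[of "x j" "b l"] by (simp only: gd)
  qed
  then show ?thesis using frames_add[OF xF b i \<alpha> \<beta>] by (intro gram_framesI)
qed

lemma MP_pm_lev: "b \<in> MP \<Longrightarrow> b \<in> pm e \<Longrightarrow> b \<in> lev e f"
  using MP_D[of b] subgrp_0[OF subgrp_pm] by (simp add: lev_def)

lemma MQ_pm_lev: "b \<in> MQ \<Longrightarrow> b \<in> pm e \<Longrightarrow> b \<in> lev f e"
  using MQ_D[of b] subgrp_0[OF subgrp_pm] by (simp add: lev_def)

lemma dual_system_MP:
  assumes "finite J" "\<And>j. j \<in> J \<Longrightarrow> x j \<in> MP" "rind J x"
  obtains \<delta> where "\<And>j. j \<in> J \<Longrightarrow> \<delta> j \<in> MP"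
    "\<And>j l. j \<in> J \<Longrightarrow> l \<in> J \<Longrightarrow> form M (\<delta> j) (x l) = (if j = l then 1 else 0)"
proof -
  have "\<exists>\<delta>. (\<forall>j\<in>J. \<delta> j \<in> MP) \<and>
    (\<forall>j\<in>J. \<forall>l\<in>J. form M (\<delta> j) (x l) = (if j = l then 1 else 0))"
  proof (rule dual_system[OF assms(1) submod_MP _ _ _ assms(2,3)])
    show "form M y z / 1 \<in> pw 0" if "y \<in> MP" "z \<in> MP" for y z
      using form_P[of y z] that MP_D[of y] MP_D[of z] by simp
    show "\<exists>y\<in>MP. form M y a = 1" if "a \<in> MP" "a \<notin> pM" for a
      using modular_P[of a] that MP_D[of a] P_MP by auto
  qed simp
  then show thesis using that by blast
qed

lemma dual_system_MQ:
  assumes "finite J" "\<And>j. j \<in> J \<Longrightarrow> x j \<in> MQ" "rind J x"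
  obtains \<delta> where "\<And>j. j \<in> J \<Longrightarrow> \<delta> j \<in> MQ"
    "\<And>j l. j \<in> J \<Longrightarrow> l \<in> J \<Longrightarrow> form M (\<delta> j) (x l) = (if j = l then inverse \<pi> else 0)"
proof -
  have "\<exists>\<delta>. (\<forall>j\<in>J. \<delta> j \<in> MQ) \<and>
    (\<forall>j\<in>J. \<forall>l\<in>J. form M (\<delta> j) (x l) = (if j = l then inverse \<pi> else 0))"
  proof (rule dual_system[OF assms(1) submod_MQ _ _ _ assms(2,3)])
    show "form M y z / inverse \<pi> \<in> pw 0" if "y \<in> MQ" "z \<in> MQ" for y z
      using form_pts[of y z] that MQ_D[of y] MQ_D[of z] pw_mult_iff[of \<pi> "form M y z" 0]
      by (simp add: val_pi divide_inverse mult.commute)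
    show "\<exists>y\<in>MQ. form M y a = inverse \<pi>" if "a \<in> MQ" "a \<notin> pM" for a
      using modular_Q[of a] that MQ_D[of a] Q_MQ by (auto simp flip: Q_def)
  qed simp
  then show thesis using that by blast
qed

text \<open>The dual system of the vectors \<open>P (x l)\<close>, l < i, is combined with the
  coefficients \<open>u l\<close>. An element of \<open>MP\<close> does not see
  \<open>Q\<close>-parts; its pairings with the later frame vectors remain uncontrolled.\<close>

lemma solve_P:
  assumes x: "x \<in> frames i n" and i: "i \<le> n" and u: "\<And>l. l < i \<Longrightarrow> u l \<in> pw (int e)"
  shows "\<exists>b\<in>MP \<inter> pm e. \<forall>l<i. form M b (x l) = u l"
proof -
  have "P (x l) \<in> MP" if "l \<in> {..<i}" for l using P_MP frames_pts[OF x] that i by simp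
  then obtain \<delta> where \<delta>: "\<And>j. j \<in> {..<i} \<Longrightarrow> \<delta> j \<in> MP"
    "\<And>j l. j \<in> {..<i} \<Longrightarrow> l \<in> {..<i} \<Longrightarrow> form M (\<delta> j) (P (x l)) = (if j = l then 1 else 0)"
    using dual_system_MP[of "{..<i}" "\<lambda>l. P (x l)"] x by (auto simp only: frames_def finite_lessThan mem_Collect_eq)
  define b where "b = lc {..<i} u \<delta>"
  have u0: "u l \<in> pw 0" if "l < i" for l using u[OF that] by (rule pw_mono) simp
  have b: "b \<in> MP" unfolding b_def using \<delta> u0 by (intro submod_lc submod_MP) auto
  moreover have "b \<in> pm e" unfolding b_def
    using \<delta>(1) u MP_D(1) by (intro subgrp_sum subgrp_pm smul_pm) auto
  moreover have "form M b (x l) = u l" if l: "l < i" for l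
  proof -
    have "form M b (x l) = form M b (P (x l))"
      using form_PQ[of b "x l"] MP_D[OF b] by simp
    also have "\<dots> = (\<Sum>j<i. if j = l then u j else 0)"
      unfolding b_def form_lc_left by (rule sum.cong) (use \<delta>(2) l in auto)
    finally show ?thesis using l by simp
  qed
  ultimately show ?thesis by blast
qed

text \<open>The duals of the later \<open>Q\<close>-parts pair to \<open>inverse \<pi>\<close>, so
  the coefficients are \<open>\<pi> * u l\<close>. This is why a correction of level e can be taken
  one power of \<pi> deeper.\<close>

lemma solve_Q:
  assumes x: "x \<in> frames i n" and u: "\<And>l. i \<le> l \<Longrightarrow> l < n \<Longrightarrow> u l \<in> pw (int e)"
  shows "\<exists>b\<in>MQ \<inter> pm (Suc e). \<forall>l. i \<le> l \<longrightarrow> l < n \<longrightarrow> form M b (x l) = u l"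
proof -
  have "Q (x l) \<in> MQ" if "l \<in> {i..<n}" for l using Q_MQ frames_pts[OF x] that by simp
  then obtain \<delta> where \<delta>: "\<And>j. j \<in> {i..<n} \<Longrightarrow> \<delta> j \<in> MQ"
    "\<And>j l. j \<in> {i..<n} \<Longrightarrow> l \<in> {i..<n} \<Longrightarrow> form M (\<delta> j) (Q (x l)) = (if j = l then inverse \<pi> else 0)"
    using dual_system_MQ[of "{i..<n}" "\<lambda>l. Q (x l)"] x by (auto simp only: frames_def finite_atLeastLessThan mem_Collect_eq)
  define b where "b = lc {i..<n} (\<lambda>l. \<pi> * u l) \<delta>"
  have u1: "\<pi> * u l \<in> pw (int (Suc e))" if "l \<in> {i..<n}" for l
    using u[of l] that by (simp add: pw_mult_iff val_pi)
  have u0: "\<pi> * u l \<in> pw 0" if "l \<in> {i..<n}" for l using u1[OF that] by (rule pw_mono) simp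
  have b: "b \<in> MQ" unfolding b_def using \<delta> u0 by (intro submod_lc submod_MQ) auto
  moreover have "b \<in> pm (Suc e)" unfolding b_def
    using \<delta>(1) u1 MQ_D(1) by (intro subgrp_sum subgrp_pm smul_pm) auto
  moreover have "form M b (x l) = u l" if l: "i \<le> l" "l < n" for l
  proof -
    have "form M b (x l) = form M b (Q (x l))"
      using form_PQ[of b "x l"] MQ_D[OF b] by simp
    also have "\<dots> = (\<Sum>j\<in>{i..<n}. if j = l then u j else 0)"
      unfolding b_def form_lc_left by (rule sum.cong) (use \<delta>(2) l in auto)
    finally show ?thesis using l by simp
  qed
  ultimately show ?thesis by blast
qed

lemma solve_symmetric:
  assumes J: "J \<subseteq> upper_pairs 0 n" and u: "\<And>j l. u j l \<in> pw g" "\<And>j. u j j \<in> base E"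
    and \<beta>: "\<And>j. j < n \<Longrightarrow> submod (\<beta> j)"
    and solve: "\<And>j v. j < n \<Longrightarrow> (\<And>l. v l \<in> pw g) \<Longrightarrow> (\<And>l. j < l \<Longrightarrow> v l = 0) \<Longrightarrow>
      \<exists>b\<in>\<beta> j. \<forall>l<n. (j, l) \<in> J \<or> (l, j) \<in> J \<longrightarrow> form M b (x l) - v l \<in> pw (g + 1)"
  shows "\<exists>b\<in>FS {..<n} \<beta>. \<forall>(j, l)\<in>J. form M (b j) (x l) + form M (x j) (b l) - u j l \<in> pw (g + 1)"
proof -
  \<comment> \<open>an off-diagonal defect is corrected by moving the later vector only, a diagonal one by half of it\<close>
  define v where "v j l = (if j < l then 0 else if j = l then u j j / 2 else cj (u l j))" for j l
  have "\<forall>j\<in>{..<n}. \<exists>b. b \<in> \<beta> j \<and> (\<forall>l<n. (j, l) \<in> J \<or> (l, j) \<in> J \<longrightarrow> form M b (x l) - v j l \<in> pw (g + 1))"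
    using solve[of _ "v _"] u by (auto simp: v_def half_pw cj_pw Bex_def)
  from bchoice[OF this] obtain B where B: "\<And>j. j < n \<Longrightarrow> B j \<in> \<beta> j"
    "\<And>j l. j < n \<Longrightarrow> l < n \<Longrightarrow> (j, l) \<in> J \<or> (l, j) \<in> J \<Longrightarrow> form M (B j) (x l) - v j l \<in> pw (g + 1)"
    by auto
  define b where "b j = (if j < n then B j else 0)" for j
  have "b \<in> FS {..<n} \<beta>" using B(1) by (auto simp: b_def FS_def)
  moreover have "form M (b j) (x l) + form M (x j) (b l) - u j l \<in> pw (g + 1)" if jl: "(j, l) \<in> J" for j l
  proof -
    have n: "j < n" "l < n" "j \<le> l" using J jl by (auto simp: upper_pairs_def)
    have "v j l + cj (v l j) = u j l"
    proof (cases "j = l")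
      case True
      have "u j j / 2 \<in> base E" using u(2) base_closed(5)[OF base_closed(2,2)] base_divide by simp
      then show ?thesis using True by (simp add: v_def cj_base)
    next
      case False
      then show ?thesis using n by (simp add: v_def)
    qed
    moreover have "form M (x j) (b l) = cj (form M (b l) (x j))" by (rule form_conj)
    ultimately have "form M (b j) (x l) + form M (x j) (b l) - u j l =
        (form M (B j) (x l) - v j l) + cj (form M (B l) (x j) - v l j)"
      using n by (simp add: b_def cj_diff algebra_simps)
    also have "\<dots> \<in> pw (g + 1)" using B(2) n jl by (intro pw_add) (auto simp: cj_pw)
    finally show ?thesis .
  qed
  ultimately show ?thesis by blast
qed

text \<open>An instance of \<open>gram_step\<close> with deformations from
  \<open>lev (\<alpha> j) (\<beta> j)\<close>: \<open>g\<close> keeps deformed frames in the set,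
  \<open>small\<close> absorbs products of deformations, and \<open>solve\<close> is the linear
  problem for one vector at a time. D is at least g + 2 because pairing with \<pi>^D M loses one
  power of \<pi> on the \<open>Q\<close>-part.\<close>

lemma gram_frames_step:
  fixes \<alpha> \<beta> :: "nat \<Rightarrow> nat" and g :: int
  assumes i: "i \<le> n" and J: "J \<subseteq> upper_pairs 0 n"
    and T: "\<And>j. j < n \<Longrightarrow> T j j \<in> base E"
    and A: "A = gram_frames i n T g1 g2 g3"
    and g: "\<And>j l. (j, l) \<in> upper_pairs 0 n \<Longrightarrow>
      \<exists>g. g = (if l < i then g1 else if j < i then g2 else g3) \<and> g \<le> int (\<alpha> j) \<and> g \<le> int (\<alpha> l) \<and>
        g + 1 \<le> int (\<beta> j) + (if l < i then 1 else 0) \<and> g + 1 \<le> int (\<beta> l) + (if j < i then 1 else 0)"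
    and \<alpha>: "\<And>l. l < i \<Longrightarrow> 1 \<le> \<alpha> l" and \<beta>: "\<And>l. l < n \<Longrightarrow> 1 \<le> \<beta> l"
    and D: "\<And>l. l < n \<Longrightarrow> \<alpha> l \<le> D \<and> \<beta> l \<le> D" and gD: "g + 2 \<le> int D"
    and small: "\<And>j l. (j, l) \<in> J \<Longrightarrow> g + 1 \<le> int (\<alpha> j) + int (\<alpha> l) \<and> g + 2 \<le> int (\<beta> j) + int (\<beta> l)"
    and lev: "\<And>j l. (j, l) \<in> J \<Longrightarrow> g = (if l < i then g1 else if j < i then g2 else g3)"
    and solve: "\<And>x j v. x \<in> frames i n \<Longrightarrow> j < n \<Longrightarrow> (\<And>l. v l \<in> pw g) \<Longrightarrow> (\<And>l. j < l \<Longrightarrow> v l = 0) \<Longrightarrow>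
      \<exists>b\<in>lev (\<alpha> j) (\<beta> j). \<forall>l<n. (j, l) \<in> J \<or> (l, j) \<in> J \<longrightarrow> form M b (x l) - v l \<in> pw (g + 1)"
  shows "card (quot A (FS {..<n} (\<lambda>_. pm D))) = (\<Prod>(j, l)\<in>J. if j = l \<and> odd g then 1 else q) *
    card (quot {x \<in> A. \<forall>(j, l)\<in>J. form M (x j) (x l) - T j l \<in> pw (g + 1)} (FS {..<n} (\<lambda>_. pm D)))"
proof (rule gram_step[where \<beta> = "\<lambda>j. lev (\<alpha> j) (\<beta> j)"])
  show "finite J" using J finite_upper_pairs by (rule finite_subset)
  show "j < n \<and> l < n" if "(j, l) \<in> J" for j l using J that by (auto simp: upper_pairs_def)
  show "submod (lev (\<alpha> j) (\<beta> j)) \<and> pm D \<subseteq> lev (\<alpha> j) (\<beta> j)" if "j < n" for j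
    using D[OF that] lev_mono[of "\<alpha> j" D "\<beta> j" D] by (simp add: submod_lev pm_lev)
  show "x + b \<in> A" if "x \<in> A" "b \<in> FS {..<n} (\<lambda>j. lev (\<alpha> j) (\<beta> j))" for x b
    using gram_frames_add[OF _ that(2) i \<alpha> \<beta> g] that(1) by (simp add: A)
  show "form M (x j) (x l) - T j l \<in> pw g" if "x \<in> A" "(j, l) \<in> J" for x j l
    using gram_framesD(2)[of x i n T g1 g2 g3 j l] that J lev[OF that(2)] by (auto simp only: A)
  show "\<exists>b\<in>FS {..<n} (\<lambda>j. lev (\<alpha> j) (\<beta> j)).
      \<forall>(j, l)\<in>J. form M (b j) (x l) + form M (x j) (b l) - u j l \<in> pw (g + 1)"
    if x: "x \<in> A" and u: "\<And>j l. u j l \<in> pw g" "\<And>j. u j j \<in> base E" for x u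
  proof (rule solve_symmetric[OF J u])
    show "\<exists>b\<in>lev (\<alpha> j) (\<beta> j). \<forall>l<n. (j, l) \<in> J \<or> (l, j) \<in> J \<longrightarrow> form M b (x l) - v l \<in> pw (g + 1)"
      if "j < n" "\<And>l. v l \<in> pw g" "\<And>l. j < l \<Longrightarrow> v l = 0" for j v
      using x that by (intro solve) (auto simp: A gram_frames_def)
  qed (rule submod_lev)
  show "form M x y \<in> pw (g + 1)"
    if "(j, l) \<in> J" "x \<in> lev (\<alpha> j) (\<beta> j)" "y \<in> lev (\<alpha> l) (\<beta> l)" for x y j l
    using small[OF that(1)] by (intro form_lev[OF that(2,3)]) auto
  show "form M x y \<in> pw (g + 1)" if "x \<in> pm D" "y \<in> pts M" for x y
    using that gD form_lev[of x D D y 0 0 "g + 1"] by (simp add: pm_lev pts_lev)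
  show "x j \<in> pts M" if "x \<in> A" "j < n" for x j
    using that frames_pts[of x i n j] by (simp add: A gram_frames_def)
qed (use T submod_pm pm_subset_pts in auto)

end

lemma card_quot_split:
  assumes K: "subgrp K" and fin: "finite (quot A K)"
    and inv: "\<And>x y. x \<in> A \<Longrightarrow> y \<in> A \<Longrightarrow> x - y \<in> K \<Longrightarrow> R x \<Longrightarrow> R y"
  shows "card (quot A K) = card (quot {x \<in> A. R x} K) + card (quot {x \<in> A. \<not> R x} K)"
proof -
  have "quot A K = quot {x \<in> A. R x} K \<union> quot {x \<in> A. \<not> R x} K" by (auto simp: quot_def)
  moreover have "quot {x \<in> A. R x} K \<inter> quot {x \<in> A. \<not> R x} K = {}"
    using inv by (auto simp: quot_def coset_eq_iff[OF K])
  ultimately show ?thesis using fin by (simp add: card_Un_disjoint)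
qed

section \<open>Residual frames and the lifting of Gram congruences\<close>

context split_module
begin

text \<open>Residual data of the first block: frames of the unimodular part modulo \<pi> with
  prescribed Gram matrix. Their number is all that remains of \<open>T\<close> in the final
  formula.\<close>

definition P_frames :: "nat \<Rightarrow> (nat \<Rightarrow> nat \<Rightarrow> 'f) \<Rightarrow> (nat \<Rightarrow> 'v) set" where
  "P_frames i T = {a \<in> FS {..<i} (\<lambda>_. MP). rind {..<i} a \<and>
     (\<forall>(j, l)\<in>upper_pairs 0 i. form M (a j) (a l) - T j l \<in> pw 1)}"

text \<open>The form on \<open>MQ\<close> is read in \<pi>^{-1} O_F / O_F, so integral values mean
  that it vanishes there. These are the isotropic frames of a symplectic space over the residue
  field.\<close>

definition Q_frames :: "nat set \<Rightarrow> (nat \<Rightarrow> 'v) set" where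
  "Q_frames J = {b \<in> FS J (\<lambda>_. MQ). rind J b \<and> (\<forall>j\<in>J. \<forall>l\<in>J. form M (b j) (b l) \<in> pw 0)}"

abbreviation "KP i \<equiv> FS {..<i} (\<lambda>_. MP \<inter> pM)"
abbreviation "KQ J \<equiv> FS J (\<lambda>_. MQ \<inter> pM)"
abbreviation "KM n D \<equiv> FS {..<n} (\<lambda>_. pm D)"

lemma subgrp_MP_pM: "subgrp (MP \<inter> pM)" and subgrp_MQ_pM: "subgrp (MQ \<inter> pM)"
  using submod_subgrp[OF submod_MP] submod_subgrp[OF submod_MQ] subgrp_pM by (auto simp: subgrp_def)

lemma subgrp_KP: "subgrp (KP i)" and subgrp_KQ: "subgrp (KQ J)" and subgrp_KM: "subgrp (KM n D)"
  by (simp_all add: subgrp_FS subgrp_MP_pM subgrp_MQ_pM subgrp_pm)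

lemma gram_frames_refine:
  assumes J: "\<And>j l. (j, l) \<in> J \<Longrightarrow> (j, l) \<in> upper_pairs 0 n \<and> (if l < i then g1 else if j < i then g2 else g3) \<le> g"
    and h: "\<And>j l. (j, l) \<in> upper_pairs 0 n \<Longrightarrow> (if l < i then h1 else if j < i then h2 else h3) =
      (if (j, l) \<in> J then g else if l < i then g1 else if j < i then g2 else g3)"
  shows "{x \<in> gram_frames i n T g1 g2 g3. \<forall>(j, l)\<in>J. form M (x j) (x l) - T j l \<in> pw g} =
    gram_frames i n T h1 h2 h3" (is "?A = ?B")
proof (intro equalityI subsetI)
  fix x assume x: "x \<in> ?A"
  then have xg: "x \<in> gram_frames i n T g1 g2 g3" by simp
  show "x \<in> ?B"
  proof (rule gram_framesI[OF gram_framesD(1)[OF xg]])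
    fix j l assume jl: "(j, l) \<in> upper_pairs 0 n"
    show "form M (x j) (x l) - T j l \<in> pw (if l < i then h1 else if j < i then h2 else h3)"
    proof (cases "(j, l) \<in> J")
      case True
      then show ?thesis using x h[OF jl] by auto
    next
      case False
      then have "(if l < i then h1 else if j < i then h2 else h3) =
        (if l < i then g1 else if j < i then g2 else g3)" using h[OF jl] by simp
      then show ?thesis using gram_framesD(2)[OF xg jl] by (simp only:)
    qed
  qed
next
  fix x assume x: "x \<in> ?B"
  have lv: "form M (x j) (x l) - T j l \<in> pw (if (j, l) \<in> J then g else if l < i then g1 else if j < i then g2 else g3)"
    if "(j, l) \<in> upper_pairs 0 n" for j l
    using gram_framesD(2)[OF x that] h[OF that] by (simp only:)
  have "x \<in> gram_frames i n T g1 g2 g3"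
  proof (rule gram_framesI[OF gram_framesD(1)[OF x]])
    fix j l assume jl: "(j, l) \<in> upper_pairs 0 n"
    show "form M (x j) (x l) - T j l \<in> pw (if l < i then g1 else if j < i then g2 else g3)"
    proof (cases "(j, l) \<in> J")
      case True
      then have "form M (x j) (x l) - T j l \<in> pw g" using lv[OF jl] by simp
      then show ?thesis by (rule pw_mono) (use J[OF True] in blast)
    next
      case False
      then show ?thesis using lv[OF jl] by simp
    qed
  qed
  moreover have "form M (x j) (x l) - T j l \<in> pw g" if "(j, l) \<in> J" for j l
    using lv[of j l] J[OF that] that by simp
  ultimately show "x \<in> ?A" by blast
qed

text \<open>The linear problem is triangular: a shift in \<open>MP\<close> settles the pairings with
  the first i vectors, then one in \<open>MQ\<close> settles the others. The latter disturbs the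
  first pairings only at level e + 1, because the first vectors have \<open>Q\<close>-parts
  divisible by \<pi>. Products of two shifts are negligible as soon as e is at least 1.\<close>

lemma gram_frames_lift:
  assumes i: "i \<le> n" and T: "\<And>j. j < n \<Longrightarrow> T j j \<in> base E" and e: "1 \<le> e" "e + 2 \<le> D"
  shows "card (quot (gram_frames i n T (int e) (int e) (int e)) (KM n D)) =
    (\<Prod>(j, l)\<in>upper_pairs 0 n. if j = l \<and> odd e then 1 else q) *
    card (quot (gram_frames i n T (int (Suc e)) (int (Suc e)) (int (Suc e))) (KM n D))"
proof -
  have "card (quot (gram_frames i n T (int e) (int e) (int e)) (KM n D)) =
    (\<Prod>(j, l)\<in>upper_pairs 0 n. if j = l \<and> odd (int e) then 1 else q) *
    card (quot {x \<in> gram_frames i n T (int e) (int e) (int e). \<forall>(j, l)\<in>upper_pairs 0 n.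
      form M (x j) (x l) - T j l \<in> pw (int e + 1)} (KM n D))"
  proof (rule gram_frames_step[where \<alpha> = "\<lambda>_. e" and \<beta> = "\<lambda>_. Suc e", OF i order.refl T refl])
    fix x j and v :: "nat \<Rightarrow> 'f"
    assume x: "x \<in> frames i n" and j: "j < n" and v: "\<And>l. v l \<in> pw (int e)"
    obtain b where b: "b \<in> MP" "b \<in> pm e" "\<And>l. l < i \<Longrightarrow> form M b (x l) = v l"
      using solve_P[OF x i, of v e] v by blast
    have "v l - form M b (x l) \<in> pw (int e)" if "l < n" for l
      using v form_lev[OF MP_pm_lev[OF b(1,2), of "Suc e"] frames_lev[OF x that], of "int e"]
      by (intro pw_diff) auto
    \<comment> \<open>The shift \<open>b\<close> has changed the pairings with the later vectors
      within level e; \<open>c\<close> compensates for that as well.\<close>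
    then obtain c where c: "c \<in> MQ" "c \<in> pm (Suc e)"
        "\<And>l. i \<le> l \<Longrightarrow> l < n \<Longrightarrow> form M c (x l) = v l - form M b (x l)"
      using solve_Q[OF x, of "\<lambda>l. v l - form M b (x l)" e] by blast
    have cl: "c \<in> lev (Suc e) (Suc e)" by (rule MQ_pm_lev[OF c(1,2)])
    have "b + c \<in> lev e (Suc e)"
      by (intro subgrp_add[OF submod_subgrp[OF submod_lev]] MP_pm_lev b MQ_pm_lev c)
    moreover have "form M (b + c) (x l) - v l \<in> pw (int e + 1)" if l: "l < n" for l
    proof (cases "l < i")
      case True
      have "form M c (x l) \<in> pw (int e + 1)"
        using form_lev[OF cl frames_lev[OF x l], of "int e + 1"] True by simp
      then show ?thesis using b(3)[OF True] by (simp add: form_add_left)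
    next
      case False
      then show ?thesis using c(3)[of l] l by (simp add: form_add_left)
    qed
    ultimately show "\<exists>b\<in>lev e (Suc e). \<forall>l<n. (j, l) \<in> upper_pairs 0 n \<or> (l, j) \<in> upper_pairs 0 n \<longrightarrow>
      form M b (x l) - v l \<in> pw (int e + 1)" by blast
  qed (use e in auto)
  moreover have "{x \<in> gram_frames i n T (int e) (int e) (int e). \<forall>(j, l)\<in>upper_pairs 0 n.
      form M (x j) (x l) - T j l \<in> pw (int e + 1)} = gram_frames i n T (int (Suc e)) (int (Suc e)) (int (Suc e))"
    by (rule gram_frames_refine) auto
  ultimately show ?thesis by (simp only: even_of_nat_iff of_nat_eq_iff)
qed

text \<open>A step from an odd level gains q off the diagonal only, the following step from an even
  level gains q everywhere. Together they contribute q^(n^2) for one power of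
  \<open>\<pi>\<^sub>0\<close>.\<close>

lemma gram_frames_lift_iter:
  assumes i: "i \<le> n" and T: "\<And>j. j < n \<Longrightarrow> T j j \<in> base E" and D: "2 * t + 2 \<le> D"
  shows "card (quot (gram_frames i n T 1 1 1) (KM n D)) = q ^ (n\<^sup>2 * t) *
    card (quot (gram_frames i n T (int (2 * t + 1)) (int (2 * t + 1)) (int (2 * t + 1))) (KM n D))"
  using D
proof (induction t)
  case (Suc t)
  define e where "e = 2 * t + 1"
  have "(\<Prod>(j, l)\<in>upper_pairs 0 n. if j = l \<and> odd e then 1 else q) *
    (\<Prod>(j, l)\<in>upper_pairs 0 n. if j = l \<and> odd (Suc e) then 1 else q) =
    (\<Prod>(j, l)\<in>upper_pairs 0 n. q ^ (if j = l then 1 else 2))"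
    unfolding prod.distrib[symmetric] by (rule prod.cong) (auto simp: e_def power2_eq_square)
  also have "\<dots> = q ^ n\<^sup>2"
    unfolding sum_upper_pairs_sq[symmetric] power_sum by (simp add: split_beta)
  finally have pr: "(\<Prod>(j, l)\<in>upper_pairs 0 n. if j = l \<and> odd e then 1 else q) *
    (\<Prod>(j, l)\<in>upper_pairs 0 n. if j = l \<and> odd (Suc e) then 1 else q) = q ^ n\<^sup>2" .
  have "card (quot (gram_frames i n T (int e) (int e) (int e)) (KM n D)) = q ^ n\<^sup>2 *
    card (quot (gram_frames i n T (int (Suc (Suc e))) (int (Suc (Suc e))) (int (Suc (Suc e)))) (KM n D))"
    using gram_frames_lift[where T = T and e = e and D = D, OF i T] gram_frames_lift[where T = T and e = "Suc e" and D = D, OF i T] Suc.prems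
    unfolding pr[symmetric] by (simp only: e_def mult.assoc) simp
  moreover have "Suc (Suc e) = 2 * Suc t + 1" by (simp add: e_def)
  ultimately show ?case using Suc by (simp add: e_def power_add)
qed simp

text \<open>Only the later vectors move, by \<open>P\<close>-parts of level 0, on which no residual
  condition rests; they can be solved for since the first \<open>P\<close>-parts are independent.
  Products of shifts remain negligible because the first i vectors may only move by multiples of
  \<pi>.\<close>

lemma gram_frames_cross:
  assumes i: "i \<le> n" and T: "\<And>j. j < n \<Longrightarrow> T j j \<in> base E" and D: "2 \<le> D"
  shows "card (quot (gram_frames i n T 1 0 0) (KM n D)) =
    q ^ (i * (n - i)) * card (quot (gram_frames i n T 1 1 0) (KM n D))"
proof -
  let ?J = "{..<i} \<times> {i..<n}"
  have "card (quot (gram_frames i n T 1 0 0) (KM n D)) =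
    (\<Prod>(j, l)\<in>?J. if j = l \<and> odd (0::int) then 1 else q) *
    card (quot {x \<in> gram_frames i n T 1 0 0. \<forall>(j, l)\<in>?J.
      form M (x j) (x l) - T j l \<in> pw (0 + 1)} (KM n D))"
  proof (rule gram_frames_step[where \<alpha> = "\<lambda>l. if l < i then 1 else 0" and
      \<beta> = "\<lambda>l. if l < i then 2 else 1", OF i _ T refl])
    fix x j and v :: "nat \<Rightarrow> 'f"
    assume x: "x \<in> frames i n" and j: "j < n" and v: "\<And>l. v l \<in> pw 0" "\<And>l. j < l \<Longrightarrow> v l = 0"
    show "\<exists>b\<in>lev (if j < i then 1 else 0) (if j < i then 2 else 1).
      \<forall>l<n. (j, l) \<in> ?J \<or> (l, j) \<in> ?J \<longrightarrow> form M b (x l) - v l \<in> pw (0 + 1)"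
    proof (cases "j < i")
      case True
      \<comment> \<open>The partners \<open>l\<close> of such a \<open>j\<close> exceed it, and
        \<open>v\<close> vanishes there, so nothing has to be corrected.\<close>
      then show ?thesis using v(2) by (intro bexI[of _ 0]) (auto intro: subgrp_0 submod_subgrp submod_lev)
    next
      case False
      obtain b where b: "b \<in> MP" "b \<in> pm 0" "\<And>l. l < i \<Longrightarrow> form M b (x l) = v l"
        using solve_P[OF x i, of v 0] v by force
      then show ?thesis using False MP_pm_lev[OF b(1,2), of 1] by (intro bexI[of _ b]) auto
    qed
  qed (use D in \<open>auto simp: upper_pairs_def split: if_splits\<close>)
  moreover have "{x \<in> gram_frames i n T 1 0 0. \<forall>(j, l)\<in>?J. form M (x j) (x l) - T j l \<in> pw (0 + 1)} =
    gram_frames i n T 1 1 0"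
    by (rule gram_frames_refine) (use i in \<open>auto simp: upper_pairs_def split: if_splits\<close>)
  ultimately show ?thesis by (simp add: split_beta)
qed

text \<open>The later vectors move by \<open>Q\<close>-parts divisible by \<pi>; against the first i
  vectors, whose \<open>Q\<close>-parts are divisible by \<pi> too, this is invisible at level 1.
  Level 0 is even, so diagonal entries contribute a factor q as well.\<close>

lemma gram_frames_block:
  assumes i: "i \<le> n" and T: "\<And>j. j < n \<Longrightarrow> T j j \<in> base E" and D: "2 \<le> D"
  shows "card (quot (gram_frames i n T 1 1 0) (KM n D)) =
    q ^ card (upper_pairs i n) * card (quot (gram_frames i n T 1 1 1) (KM n D))"
proof -
  let ?J = "upper_pairs i n"
  have "card (quot (gram_frames i n T 1 1 0) (KM n D)) =
    (\<Prod>(j, l)\<in>?J. if j = l \<and> odd (0::int) then 1 else q) *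
    card (quot {x \<in> gram_frames i n T 1 1 0. \<forall>(j, l)\<in>?J.
      form M (x j) (x l) - T j l \<in> pw (0 + 1)} (KM n D))"
  proof (rule gram_frames_step[where \<alpha> = "\<lambda>l. 1" and
      \<beta> = "\<lambda>l. if l < i then 2 else 1", OF i _ T refl])
    fix x j and v :: "nat \<Rightarrow> 'f"
    assume x: "x \<in> frames i n" and j: "j < n" and v: "\<And>l. v l \<in> pw 0"
    show "\<exists>b\<in>lev 1 (if j < i then 2 else 1).
      \<forall>l<n. (j, l) \<in> ?J \<or> (l, j) \<in> ?J \<longrightarrow> form M b (x l) - v l \<in> pw (0 + 1)"
    proof (cases "j < i")
      case True
      then show ?thesis
        by (intro bexI[of _ 0]) (auto simp: upper_pairs_def intro: subgrp_0 submod_subgrp submod_lev)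
    next
      case False
      obtain b where b: "b \<in> MQ" "b \<in> pm (Suc 0)" "\<And>l. i \<le> l \<Longrightarrow> l < n \<Longrightarrow> form M b (x l) = v l"
        using solve_Q[OF x, of v 0] v by force
      then show ?thesis using False MQ_pm_lev[OF b(1,2), of 1]
        by (intro bexI[of _ b]) (auto simp: upper_pairs_def)
    qed
  qed (use D in \<open>auto simp: upper_pairs_def split: if_splits\<close>)
  moreover have "{x \<in> gram_frames i n T 1 1 0. \<forall>(j, l)\<in>?J. form M (x j) (x l) - T j l \<in> pw (0 + 1)} =
    gram_frames i n T 1 1 1"
    by (rule gram_frames_refine) (use i in \<open>auto simp: upper_pairs_def split: if_splits\<close>)
  ultimately show ?thesis by (simp add: split_beta)
qed

text \<open>Levels 1, 0, 0 are exactly what residues decide. Two \<open>Q\<close>-parts divisible by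
  \<pi> pair into the maximal ideal, so the first block sees \<open>P\<close>-parts only; mixed
  entries are integral automatically; in the last block \<open>P\<close>-parts pair integrally,
  which leaves integrality of the pairings of \<open>Q\<close>-parts.\<close>

lemma card_residue_frames:
  assumes i: "i \<le> n" and T: "\<And>j l. j < n \<Longrightarrow> l < n \<Longrightarrow> T j l \<in> pw 0"
  shows "card (quot (gram_frames i n T 1 0 0) (FS {..<n} (\<lambda>l. lev (if l < i then 1 else 0) 1))) =
    card (quot (P_frames i T) (KP i)) * card (quot (Q_frames {i..<n}) (KQ {i..<n}))"
proof -
  let ?B = "FS {..<n} (\<lambda>l. lev (if l < i then 1 else 0) 1)"
  \<comment> \<open>The components that the shifts in \<open>?B\<close> can change at will are
    dropped: \<open>Q\<close> of the first i vectors and \<open>P\<close> of the later ones.\<close>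
  define f where "f x = (\<lambda>l. if l < i then P (x l) else 0, \<lambda>l. if i \<le> l \<and> l < n then Q (x l) else 0)"
    for x :: "nat \<Rightarrow> 'v"
  have lev_l: "y \<in> lev (if l < i then 1 else 0) 1 \<longleftrightarrow> y \<in> pts M \<and> (l < i \<longrightarrow> P y \<in> pM) \<and> Q y \<in> pM" for y l
    using P_pts by (auto simp: lev_def pm_0[simplified] pm_1[simplified])
  have "card (quot (gram_frames i n T 1 0 0) ?B) =
      card (quot (P_frames i T \<times> Q_frames {i..<n}) (KP i \<times> KQ {i..<n}))"
  proof (rule card_quot_eqI[where f = f])
    show "subgrp ?B" by (intro subgrp_FS submod_subgrp submod_lev)
    show "subgrp (KP i \<times> KQ {i..<n})" by (intro subgrp_Times subgrp_KP subgrp_KQ)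
    show "f x \<in> P_frames i T \<times> Q_frames {i..<n}" if x: "x \<in> gram_frames i n T 1 0 0" for x
    proof -
      have xF: "x \<in> frames i n" using gram_framesD(1)[OF x] .
      have "(\<lambda>l. if l < i then P (x l) else 0) \<in> P_frames i T"
        unfolding P_frames_def
      proof (intro CollectI conjI)
        show "(\<lambda>l. if l < i then P (x l) else 0) \<in> FS {..<i} (\<lambda>_. MP)"
          using frames_pts[OF xF] i by (auto simp: FS_def P_MP)
        show "rind {..<i} (\<lambda>l. if l < i then P (x l) else 0)"
          using xF unfolding frames_def residue_indep_def by simp
        have "form M (P (x j)) (P (x l)) - T j l \<in> pw 1" if jl: "(j, l) \<in> upper_pairs 0 i" for j l
        proof -
          have n: "j < i" "l < i" "j < n" "l < n" "(j, l) \<in> upper_pairs 0 n"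
            using jl i by (auto simp: upper_pairs_def)
          have "form M (x j) (x l) - T j l \<in> pw 1" using gram_framesD(2)[OF x n(5)] n by simp
          moreover have "form M (Q (x j)) (Q (x l)) \<in> pw 1"
            using form_lev[of "Q (x j)" 1 1 "Q (x l)" 1 1 1] xF n frames_pts[OF xF]
            by (auto simp: frames_def simp flip: pM_lev[simplified])
          ultimately have "form M (x j) (x l) - T j l - form M (Q (x j)) (Q (x l)) \<in> pw 1"
            by (rule pw_diff)
          then show ?thesis using form_PQ[of "x j" "x l"] by (simp add: algebra_simps)
        qed
        then show "\<forall>(j, l)\<in>upper_pairs 0 i. form M (if j < i then P (x j) else 0)
            (if l < i then P (x l) else 0) - T j l \<in> pw 1"
          by (auto simp: upper_pairs_def)
      qed
      moreover have "(\<lambda>l. if i \<le> l \<and> l < n then Q (x l) else 0) \<in> Q_frames {i..<n}"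
        unfolding Q_frames_def
      proof (intro CollectI conjI ballI)
        show "(\<lambda>l. if i \<le> l \<and> l < n then Q (x l) else 0) \<in> FS {i..<n} (\<lambda>_. MQ)"
          using frames_pts[OF xF] by (auto simp: FS_def Q_MQ)
        show "rind {i..<n} (\<lambda>l. if i \<le> l \<and> l < n then Q (x l) else 0)"
          using xF unfolding frames_def residue_indep_def by simp
        have *: "form M (Q (x j)) (Q (x l)) \<in> pw 0" if jl: "i \<le> j" "j \<le> l" "l < n" for j l
        proof -
          have n: "j < n" "(j, l) \<in> upper_pairs 0 n" using jl by (auto simp: upper_pairs_def)
          have "form M (x j) (x l) - T j l \<in> pw 0" using gram_framesD(2)[OF x n(2)] jl by simp
          then have "form M (x j) (x l) \<in> pw 0"
            using subgrp_cong_iff[OF subgrp_pw] T[OF n(1) jl(3)] by blast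
          moreover have "form M (P (x j)) (P (x l)) \<in> pw 0" using form_P frames_pts[OF xF] n jl by simp
          ultimately have "form M (x j) (x l) - form M (P (x j)) (P (x l)) \<in> pw 0" by (rule pw_diff)
          then show ?thesis using form_PQ[of "x j" "x l"] by (simp add: algebra_simps)
        qed
        have "form M (Q (x j)) (Q (x l)) \<in> pw 0" if "j \<in> {i..<n}" "l \<in> {i..<n}" for j l
        proof (cases "j \<le> l")
          case False
          then show ?thesis using *[of l j] that form_conj[of "Q (x j)" "Q (x l)"] by (simp add: cj_pw)
        qed (use * that in simp)
        then show "form M (if i \<le> j \<and> j < n then Q (x j) else 0) (if i \<le> l \<and> l < n then Q (x l) else 0) \<in> pw 0"
          if "j \<in> {i..<n}" "l \<in> {i..<n}" for j l using that by simp
      qed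
      ultimately show ?thesis by (simp add: f_def)
    qed
    show "\<exists>x\<in>gram_frames i n T 1 0 0. f x - z \<in> KP i \<times> KQ {i..<n}" if "z \<in> P_frames i T \<times> Q_frames {i..<n}" for z
    proof -
      obtain a b where z: "z = (a, b)" and a: "a \<in> P_frames i T" and b: "b \<in> Q_frames {i..<n}"
        using \<open>z \<in> _\<close> by auto
      have aM: "a l \<in> MP" for l
        using a subgrp_0[OF submod_subgrp[OF submod_MP]] by (cases "l < i") (auto simp: P_frames_def FS_def)
      have bM: "b l \<in> MQ" for l
        using b subgrp_0[OF submod_subgrp[OF submod_MQ]] by (cases "l \<in> {i..<n}") (auto simp: Q_frames_def FS_def)
      have a0: "a l = 0" if "\<not> l < i" for l using a that by (auto simp: P_frames_def FS_def)
      have b0: "b l = 0" if "\<not> (i \<le> l \<and> l < n)" for l using b that by (auto simp: Q_frames_def FS_def)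
      have Pab: "P (a l + b l) = a l" and Qab: "Q (a l + b l) = b l" for l
        using MP_D[OF aM] MQ_D[OF bM] by (simp_all add: P_add Q_add)
      have fab: "form M (a j + b j) (a l + b l) = form M (a j) (a l) + form M (b j) (b l)" for j l
        by (subst form_PQ) (simp add: Pab Qab)
      have "a + b \<in> gram_frames i n T 1 0 0"
      proof (rule gram_framesI)
        show "a + b \<in> frames i n" unfolding frames_def
        proof (intro CollectI conjI allI impI)
          show "a + b \<in> FS {..<n} (\<lambda>_. pts M)"
            using aM bM a0 b0 i by (auto simp: FS_def MP_D MQ_D pts_add)
          show "Q ((a + b) l) \<in> pM" if "l < i" for l
            using b0[of l] that by (simp only: plus_fun_apply Qab) (simp add: subgrp_0[OF subgrp_pM])
          show "rind {..<i} (\<lambda>l. P ((a + b) l))" using a by (simp add: Pab P_frames_def)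
          show "rind {i..<n} (\<lambda>l. Q ((a + b) l))" using b by (simp add: Qab Q_frames_def)
        qed
        fix j l assume jl: "(j, l) \<in> upper_pairs 0 n"
        then have n: "j \<le> l" "j < n" "l < n" by (auto simp: upper_pairs_def)
        show "form M ((a + b) j) ((a + b) l) - T j l \<in> pw (if l < i then 1 else if j < i then 0 else 0)"
        proof (cases "l < i")
          case True
          then have "form M (a j) (a l) - T j l \<in> pw 1" "b j = 0"
            using a n b0 by (auto simp: P_frames_def upper_pairs_def)
          then show ?thesis using True fab[of j l] by simp
        next
          case False
          \<comment> \<open>In mixed entries and in the last block the later vector has no
            \<open>P\<close>-part.\<close>
          have "form M (a j) (a l) \<in> pw 0" using a0[OF False] by simp
          moreover have "form M (b j) (b l) \<in> pw 0"
            using b False n b0[of j] by (cases "j < i") (auto simp: Q_frames_def)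
          ultimately have "form M (a j) (a l) + form M (b j) (b l) - T j l \<in> pw 0"
            using T[OF n(2,3)] by (intro pw_add pw_diff)
          then show ?thesis using False fab[of j l] by simp
        qed
      qed
      moreover have "f (a + b) - z = 0"
        using a0 b0 by (auto simp: f_def z fun_eq_iff Pab Qab zero_prod_def MP_D[OF aM] MQ_D[OF bM])
      moreover have "0 \<in> KP i \<times> KQ {i..<n}" by (intro subgrp_0 subgrp_Times subgrp_KP subgrp_KQ)
      ultimately show ?thesis by metis
    qed
    show "f x - f y \<in> KP i \<times> KQ {i..<n} \<longleftrightarrow> x - y \<in> ?B"
      if "x \<in> gram_frames i n T 1 0 0" "y \<in> gram_frames i n T 1 0 0" for x y
    proof -
      have x: "x \<in> frames i n" and y: "y \<in> frames i n" using that gram_framesD(1) by blast+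
      have xy: "x l - y l \<in> pts M" if "l < n" for l
        using frames_pts[OF x that] frames_pts[OF y that] by (rule subgrp_diff[OF subgrp_pts])
      have out: "x l - y l = 0" if "\<not> l < n" for l
        using x y that by (auto simp: frames_def FS_def)
      have Q: "Q (x l - y l) \<in> pM" if "l < i" for l
        using x y that by (auto simp: frames_def Q_diff intro: subgrp_diff[OF subgrp_pM])
      have "f x - f y \<in> KP i \<times> KQ {i..<n} \<longleftrightarrow>
          (\<forall>l<i. P (x l - y l) \<in> MP \<inter> pM) \<and> (\<forall>l. i \<le> l \<and> l < n \<longrightarrow> Q (x l - y l) \<in> MQ \<inter> pM)"
        by (auto simp: f_def FS_def P_diff Q_diff)
      also have "\<dots> \<longleftrightarrow> (\<forall>l<n. x l - y l \<in> lev (if l < i then 1 else 0) 1)"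
        unfolding lev_l using xy Q i by (auto simp: P_MP Q_MQ) (metis linorder_not_le)+
      also have "\<dots> \<longleftrightarrow> x - y \<in> ?B" using out by (auto simp: FS_def)
      finally show ?thesis .
    qed
  qed
  then show ?thesis using card_quot_Times[OF subgrp_KP subgrp_KQ] by simp
qed

text \<open>The exponent on the left collects the conditions met while lifting: the mixed entries,
  the last block, and n^2 for each of d - 1 double steps. The two remaining summands give the index
  of the shift lattice in all n-tuples. Products instead of quotients keep the identity in the
  natural numbers.\<close>

lemma card_gram_frames:
  assumes i: "i \<le> n" and T: "\<And>j l. j < n \<Longrightarrow> l < n \<Longrightarrow> T j l \<in> pw 0"
    and Tb: "\<And>j. j < n \<Longrightarrow> T j j \<in> base E" and d: "1 \<le> d"
  shows "card (quot (gram_frames i n T (2 * int d - 1) (2 * int d - 1) (2 * int d - 1)) (KM n (2 * d))) *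
      q ^ (i * (n - i) + card (upper_pairs i n) + n\<^sup>2 * (d - 1) + (m + h) * i + h * (n - i)) =
    card (quot (P_frames i T) (KP i)) * card (quot (Q_frames {i..<n}) (KQ {i..<n})) * q ^ (2 * d * (m + h) * n)"
proof -
  let ?B = "FS {..<n} (\<lambda>l. lev (if l < i then 1 else 0) 1)"
  let ?K = "KM n (2 * d)"
  let ?Z = "gram_frames i n T (2 * int d - 1) (2 * int d - 1) (2 * int d - 1)"
  have sgB: "subgrp ?B" by (intro subgrp_FS submod_subgrp submod_lev)
  have KB: "?K \<subseteq> ?B"
    unfolding pm_lev using d by (intro FS_mono lev_mono) auto
  have "int (2 * (d - 1) + 1) = 2 * int d - 1" using d by simp
  then have Z: "card (quot (gram_frames i n T 1 0 0) ?K) =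
      q ^ (i * (n - i)) * (q ^ card (upper_pairs i n) * (q ^ (n\<^sup>2 * (d - 1)) * card (quot ?Z ?K)))"
    using gram_frames_cross[where T = T and D = "2 * d", OF i Tb] gram_frames_block[where T = T and D = "2 * d", OF i Tb]
      gram_frames_lift_iter[where T = T and t = "d - 1" and D = "2 * d", OF i Tb] d by simp
  have 1: "card (quot (gram_frames i n T 1 0 0) ?K) =
      card (quot (gram_frames i n T 1 0 0) ?B) * card (quot ?B ?K)"
    by (rule card_quot_mult[OF subgrp_KM sgB KB]) (erule gram_frames_add, assumption, use i in \<open>auto simp: upper_pairs_def\<close>)
  have 2: "card (quot (FS {..<n} (\<lambda>_. pts M)) ?K) = card (quot (FS {..<n} (\<lambda>_. pts M)) ?B) * card (quot ?B ?K)"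
    by (rule card_quot_mult[OF subgrp_KM sgB KB]) (auto simp: FS_def lev_def intro: pts_add)
  have 3: "card (quot (FS {..<n} (\<lambda>_. pts M)) ?K) = q ^ (2 * d * (m + h) * n)"
    by (subst card_quot_FS) (simp_all add: subgrp_pm card_quot_pts_pm flip: power_mult)
  have 4: "card (quot (FS {..<n} (\<lambda>_. pts M)) ?B) = q ^ ((m + h) * i + h * (n - i))"
  proof -
    have "card (quot (pts M) (lev (if l < i then 1 else 0) 1)) = (if l < i then q ^ (m + h) else q ^ h)" for l
      using card_quot_pts_pM card_quot_pts_lev pM_lev by simp
    then have "card (quot (FS {..<n} (\<lambda>_. pts M)) ?B) = (\<Prod>l<n. if l < i then q ^ (m + h) else q ^ h)"
      by (subst card_quot_FS) (auto intro: submod_subgrp[OF submod_lev])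
    also have "\<dots> = (q ^ (m + h)) ^ card {l \<in> {..<n}. l < i} * (q ^ h) ^ card {l \<in> {..<n}. \<not> l < i}"
      by (simp add: prod.If_cases Int_def conj_commute)
    also have "{l \<in> {..<n}. l < i} = {..<i}" using i by auto
    also have "{l \<in> {..<n}. \<not> l < i} = {i..<n}" by auto
    finally show ?thesis by (simp only: power_mult power_add card_lessThan card_atLeastLessThan)
  qed
  have "card (quot ?Z ?K) * q ^ (i * (n - i) + card (upper_pairs i n) + n\<^sup>2 * (d - 1)) =
      card (quot (gram_frames i n T 1 0 0) ?B) * card (quot ?B ?K)"
    using Z 1 by (simp add: power_add ac_simps)
  moreover have "card (quot ?B ?K) * q ^ ((m + h) * i + h * (n - i)) = q ^ (2 * d * (m + h) * n)"
    using 2 3 4 by (simp add: ac_simps)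
  moreover have "q ^ (i * (n - i) + card (upper_pairs i n) + n\<^sup>2 * (d - 1) + (m + h) * i + h * (n - i)) =
      q ^ (i * (n - i) + card (upper_pairs i n) + n\<^sup>2 * (d - 1)) * q ^ ((m + h) * i + h * (n - i))"
    by (simp add: power_add)
  moreover have "card (quot (gram_frames i n T 1 0 0) ?B) =
      card (quot (P_frames i T) (KP i)) * card (quot (Q_frames {i..<n}) (KQ {i..<n}))"
    by (rule card_residue_frames[OF i T])
  ultimately show ?thesis by (metis (no_types, lifting) mult.assoc)
qed

end

section \<open>Isotropic frames\<close>

context split_module
begin

lemma finite_quot_MQ: "finite J \<Longrightarrow> finite (quot (FS J (\<lambda>_. MQ)) (KQ J))"
proof -
  assume J: "finite J"
  have "card (quot (FS J (\<lambda>_. MQ)) (KQ J)) = (q ^ h) ^ card J"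
    using J card_Q[folded MQ_def] by (subst card_quot_FS) (simp_all add: subgrp_MQ_pM)
  then show ?thesis using q_gt_1 by (intro card_ge_0_finite) simp
qed

lemma form_MQ_small: "x \<in> MQ \<inter> pM \<Longrightarrow> y \<in> pts M \<Longrightarrow> form M x y \<in> pw 0"
  using form_lev[of x 1 1 y 0 0 0] pM_lev pts_lev by simp

text \<open>The duals of an independent family in \<open>MQ\<close> pair to
  \<open>inverse \<pi>\<close>, so every prescription in \<pi>^{-1} O_F is met with integral
  coefficients.\<close>

lemma solve_MQ:
  assumes J: "finite J" and a: "a \<in> Q_frames J" and t: "\<And>j. j \<in> J \<Longrightarrow> t j \<in> pw (- 1)"
  shows "\<exists>b\<in>MQ. \<forall>j\<in>J. form M (a j) b = t j"
proof -
  have aM: "a j \<in> MQ" if "j \<in> J" for j using a that by (auto simp: Q_frames_def dest: FS_D)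
  have rind: "rind J a" using a by (simp add: Q_frames_def)
  obtain \<delta> where \<delta>: "\<And>j. j \<in> J \<Longrightarrow> \<delta> j \<in> MQ"
    "\<And>j l. j \<in> J \<Longrightarrow> l \<in> J \<Longrightarrow> form M (\<delta> j) (a l) = (if j = l then inverse \<pi> else 0)"
    using dual_system_MQ[OF J, of a] aM rind by blast
  define b where "b = lc J (\<lambda>j. \<pi> * cj (t j)) \<delta>"
  have "\<pi> * cj (t j) \<in> pw 0" if "j \<in> J" for j
    using t[OF that] by (simp add: pw_mult_iff val_pi cj_pw)
  then have "b \<in> MQ" unfolding b_def using \<delta>(1) by (intro submod_lc submod_MQ)
  moreover have "form M (a l) b = t l" if l: "l \<in> J" for l
  proof -
    have "form M b (a l) = (\<Sum>j\<in>J. if j = l then cj (t l) else 0)"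
      unfolding b_def form_lc_left by (rule sum.cong) (use \<delta>(2) l in auto)
    then have "form M b (a l) = cj (t l)" using l J by simp
    then show ?thesis using form_conj[of "a l" b] by simp
  qed
  ultimately show ?thesis by blast
qed

lemma Q_frames_cong:
  assumes x: "x \<in> Q_frames J" and y: "y \<in> FS J (\<lambda>_. MQ)" and xy: "x - y \<in> KQ J"
  shows "y \<in> Q_frames J"
proof -
  have d: "x j - y j \<in> MQ \<inter> pM" if "j \<in> J" for j using FS_D[OF xy that] by simp
  have xM: "x j \<in> pts M" "y j \<in> pts M" if "j \<in> J" for j
    using x y that by (auto simp: Q_frames_def MQ_D dest: FS_D)
  have "rind J y" by (rule rind_cong_mod[of J x]) (use x d in \<open>auto simp: Q_frames_def\<close>)
  moreover have "form M (y j) (y l) \<in> pw 0" if jl: "j \<in> J" "l \<in> J" for j l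
  proof -
    have "form M (y j) (y l) = form M (x j) (x l) - cj (form M (x l - y l) (x j)) - form M (x j - y j) (y l)"
      unfolding form_conj[of "x j" "x l - y l", symmetric] by (simp add: form_diff_left form_diff_right)
    also have "\<dots> \<in> pw 0"
      using x jl form_MQ_small[OF d[OF jl(2)] xM(1)[OF jl(1)]] form_MQ_small[OF d[OF jl(1)] xM(2)[OF jl(2)]]
      by (intro pw_diff) (auto simp: Q_frames_def cj_pw)
    finally show ?thesis .
  qed
  ultimately show ?thesis using y by (simp add: Q_frames_def)
qed

text \<open>Ordered isotropic frames of a symplectic space of dimension h over the residue field: a
  vector added to s given ones ranges over their orthogonal complement, of size q^(h - s), outside
  their span, of size q^s. Real numbers avoid truncated subtraction.\<close>

lemma card_Q_frames:
  assumes "finite J"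
  shows "real (card (quot (Q_frames J) (KQ J))) =
    (\<Prod>s<card J. real q ^ h / real q ^ s - real q ^ s)"
  using assms
proof (induction J rule: finite_induct)
  case empty
  have "Q_frames {} = {0}" "KQ {} = {0}" by (auto simp: Q_frames_def FS_def residue_indep_def)
  then show ?case by (simp add: quot_def)
next
  case (insert i J)
  let ?I = "insert i J"
  define A where "A = {x \<in> FS ?I (\<lambda>_. MQ). x(i := 0) \<in> Q_frames J}"
  define A0 where "A0 = {x \<in> A. \<forall>j\<in>J. form M (x j) (x i) \<in> pw 0}"
  \<comment> \<open>\<open>A0\<close> allows every \<open>x i\<close> orthogonal to \<open>x j\<close>, \<open>j \<in> J\<close>, modulo \<open>\<pi>\<close>; \<open>R\<close> singles out those in their span\<close>
  define R where "R x \<longleftrightarrow> (\<exists>c. (\<forall>j\<in>J. c j \<in> pw 0) \<and> x i - lc J c x \<in> pM)" for x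
  have restr: "lc J c (x(i := y)) = lc J c x" for c x y
    using insert.hyps by (intro sum.cong) auto
  have K_restr: "k(i := 0) \<in> KQ J" if "k \<in> KQ ?I" for k using that insert.hyps by (auto simp: FS_def)
  have AM: "x j \<in> MQ" if "x \<in> A" "j \<in> ?I" for x j using that by (auto simp: A_def dest: FS_D)
  have A_add: "x + b \<in> A" if x: "x \<in> A" and b: "b \<in> FS ?I (\<lambda>j. if j = i then MQ else MQ \<inter> pM)" for x b
  proof -
    have bM: "b \<in> FS ?I (\<lambda>_. MQ)" using b by (auto simp: FS_def split: if_splits)
    then have "x + b \<in> FS ?I (\<lambda>_. MQ)"
      using x subgrp_add[OF submod_subgrp[OF submod_MQ]] by (auto simp: A_def FS_def)
    moreover have "(x + b)(i := 0) \<in> Q_frames J"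
    proof (rule Q_frames_cong)
      show "x(i := 0) \<in> Q_frames J" using x by (simp add: A_def)
      show "(x + b)(i := 0) \<in> FS J (\<lambda>_. MQ)"
        using \<open>x + b \<in> FS ?I (\<lambda>_. MQ)\<close> insert.hyps by (auto simp: FS_def)
      have "x(i := 0) - (x + b)(i := 0) = - (b(i := 0))" by (auto simp: fun_eq_iff)
      moreover have "b(i := 0) \<in> KQ J" using b insert.hyps by (auto simp: FS_def split: if_splits)
      ultimately show "x(i := 0) - (x + b)(i := 0) \<in> KQ J" by (simp add: subgrp_uminus[OF subgrp_KQ])
    qed
    ultimately show ?thesis by (simp add: A_def)
  qed
  have K_B: "KQ ?I \<subseteq> FS ?I (\<lambda>j. if j = i then MQ else MQ \<inter> pM)" by (rule FS_mono) auto
  \<comment> \<open>In \<open>A\<close> no condition ties \<open>x i\<close> to the other vectors,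
    so it contributes the full q^h.\<close>
  have "card (quot A (KQ ?I)) = card (quot (Q_frames J \<times> MQ) (KQ J \<times> (MQ \<inter> pM)))"
  proof (rule card_quot_eqI[where f = "\<lambda>x. (x(i := 0), x i)"])
    show "subgrp (KQ J \<times> (MQ \<inter> pM))" by (intro subgrp_Times subgrp_KQ subgrp_MQ_pM)
    show "(x(i := 0), x i) \<in> Q_frames J \<times> MQ" if "x \<in> A" for x
      using that by (auto simp: A_def FS_def)
    show "\<exists>x\<in>A. (x(i := 0), x i) - z \<in> KQ J \<times> (MQ \<inter> pM)" if "z \<in> Q_frames J \<times> MQ" for z
    proof -
      obtain b y where z: "z = (b, y)" "b \<in> Q_frames J" "y \<in> MQ" using \<open>z \<in> _\<close> by auto
      have bi: "(b(i := y))(i := 0) = b" using z(2) insert.hyps by (auto simp: Q_frames_def FS_def fun_eq_iff)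
      have "b(i := y) \<in> A" unfolding A_def using z bi insert.hyps by (auto simp: Q_frames_def FS_def)
      moreover have "((b(i := y))(i := 0), (b(i := y)) i) - z = 0" using bi by (simp add: z zero_prod_def)
      moreover have "0 \<in> KQ J \<times> (MQ \<inter> pM)" by (intro subgrp_0 subgrp_Times subgrp_KQ subgrp_MQ_pM)
      ultimately show ?thesis by metis
    qed
    show "(x(i := 0), x i) - (y(i := 0), y i) \<in> KQ J \<times> (MQ \<inter> pM) \<longleftrightarrow> x - y \<in> KQ ?I"
      if "x \<in> A" "y \<in> A" for x y
      using that insert.hyps by (auto simp: A_def FS_def)
  qed (rule subgrp_KQ)
  then have cA: "card (quot A (KQ ?I)) = card (quot (Q_frames J) (KQ J)) * q ^ h"
    using card_quot_Times[OF subgrp_KQ[of J] subgrp_MQ_pM, of "Q_frames J" MQ] card_Q[folded MQ_def] by simp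

  \<comment> \<open>The pairings of the frame with \<open>x i\<close>, to be read modulo O_F. They
    are equidistributed, so orthogonality divides the count by q for each element of
    \<open>J\<close>.\<close>
  define f where "f x = (\<lambda>j. if j \<in> J then form M (x j) (x i) else 0)" for x
  have "card (quot A (KQ ?I)) = card (quot (FS J (\<lambda>_. pw (- 1))) (FS J (\<lambda>_. pw 0))) *
    card (quot {x \<in> A. f x \<in> FS J (\<lambda>_. pw 0)} (KQ ?I))"
  proof (rule card_quot_equidistributed[OF subgrp_KQ _ K_B])
    show "subgrp (FS ?I (\<lambda>j. if j = i then MQ else MQ \<inter> pM))"
      using subgrp_MQ_pM submod_subgrp[OF submod_MQ] by (intro subgrp_FS) auto
    show "subgrp (FS J (\<lambda>_. pw 0))" "subgrp (FS J (\<lambda>_. pw (- 1)))" by (simp_all add: subgrp_FS subgrp_pw)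
    show "FS J (\<lambda>_. pw 0) \<subseteq> FS J (\<lambda>_. pw (- 1))" by (intro FS_mono subsetI) (erule pw_mono, simp)
    show "f a \<in> FS J (\<lambda>_. pw (- 1))" if "a \<in> A" for a
      using that form_pts AM MQ_D(1) by (auto simp: f_def FS_def)
    show "f (a + k) - f a \<in> FS J (\<lambda>_. pw 0)" if a: "a \<in> A" and k: "k \<in> KQ ?I" for a k
    proof (rule FS_I)
      fix j assume j: "j \<in> J"
      have kj: "k j \<in> MQ \<inter> pM" "k i \<in> MQ \<inter> pM" using FS_D[OF k] j by auto
      have p: "a j \<in> pts M" "a i \<in> pts M" "k i \<in> pts M" using AM[OF a] j kj MQ_D by auto
      have "form M (k j) (a i) + cj (form M (k i) (a j)) + form M (k j) (k i) \<in> pw 0"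
        using kj p by (intro pw_add) (auto simp: cj_pw intro: form_MQ_small)
      then show "(f (a + k) - f a) j \<in> pw 0"
        using j form_conj[of "a j" "k i"] by (simp add: f_def form_add_left form_add_right algebra_simps)
    qed (simp add: f_def)
    show "\<exists>b\<in>FS ?I (\<lambda>j. if j = i then MQ else MQ \<inter> pM).
        \<forall>b'\<in>FS ?I (\<lambda>j. if j = i then MQ else MQ \<inter> pM). f (a + b' + b) - f (a + b') - t \<in> FS J (\<lambda>_. pw 0)"
      if a: "a \<in> A" and t: "t \<in> FS J (\<lambda>_. pw (- 1))" for a t
    proof -
      have aQ: "a(i := 0) \<in> Q_frames J" using a by (simp add: A_def)
      have "\<exists>y\<in>MQ. \<forall>j\<in>J. form M ((a(i := 0)) j) y = t j"
        by (rule solve_MQ[OF insert.hyps(1) aQ]) (rule FS_D[OF t])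
      then obtain y where y: "y \<in> MQ" "\<forall>j\<in>J. form M ((a(i := 0)) j) y = t j" by blast
      have y2: "form M (a j) y = t j" if "j \<in> J" for j
        using y(2) that insert.hyps(2) by (metis fun_upd_other)
      \<comment> \<open>Moving only \<open>x i\<close> changes the pairings additively and leaves
        the frame on \<open>J\<close> alone.\<close>
      define b where "b = (\<lambda>j. if j = i then y else 0)"
      have "b \<in> FS ?I (\<lambda>j. if j = i then MQ else MQ \<inter> pM)"
        using y(1) subgrp_0[OF subgrp_MQ_pM] by (auto simp: b_def FS_def)
      moreover have "f (a + b' + b) - f (a + b') - t \<in> FS J (\<lambda>_. pw 0)"
        if b': "b' \<in> FS ?I (\<lambda>j. if j = i then MQ else MQ \<inter> pM)" for b'
      proof (rule FS_I)
        fix j assume j: "j \<in> J"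
        have ji: "j \<noteq> i" using j insert.hyps(2) by auto
        have "b' j \<in> MQ \<inter> pM" using FS_D[OF b', of j] j ji by simp
        then have "form M (b' j) y \<in> pw 0" using y(1) MQ_D(1) by (intro form_MQ_small)
        then show "(f (a + b' + b) - f (a + b') - t) j \<in> pw 0"
          using j ji y2[OF j] by (simp add: f_def b_def form_add_left form_add_right)
      qed (use t in \<open>auto simp: f_def FS_def\<close>)
      ultimately show ?thesis by blast
    qed
  qed (rule A_add)
  moreover have "{x \<in> A. f x \<in> FS J (\<lambda>_. pw 0)} = A0" by (auto simp: A0_def f_def FS_def)
  moreover have "card (quot (FS J (\<lambda>_. pw (- 1))) (FS J (\<lambda>_. pw 0))) = q ^ card J"
    using insert.hyps card_quot_pw[of "- 1"] by (subst card_quot_FS) (simp_all add: subgrp_pw)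
  ultimately have cA0: "card (quot A (KQ ?I)) = q ^ card J * card (quot A0 (KQ ?I))" by simp

  have "card (quot A0 (KQ ?I)) = card (quot {x \<in> A0. R x} (KQ ?I)) + card (quot {x \<in> A0. \<not> R x} (KQ ?I))"
  proof (rule card_quot_split[OF subgrp_KQ])
    have "quot A0 (KQ ?I) \<subseteq> quot (FS ?I (\<lambda>_. MQ)) (KQ ?I)" by (auto simp: quot_def A0_def A_def)
    then show "finite (quot A0 (KQ ?I))" using finite_quot_MQ[of ?I] insert.hyps finite_subset by blast
    show "R y" if "x \<in> A0" "y \<in> A0" and xy: "x - y \<in> KQ ?I" and "R x" for x y
    proof -
      obtain c where c: "\<And>j. j \<in> J \<Longrightarrow> c j \<in> pw 0" "x i - lc J c x \<in> pM" using \<open>R x\<close> by (auto simp: R_def)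
      have d: "x j - y j \<in> pM" if "j \<in> ?I" for j using FS_D[OF xy that] by simp
      have "lc J c (\<lambda>j. x j - y j) \<in> pM" using c d by (intro submod_lc submod_pM) auto
      then have "(x i - lc J c x) - (x i - y i) + lc J c (\<lambda>j. x j - y j) \<in> pM"
        by (intro subgrp_add[OF subgrp_pM subgrp_diff[OF subgrp_pM c(2) d]]) auto
      then have "y i - lc J c y \<in> pM" unfolding lc_diff_right[symmetric] by simp
      then show "R y" using c(1) by (auto simp: R_def)
    qed
  qed
  moreover have "{x \<in> A0. \<not> R x} = Q_frames ?I"
  proof (intro equalityI subsetI)
    fix x assume x: "x \<in> {x \<in> A0. \<not> R x}"
    then have xF: "x \<in> FS ?I (\<lambda>_. MQ)" "x(i := 0) \<in> Q_frames J"
      and xo: "\<And>j. j \<in> J \<Longrightarrow> form M (x j) (x i) \<in> pw 0" by (auto simp: A0_def A_def)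
    have xM: "x j \<in> pts M" if "j \<in> ?I" for j using FS_D[OF xF(1) that] MQ_D by blast
    have xJ: "rind J x" "\<And>j l. j \<in> J \<Longrightarrow> l \<in> J \<Longrightarrow> form M (x j) (x l) \<in> pw 0"
    proof -
      have "rind J (x(i := 0))" using xF(2) by (simp add: Q_frames_def)
      then show "rind J x" unfolding residue_indep_def restr .
      show "form M (x j) (x l) \<in> pw 0" if "j \<in> J" "l \<in> J" for j l
      proof -
        have "j \<noteq> i" "l \<noteq> i" using that insert.hyps by auto
        moreover have "form M ((x(i := 0)) j) ((x(i := 0)) l) \<in> pw 0"
          using xF(2) that unfolding Q_frames_def by blast
        ultimately show ?thesis by simp
      qed
    qed
    have "rind ?I x"
    proof (rule rindI)
      fix c assume c: "\<And>j. j \<in> ?I \<Longrightarrow> c j \<in> pw 0" and s: "lc ?I c x \<in> pM"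
      have s': "smul M (c i) (x i) + lc J c x \<in> pM" using s insert.hyps by simp
      have ci: "c i \<in> pw 1"
      proof (rule ccontr)
        assume "c i \<notin> pw 1"
        then have u: "c i \<noteq> 0" "inverse (c i) \<in> pw 0" using pw_nonunit[of "c i"] c by auto
        have "smul M (inverse (c i)) (smul M (c i) (x i) + lc J c x) \<in> pM"
          by (rule submod_smul[OF submod_pM u(2) s'])
        then have "x i - lc J (\<lambda>j. - (inverse (c i) * c j)) x \<in> pM"
          using u(1) by (simp add: V.scale_right_distrib lc_smul sum_negf)
        moreover have "\<forall>j\<in>J. - (inverse (c i) * c j) \<in> pw 0" using pw_mult[OF u(2), of _ 0] c by simp
        ultimately have "R x" unfolding R_def by (intro exI[of _ "\<lambda>j. - (inverse (c i) * c j)"] conjI)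
        then show False using x by simp
      qed
      then have "smul M (c i) (x i) \<in> pM" using xM by (intro smul_pM) auto
      then have "lc J c x \<in> pM" using s' subgrp_add_cancel[OF subgrp_pM] by (metis add.commute)
      then have "\<forall>j\<in>J. c j \<in> pw 1" using rindD[OF xJ(1), of c] c by blast
      then show "\<forall>j\<in>?I. c j \<in> pw 1" using ci by simp
    qed
    \<comment> \<open>The residual form is alternating: a diagonal value lies in
      \<open>F\<^sub>0\<close> and in \<pi>^{-1} O_F, hence is integral by parity.\<close>
    moreover have "form M (x i) (x i) \<in> pw 0"
      using form_diag_base[of "x i"] form_pts[OF xM xM, of i i] base_pw_even[of 0] by auto
    moreover have "form M (x i) (x j) \<in> pw 0" if "j \<in> J" for j
      using xo[OF that] form_conj[of "x i" "x j"] by (simp add: cj_pw)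
    ultimately show "x \<in> Q_frames ?I" using xF(1) xJ xo by (auto simp: Q_frames_def)
  next
    fix x assume x: "x \<in> Q_frames ?I"
    have ind: "rind ?I x" using x by (simp add: Q_frames_def)
    have "rind J x" by (rule rind_subset[OF ind]) (use insert.hyps in auto)
    then have "rind J (x(i := 0))" unfolding residue_indep_def restr .
    then have "x(i := 0) \<in> Q_frames J" using x insert.hyps by (auto simp: Q_frames_def FS_def)
    moreover have "\<not> R x"
    proof
      assume "R x"
      then obtain c where c: "\<And>j. j \<in> J \<Longrightarrow> c j \<in> pw 0" "x i - lc J c x \<in> pM" by (auto simp: R_def)
      have "lc J (\<lambda>j. if j = i then 1 else - c j) x = - lc J c x"
        unfolding sum_negf[symmetric] using insert.hyps by (intro sum.cong) auto
      then have "lc ?I (\<lambda>j. if j = i then 1 else - c j) x \<in> pM" using c(2) insert.hyps by simp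
      then have "(if i = i then 1 else - c i) \<in> pw 1"
        using c(1) by (intro rindD[OF ind, of "\<lambda>j. if j = i then 1 else - c j"]) auto
      then show False by (simp add: mem_pw val_one)
    qed
    ultimately show "x \<in> {x \<in> A0. \<not> R x}" using x by (auto simp: A0_def A_def Q_frames_def)
  qed
  moreover have "card (quot {x \<in> A0. R x} (KQ ?I)) = card (quot (Q_frames J) (KQ J)) * q ^ card J"
  proof -
    \<comment> \<open>Vectors in the span are parametrised by their coefficients modulo \<pi>, and
      they are automatically orthogonal to the isotropic frame.\<close>
    have "card (quot (Q_frames J \<times> FS J (\<lambda>_. pw 0)) (KQ J \<times> FS J (\<lambda>_. pw 1))) =
      card (quot {x \<in> A0. R x} (KQ ?I))"
    proof (rule card_quot_eqI[where f = "\<lambda>(x, c). x(i := lc J c x)"])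
      show "subgrp (KQ J \<times> FS J (\<lambda>_. pw 1))" by (intro subgrp_Times subgrp_KQ subgrp_FS subgrp_pw)
      show "(case z of (x, c) \<Rightarrow> x(i := lc J c x)) \<in> {x \<in> A0. R x}"
        if "z \<in> Q_frames J \<times> FS J (\<lambda>_. pw 0)" for z
      proof -
        obtain x c where z: "z = (x, c)" "x \<in> Q_frames J" "c \<in> FS J (\<lambda>_. pw 0)" using \<open>z \<in> _\<close> by auto
        have c: "c j \<in> pw 0" if "j \<in> J" for j using FS_D[OF z(3) that] .
        have xM: "x j \<in> MQ" if "j \<in> J" for j using z(2) that by (auto simp: Q_frames_def dest: FS_D)
        have x0: "(x(i := lc J c x))(i := 0) = x"
          using z(2) insert.hyps by (auto simp: Q_frames_def FS_def fun_eq_iff)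
        have "lc J c x \<in> MQ" using c xM by (intro submod_lc submod_MQ)
        then have "x(i := lc J c x) \<in> A" unfolding A_def using x0 z(2) insert.hyps by (auto simp: Q_frames_def FS_def)
        moreover have "form M (x j) (lc J c x) \<in> pw 0" if j: "j \<in> J" for j
          unfolding form_lc_right using z(2) c j pw_mult[of _ 0 _ 0]
          by (intro pw_sum) (auto simp: Q_frames_def cj_pw)
        moreover have "R (x(i := lc J c x))"
          unfolding R_def restr using c subgrp_0[OF subgrp_pM] by (intro exI[of _ c]) auto
        ultimately show ?thesis using insert.hyps by (auto simp: A0_def z)
      qed
      show "\<exists>z\<in>Q_frames J \<times> FS J (\<lambda>_. pw 0). (case z of (x, c) \<Rightarrow> x(i := lc J c x)) - y \<in> KQ ?I"
        if y: "y \<in> {x \<in> A0. R x}" for y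
      proof -
        obtain c where c: "\<And>j. j \<in> J \<Longrightarrow> c j \<in> pw 0" "y i - lc J c y \<in> pM" using y by (auto simp: R_def)
        define c' where "c' j = (if j \<in> J then c j else 0)" for j
        have cc: "lc J c' (y(i := 0)) = lc J c y" unfolding restr by (rule sum.cong) (auto simp: c'_def)
        have yA: "y \<in> A" "y(i := 0) \<in> Q_frames J" using y by (auto simp: A0_def A_def)
        have "lc J c y \<in> MQ" using c AM[OF yA(1)] by (intro submod_lc submod_MQ) auto
        then have "lc J c y - y i \<in> MQ \<inter> pM"
          using c(2) AM[OF yA(1)] subgrp_diff[OF submod_subgrp[OF submod_MQ]] subgrp_diff_commute[OF subgrp_pM]
          by auto
        then have "(y(i := 0))(i := lc J c' (y(i := 0))) - y \<in> KQ ?I"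
          unfolding cc using subgrp_0[OF subgrp_MQ_pM] by (auto simp: FS_def)
        moreover have "c' \<in> FS J (\<lambda>_. pw 0)" using c by (auto simp: c'_def FS_def)
        ultimately show ?thesis using yA(2) by (intro bexI[of _ "(y(i := 0), c')"]) auto
      qed
      show "(case z of (x, c) \<Rightarrow> x(i := lc J c x)) - (case w of (x, c) \<Rightarrow> x(i := lc J c x)) \<in> KQ ?I \<longleftrightarrow>
          z - w \<in> KQ J \<times> FS J (\<lambda>_. pw 1)"
        if "z \<in> Q_frames J \<times> FS J (\<lambda>_. pw 0)" "w \<in> Q_frames J \<times> FS J (\<lambda>_. pw 0)" for z w
      proof -
        obtain x c where z: "z = (x, c)" "x \<in> Q_frames J" "c \<in> FS J (\<lambda>_. pw 0)"
          using \<open>z \<in> _\<close> by auto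
        obtain x' c' where w: "w = (x', c')" "x' \<in> Q_frames J" "c' \<in> FS J (\<lambda>_. pw 0)"
          using \<open>w \<in> _\<close> by auto
        have c: "c j \<in> pw 0" "c' j \<in> pw 0" if "j \<in> J" for j using FS_D z(3) w(3) that by fastforce+
        have xM: "x j \<in> MQ" "x' j \<in> MQ" if "j \<in> J" for j
          using z(2) w(2) that by (auto simp: Q_frames_def dest: FS_D)
        have xi: "x i = 0" "x' i = 0" using z(2) w(2) insert.hyps by (auto simp: Q_frames_def FS_def)
        have ind: "rind J x" using z(2) by (simp add: Q_frames_def)
        have lcM: "lc J c x - lc J c' x' \<in> MQ"
          using c xM by (intro subgrp_diff submod_subgrp submod_lc submod_MQ)
        have "x(i := lc J c x) - x'(i := lc J c' x') \<in> KQ ?I \<longleftrightarrow>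
            x - x' \<in> KQ J \<and> lc J c x - lc J c' x' \<in> pM"
          using lcM xi insert.hyps z(2) w(2) by (auto simp: FS_def Q_frames_def)
        also have "\<dots> \<longleftrightarrow> x - x' \<in> KQ J \<and> c - c' \<in> FS J (\<lambda>_. pw 1)"
        proof (rule conj_cong[OF refl])
          assume d: "x - x' \<in> KQ J"
          \<comment> \<open>With frames congruent modulo \<pi>, the difference of the two
            combinations reduces to a single combination of \<open>x\<close> with the coefficient
            differences.\<close>
          have "lc J c' (\<lambda>j. x j - x' j) \<in> pM" using c FS_D[OF d] by (intro submod_lc submod_pM) auto
          moreover have "lc J c x - lc J c' x' - lc J (\<lambda>j. c j - c' j) x = lc J c' (\<lambda>j. x j - x' j)"
            unfolding lc_diff[symmetric] lc_diff_right[symmetric] by simp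
          ultimately have "lc J c x - lc J c' x' \<in> pM \<longleftrightarrow> lc J (\<lambda>j. c j - c' j) x \<in> pM"
            by (intro subgrp_cong_iff[OF subgrp_pM]) (simp only:)
          also have "\<dots> \<longleftrightarrow> (\<forall>j\<in>J. c j - c' j \<in> pw 1)"
          proof
            assume "lc J (\<lambda>j. c j - c' j) x \<in> pM"
            then show "\<forall>j\<in>J. c j - c' j \<in> pw 1"
              using rindD[OF ind, of "\<lambda>j. c j - c' j"] c by (auto intro: pw_diff)
          next
            assume "\<forall>j\<in>J. c j - c' j \<in> pw 1"
            then show "lc J (\<lambda>j. c j - c' j) x \<in> pM" using xM(1) MQ_D(1) by (intro lc_pM) auto
          qed
          also have "\<dots> \<longleftrightarrow> c - c' \<in> FS J (\<lambda>_. pw 1)" using z(3) w(3) by (auto simp: FS_def)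
          finally show "lc J c x - lc J c' x' \<in> pM \<longleftrightarrow> c - c' \<in> FS J (\<lambda>_. pw 1)" .
        qed
        finally show ?thesis by (simp add: z w)
      qed
    qed (rule subgrp_KQ)
    moreover have "card (quot (FS J (\<lambda>_. pw 0)) (FS J (\<lambda>_. pw 1))) = q ^ card J"
      using insert.hyps card_quot_pw[of 0] by (subst card_quot_FS) (simp_all add: subgrp_pw)
    moreover have "subgrp (FS J (\<lambda>_. pw 1))" by (simp add: subgrp_FS subgrp_pw)
    from card_quot_Times[OF subgrp_KQ[of J] this, of "Q_frames J" "FS J (\<lambda>_. pw 0)"]
    have "card (quot (Q_frames J \<times> FS J (\<lambda>_. pw 0)) (KQ J \<times> FS J (\<lambda>_. pw 1))) =
      card (quot (Q_frames J) (KQ J)) * card (quot (FS J (\<lambda>_. pw 0)) (FS J (\<lambda>_. pw 1)))" .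
    ultimately show ?thesis by simp
  qed
  ultimately have "card (quot (Q_frames J) (KQ J)) * q ^ h =
    q ^ card J * (card (quot (Q_frames J) (KQ J)) * q ^ card J + card (quot (Q_frames ?I) (KQ ?I)))"
    using cA cA0 by simp
  then have "real (card (quot (Q_frames J) (KQ J)) * q ^ h) =
    real (q ^ card J * (card (quot (Q_frames J) (KQ J)) * q ^ card J + card (quot (Q_frames ?I) (KQ ?I))))"
    by (rule arg_cong)
  then have "real (card (quot (Q_frames J) (KQ J))) * real q ^ h = real q ^ card J *
    (real (card (quot (Q_frames J) (KQ J))) * real q ^ card J + real (card (quot (Q_frames ?I) (KQ ?I))))"
    by (simp only: of_nat_add of_nat_mult of_nat_power)
  then have "real (card (quot (Q_frames ?I) (KQ ?I))) =
    real (card (quot (Q_frames J) (KQ J))) * (real q ^ h / real q ^ card J - real q ^ card J)"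
    using q_gt_1 by (simp add: field_simps)
  then show ?case using insert by simp
qed

end

section \<open>Homomorphisms as tuples of vectors\<close>

context herm_module
begin

lemma has_residue_dim_iff: "has_residue_dim E M W r \<longleftrightarrow>
    (\<exists>b. (\<forall>i<r. b i \<in> pts M) \<and> rind {..<r} b \<and> W = {coset pM (lc {..<r} c b) | c. \<forall>i<r. c i \<in> pw 0})"
  by (simp add: has_residue_dim_def residue_indep_def ringF_eq Ball_def)

lemma card_of_residue_dim: "has_residue_dim E M W r \<Longrightarrow> card W = q ^ r"
  unfolding has_residue_dim_iff using card_span_mod by blast

text \<open>\<open>has_residue_dim\<close> only provides some independent spanning family; comparing
  cardinalities transfers independence to the given one.\<close>

lemma has_residue_dim_span_iff:
  assumes "\<And>l. l < r \<Longrightarrow> x l \<in> pts M"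
  shows "has_residue_dim E M {coset pM (lc {..<r} c x) | c. \<forall>l<r. c l \<in> pw 0} r \<longleftrightarrow> rind {..<r} x"
proof
  assume "has_residue_dim E M {coset pM (lc {..<r} c x) | c. \<forall>l<r. c l \<in> pw 0} r"
  from card_of_residue_dim[OF this] show "rind {..<r} x" by (intro rind_of_card assms)
next
  assume "rind {..<r} x"
  then show "has_residue_dim E M {coset pM (lc {..<r} c x) | c. \<forall>l<r. c l \<in> pw 0} r"
    unfolding has_residue_dim_iff using assms by (intro exI[of _ x] conjI refl) auto
qed

lemma mod_pi0_eq: "mod_pi0 E d M x = coset (pm (2 * d)) x"
  by (simp add: mod_pi0_def pi0_power)

lemma basis_card_quot: "lat_basis E M n e \<Longrightarrow> card (quot (pts M) pM) = q ^ n"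
proof -
  assume b: "lat_basis E M n e"
  have "quot (pts M) pM = {coset pM (lc {..<n} c e) | c. \<forall>l<n. c l \<in> pw 0}"
    unfolding basis_pts_eq[OF b] by (auto simp: quot_def)
  then show ?thesis using card_span_mod[OF basis_pts[OF b] basis_rind[OF b]] by simp
qed

lemma basis_finite_quot: "lat_basis E M n e \<Longrightarrow> finite (quot (pts M) pM)"
  using basis_card_quot q_gt_1 by (intro card_ge_0_finite) simp

lemma finite_Gr: "lat_basis E M n e \<Longrightarrow> finite (Gr E r M)"
proof (rule finite_subset)
  show "Gr E r M \<subseteq> Pow (quot (pts M) pM)"
    unfolding Gr_def has_residue_dim_iff by (auto simp: quot_def intro!: imageI pts_lc)
qed (use basis_finite_quot in simp)

lemma basis_delta: "(l::nat) < n \<Longrightarrow> lc {..<n} (\<lambda>j. if j = l then 1 else 0) e = e l"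
proof -
  assume "l < n"
  moreover have "lc {..<n} (\<lambda>j. if j = l then 1 else 0) e = (\<Sum>j<n. if j = l then e j else 0)"
    by (rule sum.cong) auto
  ultimately show ?thesis by (simp only: sum.delta finite_lessThan lessThan_iff if_True)
qed

end

text \<open>The precision at which homomorphisms compare forms:
  \<open>\<pi>\<^sub>0\<^sup>d \<pi>\<^sup>-\<^sup>1\<close> has valuation 2d - 1.\<close>

lemma (in ramified_ext) pw_image: "(\<lambda>a. pi0 E ^ d * inverse \<pi> * a) ` pw 0 = pw (2 * int d - 1)"
proof (intro equalityI subsetI)
  have nz: "pi0 E ^ d * inverse \<pi> \<noteq> 0" by (simp add: pi0_def)
  have v: "val E (pi0 E ^ d * inverse \<pi>) = 2 * int d - 1"
    by (simp add: pi0_power val_mult val_pi_power val_inverse val_pi)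
  show "x \<in> pw (2 * int d - 1)" if "x \<in> (\<lambda>a. pi0 E ^ d * inverse \<pi> * a) ` pw 0" for x
    using that pw_mult_iff[OF nz, of _ "2 * int d - 1"] v by auto
  show "x \<in> (\<lambda>a. pi0 E ^ d * inverse \<pi> * a) ` pw 0" if "x \<in> pw (2 * int d - 1)" for x
  proof (rule image_eqI)
    show "x = pi0 E ^ d * inverse \<pi> * (x / (pi0 E ^ d * inverse \<pi>))" using nz by simp
    then show "x / (pi0 E ^ d * inverse \<pi>) \<in> pw 0"
      using that pw_mult_iff[OF nz, of "x / (pi0 E ^ d * inverse \<pi>)" "2 * int d - 1"] v by simp
  qed
qed

text \<open>Fixing a basis of \<open>L\<close> and a precision d turns homomorphisms modulo
  \<open>\<pi>\<^sub>0\<^sup>d\<close> into n-tuples of vectors of \<open>M\<close> modulo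
  \<pi>^(2d).\<close>

locale herm_hom = ramified_ext p E + M: split_module p E M P m h + L: herm_module p E L
  for p and E :: "'f::field_char_0 quad_ext" and M :: "('f, 'm::ab_group_add) herm"
    and P m h and L :: "('f, 'l::ab_group_add) herm" +
  fixes n :: nat and e :: "nat \<Rightarrow> 'l" and d :: nat
  assumes basis: "lat_basis E L n e" and d: "1 \<le> d"
begin

abbreviation "T j l \<equiv> form L (e j) (e l)"
abbreviation "K \<equiv> M.KM n (2 * d)"
abbreviation "modL \<equiv> mod_pi0 E d L"

definition "gram_tuples = {x \<in> FS {..<n} (\<lambda>_. pts M). \<forall>j<n. \<forall>l<n. form M (x j) (x l) - T j l \<in> pw (2 * int d - 1)}"

text \<open>All lifts to \<open>M\<close> of the images of the basis vectors; for a homomorphism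
  they form one coset of \<open>K\<close>, by \<open>tuples_eq_coset\<close>.\<close>

definition "tuples \<phi> = {x \<in> FS {..<n} (\<lambda>_. pts M). \<forall>l<n. x l \<in> \<phi> (modL (e l))}"

lemma modL: "modL u = coset (L.pm (2 * d)) u"
  by (rule L.mod_pi0_eq)

lemma modM: "mod_pi0 E d M x = coset (M.pm (2 * d)) x"
  by (rule M.mod_pi0_eq)

lemma form_M_pm: "x \<in> M.pm (2 * d) \<Longrightarrow> y \<in> pts M \<Longrightarrow> form M x y \<in> pw (2 * int d - 1)"
  using M.form_lev[of x "2 * d" "2 * d" y 0 0 "2 * int d - 1"] by (simp add: M.pm_lev M.pts_lev)

lemma herm_homs_iff: "\<phi> \<in> herm_homs E d L M \<longleftrightarrow>
    \<phi> \<in> quot (pts L) (L.pm (2 * d)) \<rightarrow>\<^sub>E quot (pts M) (M.pm (2 * d)) \<and>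
    (\<forall>x\<in>pts L. \<forall>y\<in>pts L. \<forall>x'\<in>\<phi> (modL x). \<forall>y'\<in>\<phi> (modL y).
      \<phi> (modL (x + y)) = coset (M.pm (2 * d)) (x' + y') \<and>
      (\<forall>a\<in>pw 0. \<phi> (modL (smul L a x)) = coset (M.pm (2 * d)) (smul M a x')) \<and>
      form M x' y' - form L x y \<in> pw (2 * int d - 1))"
  unfolding herm_homs_def ringF_eq pw_image modM by (simp add: pi0_power)

lemma hom_value:
  assumes "\<phi> \<in> herm_homs E d L M" "u \<in> pts L"
  shows "\<phi> (modL u) \<in> quot (pts M) (M.pm (2 * d))"
  using assms unfolding herm_homs_iff modL by (auto simp: quot_def)

lemma hom_coset:
  assumes "\<phi> \<in> herm_homs E d L M" "u \<in> pts L" "y \<in> \<phi> (modL u)"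
  shows "y \<in> pts M" "\<phi> (modL u) = coset (M.pm (2 * d)) y"
proof -
  obtain z where z: "z \<in> pts M" "\<phi> (modL u) = coset (M.pm (2 * d)) z"
    using hom_value[OF assms(1,2)] by (auto simp: quot_def)
  then have yz: "y - z \<in> M.pm (2 * d)" using assms(3) by (simp add: mem_coset)
  then show "y \<in> pts M" using M.pts_add[OF _ z(1), of "y - z"] subsetD[OF M.pm_subset_pts] by simp
  show "\<phi> (modL u) = coset (M.pm (2 * d)) y"
    using yz z(2) coset_eq_iff[OF M.subgrp_pm] by metis
qed

lemma hom_add:
  "\<phi> \<in> herm_homs E d L M \<Longrightarrow> u \<in> pts L \<Longrightarrow> v \<in> pts L \<Longrightarrow> x \<in> \<phi> (modL u) \<Longrightarrow> y \<in> \<phi> (modL v) \<Longrightarrow>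
    x + y \<in> \<phi> (modL (u + v))"
  and hom_smul:
  "\<phi> \<in> herm_homs E d L M \<Longrightarrow> u \<in> pts L \<Longrightarrow> a \<in> pw 0 \<Longrightarrow> x \<in> \<phi> (modL u) \<Longrightarrow> smul M a x \<in> \<phi> (modL (smul L a u))"
  and hom_form:
  "\<phi> \<in> herm_homs E d L M \<Longrightarrow> u \<in> pts L \<Longrightarrow> v \<in> pts L \<Longrightarrow> x \<in> \<phi> (modL u) \<Longrightarrow> y \<in> \<phi> (modL v) \<Longrightarrow>
    form M x y - form L u v \<in> pw (2 * int d - 1)"
  unfolding herm_homs_iff using coset_self[OF M.subgrp_pm] by metis+

lemma hom_nonempty: "\<phi> \<in> herm_homs E d L M \<Longrightarrow> u \<in> pts L \<Longrightarrow> \<exists>y. y \<in> \<phi> (modL u)"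
  using hom_value[of \<phi> u] coset_self[OF M.subgrp_pm] by (auto simp: quot_def)

lemma e_pts: "l < n \<Longrightarrow> e l \<in> pts L"
  by (rule L.basis_pts[OF basis])

lemma tuples_lc:
  assumes \<phi>: "\<phi> \<in> herm_homs E d L M" and x: "x \<in> tuples \<phi>" and c: "\<And>l. l < n \<Longrightarrow> c l \<in> pw 0"
  shows "M.lc {..<n} c x \<in> \<phi> (modL (L.lc {..<n} c e))"
proof -
  have "M.lc {..<k} c x \<in> \<phi> (modL (L.lc {..<k} c e))" if "k \<le> n" for k
    using that
  proof (induction k)
    case 0
    \<comment> \<open>The zero vector lifts the image of 0, being 0 times any lift of it.\<close>
    obtain y where "y \<in> \<phi> (modL 0)" using hom_nonempty[OF \<phi> L.pts_0] by blast
    then show ?case using hom_smul[OF \<phi> L.pts_0, of 0] by simp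
  next
    case (Suc k)
    have k: "k < n" using Suc.prems by simp
    have "smul M (c k) (x k) \<in> \<phi> (modL (smul L (c k) (e k)))"
      using x k by (intro hom_smul[OF \<phi> e_pts[OF k] c[OF k]]) (simp add: tuples_def)
    moreover have "L.lc {..<k} c e \<in> pts L" using k c e_pts by (intro L.pts_lc) auto
    ultimately show ?case
      using hom_add[OF \<phi> _ L.pts_smul[OF c[OF k] e_pts[OF k]]] Suc by simp
  qed
  then show ?thesis by simp
qed

lemma tuples_coset:
  assumes "\<phi> \<in> herm_homs E d L M" "x \<in> tuples \<phi>" "\<And>l. l < n \<Longrightarrow> c l \<in> pw 0"
  shows "\<phi> (modL (L.lc {..<n} c e)) = coset (M.pm (2 * d)) (M.lc {..<n} c x)"
proof (rule hom_coset(2)[OF assms(1)])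
  show "L.lc {..<n} c e \<in> pts L" using assms(3) e_pts by (intro L.pts_lc) auto
  show "M.lc {..<n} c x \<in> \<phi> (modL (L.lc {..<n} c e))" using assms by (intro tuples_lc)
qed

lemma tuples_nonempty:
  assumes \<phi>: "\<phi> \<in> herm_homs E d L M"
  shows "\<exists>x. x \<in> tuples \<phi>"
proof -
  define x where "x l = (if l < n then SOME y. y \<in> \<phi> (modL (e l)) else 0)" for l
  have "x l \<in> \<phi> (modL (e l))" if "l < n" for l
    unfolding x_def using that hom_nonempty[OF \<phi> e_pts[OF that]] someI_ex[of "\<lambda>y. y \<in> \<phi> (modL (e l))"] by simp
  then have "x \<in> tuples \<phi>"
    using hom_coset(1)[OF \<phi> e_pts] by (auto simp: tuples_def FS_def x_def)
  then show ?thesis by blast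
qed

lemma tuples_eq_coset:
  assumes \<phi>: "\<phi> \<in> herm_homs E d L M" and x: "x \<in> tuples \<phi>"
  shows "tuples \<phi> = coset K x"
proof -
  have 1: "\<phi> (modL (e l)) = coset (M.pm (2 * d)) (x l)" if "l < n" for l
    using hom_coset(2)[OF \<phi> e_pts[OF that]] x that by (simp add: tuples_def)
  have xF: "x \<in> FS {..<n} (\<lambda>_. pts M)" using x by (simp add: tuples_def)
  have "y \<in> tuples \<phi> \<longleftrightarrow> y - x \<in> K" for y
  proof
    assume "y \<in> tuples \<phi>"
    then show "y - x \<in> K" using 1 xF by (auto simp: tuples_def FS_def mem_coset)
  next
    assume yx: "y - x \<in> K"
    have "y l - x l \<in> M.pm (2 * d)" if "l < n" for l using FS_D[OF yx] that by simp
    moreover have "y l \<in> pts M" if "l < n" for l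
      using M.pts_add[of "y l - x l" "x l"] calculation[OF that] subsetD[OF M.pm_subset_pts] FS_D[OF xF] that
      by simp
    moreover have "y l = 0" if "\<not> l < n" for l using FS_out[OF yx, of l] FS_out[OF xF, of l] that by simp
    ultimately show "y \<in> tuples \<phi>" using 1 by (auto simp: tuples_def FS_def mem_coset)
  qed
  then show ?thesis by (intro set_eqI) (simp only: mem_coset)
qed

lemma tuples_gram: "\<phi> \<in> herm_homs E d L M \<Longrightarrow> x \<in> tuples \<phi> \<Longrightarrow> x \<in> gram_tuples"
  using hom_form e_pts by (auto simp: tuples_def gram_tuples_def)

text \<open>The homomorphism is the linear extension of \<open>x\<close> in coordinates. The
  coordinates of a class are determined only modulo \<pi>^(2d), which is exactly what the target
  ignores.\<close>

lemma gram_tuples_hom: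
  assumes x: "x \<in> gram_tuples"
  shows "\<exists>\<phi>\<in>herm_homs E d L M. x \<in> tuples \<phi>"
proof -
  have xM: "x l \<in> pts M" if "l < n" for l using x that by (auto simp: gram_tuples_def dest: FS_D)
  define cf where "cf C = (SOME c. (\<forall>l<n. c l \<in> pw 0) \<and> C = modL (L.lc {..<n} c e))" for C
  define \<phi> where "\<phi> C = (if C \<in> quot (pts L) (L.pm (2 * d)) then coset (M.pm (2 * d)) (M.lc {..<n} (cf C) x) else undefined)" for C
  have \<phi>: "\<phi> (modL (L.lc {..<n} c e)) = coset (M.pm (2 * d)) (M.lc {..<n} c x)" if c: "\<forall>l<n. c l \<in> pw 0" for c
  proof -
    let ?C = "modL (L.lc {..<n} c e)"
    have "(\<forall>l<n. cf ?C l \<in> pw 0) \<and> ?C = modL (L.lc {..<n} (cf ?C) e)"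
      unfolding cf_def by (rule someI[of _ c]) (use c in simp)
    then have "modL (L.lc {..<n} (cf ?C) e) = ?C" by simp
    then have "L.lc {..<n} (cf ?C) e - L.lc {..<n} c e \<in> L.pm (2 * d)"
      by (simp only: modL coset_eq_iff[OF L.subgrp_pm])
    then have "cf ?C l - c l \<in> pw (int (2 * d))" if "l < n" for l
      unfolding L.lc_diff by (rule L.basis_pm[OF basis _ that])
    then have "M.lc {..<n} (cf ?C) x - M.lc {..<n} c x \<in> M.pm (2 * d)"
      unfolding M.lc_diff using xM by (intro subgrp_sum M.subgrp_pm M.smul_pm) auto
    moreover have "?C \<in> quot (pts L) (L.pm (2 * d))"
      unfolding modL quot_def using c e_pts by (intro imageI L.pts_lc) auto
    ultimately show ?thesis unfolding \<phi>_def by (simp add: coset_eq_iff[OF M.subgrp_pm])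
  qed
  have "\<phi> \<in> herm_homs E d L M"
    unfolding herm_homs_iff
  proof (intro conjI ballI)
    show "\<phi> \<in> quot (pts L) (L.pm (2 * d)) \<rightarrow>\<^sub>E quot (pts M) (M.pm (2 * d))"
    proof (rule PiE_I)
      fix C assume "C \<in> quot (pts L) (L.pm (2 * d))"
      then obtain u where u: "u \<in> pts L" "C = modL u" by (auto simp: quot_def modL)
      obtain c where c: "\<forall>l<n. c l \<in> pw 0" "u = L.lc {..<n} c e" using L.basis_expand[OF basis u(1)] by blast
      show "\<phi> C \<in> quot (pts M) (M.pm (2 * d))"
        unfolding u(2) c(2) \<phi>[OF c(1)] quot_def using c(1) xM by (intro imageI M.pts_lc) auto
    qed (simp add: \<phi>_def)
    fix u v y z
    assume u: "u \<in> pts L" and v: "v \<in> pts L" and y: "y \<in> \<phi> (modL u)" and z: "z \<in> \<phi> (modL v)"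
    obtain b where b: "\<forall>l<n. b l \<in> pw 0" "u = L.lc {..<n} b e" using L.basis_expand[OF basis u] by blast
    obtain c where c: "\<forall>l<n. c l \<in> pw 0" "v = L.lc {..<n} c e" using L.basis_expand[OF basis v] by blast
    have y': "y - M.lc {..<n} b x \<in> M.pm (2 * d)" using y unfolding b(2) \<phi>[OF b(1)] mem_coset .
    have z': "z - M.lc {..<n} c x \<in> M.pm (2 * d)" using z unfolding c(2) \<phi>[OF c(1)] mem_coset .
    have lM: "M.lc {..<n} b x \<in> pts M" "M.lc {..<n} c x \<in> pts M" using b c xM by (auto intro!: M.pts_lc)
    have zM: "z \<in> pts M" using M.pts_add[OF subsetD[OF M.pm_subset_pts z'] lM(2)] by simp
    have "M.lc {..<n} (\<lambda>l. b l + c l) x - (y + z) = - ((y - M.lc {..<n} b x) + (z - M.lc {..<n} c x))"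
      unfolding M.lc_add[symmetric] by simp
    also have "\<dots> \<in> M.pm (2 * d)" by (intro subgrp_uminus subgrp_add M.subgrp_pm y' z')
    finally show "\<phi> (modL (u + v)) = coset (M.pm (2 * d)) (y + z)"
      using b c unfolding b(2) c(2) L.lc_add by (subst \<phi>) (auto intro: pw_add simp: coset_eq_iff[OF M.subgrp_pm])
    show "\<phi> (modL (smul L a u)) = coset (M.pm (2 * d)) (smul M a y)" if a: "a \<in> pw 0" for a
    proof -
      have "M.lc {..<n} (\<lambda>l. a * b l) x - smul M a y = - smul M a (y - M.lc {..<n} b x)"
        unfolding M.lc_smul[symmetric] by (simp add: M.V.scale_right_diff_distrib)
      also have "\<dots> \<in> M.pm (2 * d)" by (intro subgrp_uminus M.subgrp_pm M.submod_smul[OF M.submod_pm] a y')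
      finally show ?thesis
        using b pw_mult[OF a, of _ 0] unfolding b(2) L.lc_smul
        by (subst \<phi>) (auto simp: coset_eq_iff[OF M.subgrp_pm])
    qed
    have "form M (M.lc {..<n} b x) (M.lc {..<n} c x) - form L u v =
        (\<Sum>j<n. b j * (\<Sum>l<n. cj (c l) * (form M (x j) (x l) - T j l)))"
      unfolding b(2) c(2) M.form_lc_left L.form_lc_left unfolding M.form_lc_right L.form_lc_right
      by (simp add: right_diff_distrib sum_subtractf)
    also have "\<dots> \<in> pw (2 * int d - 1)"
      using b(1) c(1) x by (intro pw_sum pw_mult_le[of _ 0 _ "2 * int d - 1"]) (auto simp: gram_tuples_def cj_pw)
    finally have 1: "form M (M.lc {..<n} b x) (M.lc {..<n} c x) - form L u v \<in> pw (2 * int d - 1)" .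
    have 2: "form M (y - M.lc {..<n} b x) z \<in> pw (2 * int d - 1)" by (rule form_M_pm[OF y' zM])
    have 3: "cj (form M (z - M.lc {..<n} c x) (M.lc {..<n} b x)) \<in> pw (2 * int d - 1)"
      using form_M_pm[OF z' lM(1)] by (simp add: cj_pw)
    have "form M y z - form L u v = (form M (M.lc {..<n} b x) (M.lc {..<n} c x) - form L u v)
        + form M (y - M.lc {..<n} b x) z + cj (form M (z - M.lc {..<n} c x) (M.lc {..<n} b x))"
      unfolding M.form_conj[of "M.lc {..<n} b x" "z - M.lc {..<n} c x", symmetric]
      by (simp only: M.form_diff_left M.form_diff_right) simp
    also have "\<dots> \<in> pw (2 * int d - 1)" by (intro pw_add 1 2 3)
    finally show "form M y z - form L u v \<in> pw (2 * int d - 1)" .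
  qed
  moreover have "x l \<in> \<phi> (modL (e l))" if "l < n" for l
    using \<phi>[of "\<lambda>j. if j = l then 1 else 0"] coset_self[OF M.subgrp_pm]
    unfolding M.basis_delta[OF that] L.basis_delta[OF that] by simp
  then have "x \<in> tuples \<phi>" using x by (auto simp: tuples_def gram_tuples_def)
  ultimately show ?thesis by blast
qed

lemma bij_tuples: "bij_betw tuples (herm_homs E d L M) (quot gram_tuples K)"
proof (rule bij_betw_imageI)
  show "inj_on tuples (herm_homs E d L M)"
  proof (rule inj_onI)
    fix \<phi> \<psi> assume \<phi>: "\<phi> \<in> herm_homs E d L M" and \<psi>: "\<psi> \<in> herm_homs E d L M" and eq: "tuples \<phi> = tuples \<psi>"
    obtain x where x: "x \<in> tuples \<phi>" "x \<in> tuples \<psi>" using tuples_nonempty[OF \<phi>] eq by blast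
    show "\<phi> = \<psi>"
    proof (rule PiE_ext)
      show "\<phi> \<in> quot (pts L) (L.pm (2 * d)) \<rightarrow>\<^sub>E quot (pts M) (M.pm (2 * d))"
        "\<psi> \<in> quot (pts L) (L.pm (2 * d)) \<rightarrow>\<^sub>E quot (pts M) (M.pm (2 * d))"
        using \<phi> \<psi> by (simp_all add: herm_homs_iff)
      fix C assume "C \<in> quot (pts L) (L.pm (2 * d))"
      then obtain u where u: "u \<in> pts L" "C = modL u" by (auto simp: quot_def modL)
      obtain c where c: "\<forall>l<n. c l \<in> pw 0" "u = L.lc {..<n} c e" using L.basis_expand[OF basis u(1)] by blast
      show "\<phi> C = \<psi> C"
        unfolding u(2) c(2) using tuples_coset[OF \<phi> x(1)] tuples_coset[OF \<psi> x(2)] c(1) by simp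
    qed
  qed
  show "tuples ` herm_homs E d L M = quot gram_tuples K"
  proof (intro equalityI subsetI)
    fix X assume "X \<in> tuples ` herm_homs E d L M"
    then obtain \<phi> where \<phi>: "\<phi> \<in> herm_homs E d L M" "X = tuples \<phi>" by blast
    obtain x where x: "x \<in> tuples \<phi>" using tuples_nonempty[OF \<phi>(1)] by blast
    show "X \<in> quot gram_tuples K"
      unfolding \<phi>(2) tuples_eq_coset[OF \<phi>(1) x] quot_def using tuples_gram[OF \<phi>(1) x] by (rule imageI)
  next
    fix X assume "X \<in> quot gram_tuples K"
    then obtain x where x: "x \<in> gram_tuples" "X = coset K x" by (auto simp: quot_def)
    then show "X \<in> tuples ` herm_homs E d L M"
      using gram_tuples_hom[OF x(1)] tuples_eq_coset by blast
  qed
qed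

text \<open>Primitivity and the kernel can be tested on any tuple of lifts; this transports their
  counts to cosets of tuples.\<close>

lemma card_homs_filter:
  assumes "\<And>\<phi> x. \<phi> \<in> herm_homs E d L M \<Longrightarrow> x \<in> tuples \<phi> \<Longrightarrow> A \<phi> \<longleftrightarrow> R x"
  shows "card {\<phi> \<in> herm_homs E d L M. A \<phi>} = card (quot {x \<in> gram_tuples. R x} K)"
proof (rule bij_betw_same_card[OF bij_betw_subset[OF bij_tuples]])
  show "tuples ` {\<phi> \<in> herm_homs E d L M. A \<phi>} = quot {x \<in> gram_tuples. R x} K"
  proof (intro equalityI subsetI)
    fix X assume "X \<in> tuples ` {\<phi> \<in> herm_homs E d L M. A \<phi>}"
    then obtain \<phi> where \<phi>: "\<phi> \<in> herm_homs E d L M" "X = tuples \<phi>" "A \<phi>" by blast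
    obtain x where x: "x \<in> tuples \<phi>" using tuples_nonempty[OF \<phi>(1)] by blast
    show "X \<in> quot {x \<in> gram_tuples. R x} K"
      unfolding \<phi>(2) tuples_eq_coset[OF \<phi>(1) x] quot_def
      using tuples_gram[OF \<phi>(1) x] assms[OF \<phi>(1) x] \<phi>(3) by simp
  next
    fix X assume "X \<in> quot {x \<in> gram_tuples. R x} K"
    then obtain x where x: "x \<in> gram_tuples" "R x" "X = coset K x" by (auto simp: quot_def)
    obtain \<phi> where \<phi>: "\<phi> \<in> herm_homs E d L M" "x \<in> tuples \<phi>" using gram_tuples_hom[OF x(1)] by blast
    then have "X = tuples \<phi>" "A \<phi>" using tuples_eq_coset x assms by auto
    then show "X \<in> tuples ` {\<phi> \<in> herm_homs E d L M. A \<phi>}" using \<phi>(1) by blast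
  qed
qed auto

lemma finite_herm_homs: "finite (herm_homs E d L M)"
proof -
  have "card (quot (FS {..<n} (\<lambda>_. pts M)) K) = (q ^ (2 * d * (m + h))) ^ n"
    by (subst card_quot_FS) (auto intro: M.subgrp_pm simp: M.card_quot_pts_pm)
  then have "finite (quot (FS {..<n} (\<lambda>_. pts M)) K)" using q_gt_1 by (intro card_ge_0_finite) simp
  then have "finite (quot gram_tuples K)"
    by (rule finite_subset[rotated]) (auto simp: quot_def gram_tuples_def)
  then show ?thesis using bij_betw_finite[OF bij_tuples] by blast
qed

lemma pm_pM: "M.pm (2 * d) \<subseteq> M.pM"
  using M.pm_mono[of 1 "2 * d"] d by simp

text \<open>The image of \<open>L\<close> modulo \<pi> is spanned by the residues of the n lifts, so
  having dimension n means that they are independent.\<close>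

lemma prim_homs_iff:
  assumes \<phi>: "\<phi> \<in> herm_homs E d L M" and x: "x \<in> tuples \<phi>" and rank: "lat_rank L = n"
  shows "\<phi> \<in> prim_homs E d L M \<longleftrightarrow> M.rind {..<n} x"
proof -
  have xM: "x l \<in> pts M" if "l < n" for l using x that by (auto simp: tuples_def dest: FS_D)
  have "{coset M.pM y | y. \<exists>u\<in>pts L. y \<in> \<phi> (modL u)} = {coset M.pM (M.lc {..<n} c x) | c. \<forall>l<n. c l \<in> pw 0}"
  proof (intro equalityI subsetI)
    fix Y assume "Y \<in> {coset M.pM y | y. \<exists>u\<in>pts L. y \<in> \<phi> (modL u)}"
    then obtain y u where y: "Y = coset M.pM y" "u \<in> pts L" "y \<in> \<phi> (modL u)" by blast
    obtain c where c: "\<forall>l<n. c l \<in> pw 0" "u = L.lc {..<n} c e" using L.basis_expand[OF basis y(2)] by blast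
    have "y - M.lc {..<n} c x \<in> M.pM"
      using y(3) tuples_coset[OF \<phi> x, of c] c pm_pM by (auto simp: mem_coset)
    then have "Y = coset M.pM (M.lc {..<n} c x)" using y(1) coset_eq_iff[OF M.subgrp_pM] by blast
    then show "Y \<in> {coset M.pM (M.lc {..<n} c x) | c. \<forall>l<n. c l \<in> pw 0}" using c(1) by blast
  next
    fix Y assume "Y \<in> {coset M.pM (M.lc {..<n} c x) | c. \<forall>l<n. c l \<in> pw 0}"
    then obtain c where c: "Y = coset M.pM (M.lc {..<n} c x)" "\<forall>l<n. c l \<in> pw 0" by blast
    have "M.lc {..<n} c x \<in> \<phi> (modL (L.lc {..<n} c e))" using tuples_lc[OF \<phi> x] c(2) by blast
    moreover have "L.lc {..<n} c e \<in> pts L" using c(2) e_pts by (intro L.pts_lc) auto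
    ultimately show "Y \<in> {coset M.pM y | y. \<exists>u\<in>pts L. y \<in> \<phi> (modL u)}" using c(1) by blast
  qed
  then show ?thesis
    using \<phi> M.has_residue_dim_span_iff[OF xM] by (simp add: prim_homs_def rank)
qed

text \<open>The preimage in \<open>L\<close> of the kernel V of the induced map to \<open>MQ\<close>
  modulo \<pi>. It does not involve the basis, so bases adapted to different V can be used for the
  same \<phi>.\<close>

definition "ker_lat \<phi> = {u \<in> pts L. \<exists>y\<in>\<phi> (modL u). M.Q y \<in> M.pM}"

lemma ker_lat_iff:
  assumes \<phi>: "\<phi> \<in> herm_homs E d L M" and x: "x \<in> tuples \<phi>" and c: "\<And>l. l < n \<Longrightarrow> c l \<in> pw 0"
  shows "L.lc {..<n} c e \<in> ker_lat \<phi> \<longleftrightarrow> M.Q (M.lc {..<n} c x) \<in> M.pM"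
proof
  assume "L.lc {..<n} c e \<in> ker_lat \<phi>"
  then obtain y where y: "y - M.lc {..<n} c x \<in> M.pm (2 * d)" "M.Q y \<in> M.pM"
    using tuples_coset[OF \<phi> x c] by (auto simp: ker_lat_def mem_coset)
  have "M.Q (y - M.lc {..<n} c x) \<in> M.pM" using y(1) pm_pM M.Q_pM by blast
  then show "M.Q (M.lc {..<n} c x) \<in> M.pM"
    using subgrp_cong_iff[OF M.subgrp_pM] y(2) by (simp only: M.Q_diff)
next
  assume "M.Q (M.lc {..<n} c x) \<in> M.pM"
  then show "L.lc {..<n} c e \<in> ker_lat \<phi>"
    using tuples_lc[OF \<phi> x c] c e_pts by (auto simp: ker_lat_def intro!: L.pts_lc)
qed

lemma ker_lat_submod:
  assumes \<phi>: "\<phi> \<in> herm_homs E d L M"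
  shows "L.submod (ker_lat \<phi>)" "L.pM \<subseteq> ker_lat \<phi>"
proof -
  obtain x where x: "x \<in> tuples \<phi>" using tuples_nonempty[OF \<phi>] by blast
  have xM: "x l \<in> pts M" if "l < n" for l using x that by (auto simp: tuples_def dest: FS_D)
  show "L.pM \<subseteq> ker_lat \<phi>"
  proof
    fix u assume u: "u \<in> L.pM"
    then have "u \<in> pts L" using L.pM_subset_pts by blast
    then obtain c where c: "\<forall>l<n. c l \<in> pw 0" "u = L.lc {..<n} c e" using L.basis_expand[OF basis] by blast
    have "c l \<in> pw 1" if "l < n" for l using L.basis_pm[OF basis, of c 1 l] u c(2) that by simp
    then have "M.lc {..<n} c x \<in> M.pM" using xM by (intro M.lc_pM) auto
    then show "u \<in> ker_lat \<phi>" using ker_lat_iff[OF \<phi> x, of c] c M.Q_pM by simp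
  qed
  show "L.submod (ker_lat \<phi>)"
    unfolding L.submod_def
  proof (intro conjI subgrpI ballI)
    show "0 \<in> ker_lat \<phi>" using \<open>L.pM \<subseteq> ker_lat \<phi>\<close> subgrp_0[OF L.subgrp_pM] by blast
  next
    fix u v assume uv: "u \<in> ker_lat \<phi>" "v \<in> ker_lat \<phi>"
    then obtain b where b: "\<forall>l<n. b l \<in> pw 0" "u = L.lc {..<n} b e"
      using L.basis_expand[OF basis] by (auto simp: ker_lat_def)
    obtain c where c: "\<forall>l<n. c l \<in> pw 0" "v = L.lc {..<n} c e"
      using uv L.basis_expand[OF basis] by (auto simp: ker_lat_def)
    have bc: "b l - c l \<in> pw 0" if "l < n" for l using b c that by (intro pw_diff) auto
    have "M.Q (M.lc {..<n} b x) - M.Q (M.lc {..<n} c x) \<in> M.pM"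
      using uv b c ker_lat_iff[OF \<phi> x, of b] ker_lat_iff[OF \<phi> x, of c]
      by (intro subgrp_diff[OF M.subgrp_pM]) auto
    then have "M.Q (M.lc {..<n} (\<lambda>l. b l - c l) x) \<in> M.pM"
      unfolding M.Q_diff[symmetric] M.lc_diff .
    then show "u - v \<in> ker_lat \<phi>"
      unfolding b(2) c(2) L.lc_diff using ker_lat_iff[OF \<phi> x, of "\<lambda>l. b l - c l"] bc by blast
  next
    fix a u assume a: "a \<in> pw 0" and u: "u \<in> ker_lat \<phi>"
    then obtain c where c: "\<forall>l<n. c l \<in> pw 0" "u = L.lc {..<n} c e"
      using L.basis_expand[OF basis] by (auto simp: ker_lat_def)
    have ac: "a * c l \<in> pw 0" if "l < n" for l using pw_mult[OF a, of "c l" 0] c(1) that by simp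
    have "smul M a (M.Q (M.lc {..<n} c x)) \<in> M.pM"
      using u c ker_lat_iff[OF \<phi> x, of c] by (intro M.submod_smul[OF M.submod_pM a]) auto
    then have "M.Q (M.lc {..<n} (\<lambda>l. a * c l) x) \<in> M.pM"
      unfolding M.Q_smul[symmetric] M.lc_smul .
    then show "smul L a u \<in> ker_lat \<phi>"
      unfolding c(2) L.lc_smul using ker_lat_iff[OF \<phi> x, of "\<lambda>l. a * c l"] ac by blast
  qed
qed

lemma ker_Gr: "\<phi> \<in> herm_homs E d L M \<Longrightarrow> \<exists>r\<le>n. quot (ker_lat \<phi>) L.pM \<in> Gr E r L"
proof -
  assume \<phi>: "\<phi> \<in> herm_homs E d L M"
  have sub: "ker_lat \<phi> \<subseteq> pts L" by (auto simp: ker_lat_def)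
  obtain r x where r: "r \<le> n" "\<forall>l<r. x l \<in> ker_lat \<phi>" "L.rind {..<r} x"
    "quot (ker_lat \<phi>) L.pM = {coset L.pM (L.lc {..<r} c x) | c. \<forall>l<r. c l \<in> pw 0}"
    using L.submod_residue_span[OF basis ker_lat_submod[OF \<phi>] sub] by auto
  have "has_residue_dim E L (quot (ker_lat \<phi>) L.pM) r"
    unfolding L.has_residue_dim_iff using r(2-4) sub by (intro exI[of _ x] conjI) auto
  then show ?thesis using r(1) unfolding Gr_def by blast
qed

lemma split_sum: "i \<le> n \<Longrightarrow> sum f {..<n} = sum f {..<i} + sum f {i..<n}"
  for f :: "nat \<Rightarrow> 'a::comm_monoid_add"
  by (simp add: lessThan_atLeast0 sum.atLeastLessThan_concat)

text \<open>A linear map has the span of the first i basis vectors as kernel iff it kills them and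
  is injective on the span of the others.\<close>

lemma ker_eq_iff:
  assumes \<phi>: "\<phi> \<in> herm_homs E d L M" and x: "x \<in> tuples \<phi>" and i: "i \<le> n"
    and V: "V = {coset L.pM (L.lc {..<i} c e) | c. \<forall>l<i. c l \<in> pw 0}"
  shows "quot (ker_lat \<phi>) L.pM = V \<longleftrightarrow>
    (\<forall>l<i. M.Q (x l) \<in> M.pM) \<and> M.rind {i..<n} (\<lambda>l. M.Q (x l))"
proof
  have sub: "u \<in> ker_lat \<phi>" if "v \<in> ker_lat \<phi>" "u - v \<in> L.pM" for u v
    using subgrp_add[OF L.submod_subgrp[OF ker_lat_submod(1)[OF \<phi>]] that(1), of "u - v"]
      ker_lat_submod(2)[OF \<phi>] that(2) by auto
  assume eq: "quot (ker_lat \<phi>) L.pM = V"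
  show "(\<forall>l<i. M.Q (x l) \<in> M.pM) \<and> M.rind {i..<n} (\<lambda>l. M.Q (x l))"
  proof (intro conjI allI impI)
    fix l assume l: "l < i"
    have dl: "\<forall>j<k. (if j = l then 1 else 0) \<in> pw 0" for k :: nat by simp
    have "coset L.pM (L.lc {..<i} (\<lambda>j. if j = l then 1 else 0) e) \<in> V"
      unfolding V using dl[of i]
      by (intro CollectI exI[of _ "\<lambda>j. if j = l then 1 else 0"] conjI refl)
    then have "coset L.pM (e l) \<in> quot (ker_lat \<phi>) L.pM" using eq L.basis_delta[OF l] by simp
    then obtain v where "v \<in> ker_lat \<phi>" "e l - v \<in> L.pM"
      by (auto simp: quot_def coset_eq_iff[OF L.subgrp_pM])
    then have "e l \<in> ker_lat \<phi>" by (rule sub)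
    then have "L.lc {..<n} (\<lambda>j. if j = l then 1 else 0) e \<in> ker_lat \<phi>"
      using L.basis_delta[of l n] l i by simp
    then have "M.Q (M.lc {..<n} (\<lambda>j. if j = l then 1 else 0) x) \<in> M.pM"
      using ker_lat_iff[OF \<phi> x, of "\<lambda>j. if j = l then 1 else 0"] dl by blast
    then show "M.Q (x l) \<in> M.pM" using M.basis_delta[of l n] l i by simp
  next
    show "M.rind {i..<n} (\<lambda>l. M.Q (x l))"
    proof (rule M.rindI)
      fix c assume c: "\<And>l. l \<in> {i..<n} \<Longrightarrow> c l \<in> pw 0" and s: "M.lc {i..<n} c (\<lambda>l. M.Q (x l)) \<in> M.pM"
      \<comment> \<open>Extension by 0 turns a relation among the later \<open>Q\<close>-parts into
        an element of the kernel lattice.\<close>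
      define c' where "c' l = (if l < i then 0 else c l)" for l
      have cM: "M.lc {..<n} c' y = M.lc {i..<n} c y" for y unfolding split_sum[OF i] by (simp add: c'_def)
      have c': "c' l \<in> pw 0" if "l < n" for l using c that by (simp add: c'_def)
      have "M.Q (M.lc {..<n} c' x) \<in> M.pM" using s unfolding M.Q_lc cM .
      then have "L.lc {..<n} c' e \<in> ker_lat \<phi>" using ker_lat_iff[OF \<phi> x, of c'] c' by blast
      then have "coset L.pM (L.lc {..<n} c' e) \<in> V" using eq by (auto simp: quot_def)
      \<comment> \<open>Lying in V, the element is congruent to a combination of the first i basis
        vectors, so its coordinates from i on are divisible by \<pi>.\<close>
      then obtain b where b: "L.lc {..<n} c' e - L.lc {..<i} b e \<in> L.pM"
        unfolding V by (auto simp: coset_eq_iff[OF L.subgrp_pM])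
      define b' where "b' l = (if l < i then b l else 0)" for l
      have "L.lc {..<n} b' e = L.lc {..<i} b e" unfolding split_sum[OF i] by (simp add: b'_def)
      then have "L.lc {..<n} (\<lambda>l. c' l - b' l) e \<in> L.pm 1" using b by (simp flip: L.lc_diff)
      then have "c' l - b' l \<in> pw 1" if "l < n" for l
        using L.basis_pm[OF basis, of "\<lambda>l. c' l - b' l" 1 l] that by simp
      then show "\<forall>l\<in>{i..<n}. c l \<in> pw 1" by (fastforce simp: c'_def b'_def)
    qed
  qed
next
  assume "(\<forall>l<i. M.Q (x l) \<in> M.pM) \<and> M.rind {i..<n} (\<lambda>l. M.Q (x l))"
  then have Qx: "\<And>l. l < i \<Longrightarrow> M.Q (x l) \<in> M.pM" and ind: "M.rind {i..<n} (\<lambda>l. M.Q (x l))" by auto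
  show "quot (ker_lat \<phi>) L.pM = V"
  proof (intro equalityI subsetI)
    fix X assume "X \<in> quot (ker_lat \<phi>) L.pM"
    then obtain u where u: "u \<in> ker_lat \<phi>" "X = coset L.pM u" by (auto simp: quot_def)
    then obtain c where c: "\<forall>l<n. c l \<in> pw 0" "u = L.lc {..<n} c e"
      using L.basis_expand[OF basis] by (auto simp: ker_lat_def)
    have "M.Q (M.lc {..<n} c x) \<in> M.pM" using ker_lat_iff[OF \<phi> x, of c] u c by blast
    moreover have "M.lc {..<i} c (\<lambda>l. M.Q (x l)) \<in> M.pM" using Qx c(1) i by (intro M.submod_lc M.submod_pM) auto
    ultimately have "M.lc {i..<n} c (\<lambda>l. M.Q (x l)) \<in> M.pM"
      unfolding M.Q_lc unfolding split_sum[OF i] by (rule subgrp_cancel_left[OF M.subgrp_pM])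
    then have "c l \<in> pw 1" if "l \<in> {i..<n}" for l using M.rindD[OF ind _ _ that] c(1) by simp
    then have "L.lc {i..<n} c e \<in> L.pM" using e_pts by (intro L.lc_pM) auto
    then have "X = coset L.pM (L.lc {..<i} c e)"
      unfolding u(2) c(2) split_sum[OF i] coset_eq_iff[OF L.subgrp_pM] by simp
    then show "X \<in> V" unfolding V using c(1) i by auto
  next
    fix X assume "X \<in> V"
    then obtain c where c: "X = coset L.pM (L.lc {..<i} c e)" "\<forall>l<i. c l \<in> pw 0" unfolding V by blast
    define c' where "c' l = (if l < i then c l else 0)" for l
    have cM: "M.lc {..<n} c' y = M.lc {..<i} c y" for y unfolding split_sum[OF i] by (simp add: c'_def)
    have cL: "L.lc {..<n} c' y = L.lc {..<i} c y" for y unfolding split_sum[OF i] by (simp add: c'_def)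
    have "M.lc {..<i} c (\<lambda>l. M.Q (x l)) \<in> M.pM" using Qx c(2) by (intro M.submod_lc M.submod_pM) auto
    then have "L.lc {..<n} c' e \<in> ker_lat \<phi>"
      using ker_lat_iff[OF \<phi> x, of c'] c(2) unfolding M.Q_lc cM by (simp add: c'_def)
    then show "X \<in> quot (ker_lat \<phi>) L.pM" using c(1) cL by (auto simp: quot_def)
  qed
qed

text \<open>Block triangularity: modulo \<pi> the first i vectors have no \<open>Q\<close>-part and
  the \<open>Q\<close>-parts of the others are independent. A relation thus involves the first i
  vectors only, where it is one between \<open>P\<close>-parts.\<close>

lemma rind_frames:
  assumes xM: "\<And>l. l < n \<Longrightarrow> x l \<in> pts M" and i: "i \<le> n" and Qx: "\<And>l. l < i \<Longrightarrow> M.Q (x l) \<in> M.pM"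
    and ind: "M.rind {i..<n} (\<lambda>l. M.Q (x l))"
  shows "M.rind {..<n} x \<longleftrightarrow> M.rind {..<i} (\<lambda>l. P (x l))"
proof
  have Q: "M.lc {..<i} c (\<lambda>l. M.Q (x l)) \<in> M.pM" if "\<And>l. l < i \<Longrightarrow> c l \<in> pw 0" for c
    using that Qx by (intro M.submod_lc M.submod_pM) auto
  assume x: "M.rind {..<n} x"
  show "M.rind {..<i} (\<lambda>l. P (x l))"
  proof (rule M.rindI)
    fix c assume c: "\<And>l. l \<in> {..<i} \<Longrightarrow> c l \<in> pw 0" and s: "M.lc {..<i} c (\<lambda>l. P (x l)) \<in> M.pM"
    have "P (M.lc {..<i} c x) \<in> M.pM" "M.Q (M.lc {..<i} c x) \<in> M.pM"
      using s Q[of c] c unfolding M.P_lc M.Q_lc by auto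
    then have "M.lc {..<i} c x \<in> M.pM" using M.pM_iff by blast
    moreover have "M.rind {..<i} x" by (rule M.rind_subset[OF x]) (use i in auto)
    ultimately show "\<forall>l\<in>{..<i}. c l \<in> pw 1" using c by (intro ballI M.rindD[of "{..<i}" x c])
  qed
next
  assume x: "M.rind {..<i} (\<lambda>l. P (x l))"
  show "M.rind {..<n} x"
  proof (rule M.rindI)
    fix c assume c: "\<And>l. l \<in> {..<n} \<Longrightarrow> c l \<in> pw 0" and s: "M.lc {..<n} c x \<in> M.pM"
    have Pc: "P (M.lc {..<n} c x) \<in> M.pM" using s M.pM_iff by blast
    have "M.Q (M.lc {..<n} c x) \<in> M.pM" using s M.pM_iff by blast
    moreover have "M.lc {..<i} c (\<lambda>l. M.Q (x l)) \<in> M.pM" using Qx c i by (intro M.submod_lc M.submod_pM) auto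
    ultimately have "M.lc {i..<n} c (\<lambda>l. M.Q (x l)) \<in> M.pM"
      unfolding M.Q_lc unfolding split_sum[OF i] by (rule subgrp_cancel_left[OF M.subgrp_pM])
    then have c1: "c l \<in> pw 1" if "l \<in> {i..<n}" for l using M.rindD[OF ind _ _ that] c by simp
    then have Pn: "M.lc {i..<n} c (\<lambda>l. P (x l)) \<in> M.pM" using xM M.P_pts by (intro M.lc_pM) auto
    have "M.lc {..<i} c (\<lambda>l. P (x l)) + M.lc {i..<n} c (\<lambda>l. P (x l)) \<in> M.pM"
      using Pc unfolding M.P_lc unfolding split_sum[OF i] .
    then have "M.lc {..<i} c (\<lambda>l. P (x l)) \<in> M.pM" by (rule subgrp_cancel_right[OF M.subgrp_pM _ Pn])
    then have "\<forall>l\<in>{..<i}. c l \<in> pw 1" using M.rindD[OF x, of c] c i by auto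
    then show "\<forall>l\<in>{..<n}. c l \<in> pw 1" using c1
      by (metis atLeastLessThan_iff lessThan_iff linorder_not_le)
  qed
qed

text \<open>Entries below the diagonal are conjugate to those above it, and conjugation preserves
  \<open>pw\<close>; the conditions on residues agree by \<open>rind_frames\<close>.\<close>

lemma gram_tuples_frames:
  assumes i: "i \<le> n"
  shows "{x \<in> gram_tuples. M.rind {..<n} x \<and> (\<forall>l<i. M.Q (x l) \<in> M.pM) \<and> M.rind {i..<n} (\<lambda>l. M.Q (x l))} =
    M.gram_frames i n T (2 * int d - 1) (2 * int d - 1) (2 * int d - 1)"
proof -
  have "x \<in> gram_tuples \<longleftrightarrow> x \<in> FS {..<n} (\<lambda>_. pts M) \<and>
      (\<forall>(j, l)\<in>upper_pairs 0 n. form M (x j) (x l) - T j l \<in> pw (2 * int d - 1))" for x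
  proof -
    have "form M (x j) (x l) - T j l \<in> pw (2 * int d - 1)" if "j < n" "l < n"
      and u: "\<forall>(j, l)\<in>upper_pairs 0 n. form M (x j) (x l) - T j l \<in> pw (2 * int d - 1)" for j l
    proof (cases "j \<le> l")
      case False
      then have "form M (x l) (x j) - T l j \<in> pw (2 * int d - 1)"
        using u that by (auto simp: upper_pairs_def)
      then have "cj (form M (x l) (x j) - T l j) \<in> pw (2 * int d - 1)" by (simp add: cj_pw)
      then show ?thesis using M.form_conj[of "x j" "x l"] L.form_conj[of "e j" "e l"] by (simp add: cj_diff)
    qed (use u that in \<open>auto simp: upper_pairs_def\<close>)
    then show ?thesis by (auto simp: gram_tuples_def upper_pairs_def)
  qed
  moreover have "M.rind {..<n} x \<and> (\<forall>l<i. M.Q (x l) \<in> M.pM) \<and> M.rind {i..<n} (\<lambda>l. M.Q (x l)) \<longleftrightarrow>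
      (\<forall>l<i. M.Q (x l) \<in> M.pM) \<and> M.rind {..<i} (\<lambda>l. P (x l)) \<and> M.rind {i..<n} (\<lambda>l. M.Q (x l))"
    if "x \<in> FS {..<n} (\<lambda>_. pts M)" for x
  proof -
    have "x l \<in> pts M" if "l < n" for l using FS_D[OF \<open>x \<in> _\<close>] that by simp
    then show ?thesis using rind_frames[OF _ i, of x] by blast
  qed
  ultimately show ?thesis by (intro set_eqI) (simp add: M.gram_frames_def M.frames_def, blast)
qed

lemma card_prim_ker:
  assumes "lat_rank L = n" "i \<le> n" "V = {coset L.pM (L.lc {..<i} c e) | c. \<forall>l<i. c l \<in> pw 0}"
  shows "card {\<phi> \<in> prim_homs E d L M. quot (ker_lat \<phi>) L.pM = V} =
    card (quot (M.gram_frames i n T (2 * int d - 1) (2 * int d - 1) (2 * int d - 1)) K)"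
proof -
  have "{\<phi> \<in> prim_homs E d L M. quot (ker_lat \<phi>) L.pM = V} =
      {\<phi> \<in> herm_homs E d L M. \<phi> \<in> prim_homs E d L M \<and> quot (ker_lat \<phi>) L.pM = V}"
    by (auto simp: prim_homs_def)
  then show ?thesis
    unfolding gram_tuples_frames[OF assms(2), symmetric]
    using card_homs_filter[of "\<lambda>\<phi>. \<phi> \<in> prim_homs E d L M \<and> quot (ker_lat \<phi>) L.pM = V"
        "\<lambda>x. M.rind {..<n} x \<and> (\<forall>l<i. M.Q (x l) \<in> M.pM) \<and> M.rind {i..<n} (\<lambda>l. M.Q (x l))"]
      prim_homs_iff[OF _ _ assms(1)] ker_eq_iff[OF _ _ assms(2,3)] by simp
qed

text \<open>Primitive homomorphisms are sorted by kernel. Subspaces of different dimensions have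
  different cardinalities, so the strata are disjoint.\<close>

lemma card_prim_homs_sum:
  "card (prim_homs E d L M) = (\<Sum>i\<le>n. \<Sum>V\<in>Gr E i L. card {\<phi> \<in> prim_homs E d L M. quot (ker_lat \<phi>) L.pM = V})"
proof -
  have fin: "finite (prim_homs E d L M)"
    using finite_herm_homs by (rule finite_subset[rotated]) (auto simp: prim_homs_def)
  have sub: "prim_homs E d L M \<subseteq> herm_homs E d L M" by (auto simp: prim_homs_def)
  have "prim_homs E d L M = (\<Union>i\<in>{..n}. {\<phi> \<in> prim_homs E d L M. quot (ker_lat \<phi>) L.pM \<in> Gr E i L})"
    using ker_Gr sub by blast
  then have "card (prim_homs E d L M) = card (\<Union>i\<in>{..n}. {\<phi> \<in> prim_homs E d L M. quot (ker_lat \<phi>) L.pM \<in> Gr E i L})"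
    by simp
  also have "\<dots> = (\<Sum>i\<le>n. card {\<phi> \<in> prim_homs E d L M. quot (ker_lat \<phi>) L.pM \<in> Gr E i L})"
  proof (rule card_UN_disjoint)
    have "i = j" if "V \<in> Gr E i L" "V \<in> Gr E j L" for V i j
    proof -
      have "q ^ i = q ^ j" using that L.card_of_residue_dim[of V i] L.card_of_residue_dim[of V j] by (simp add: Gr_def)
      then show ?thesis using q_gt_1 by (simp add: power_inject_exp)
    qed
    then show "\<forall>i\<in>{..n}. \<forall>j\<in>{..n}. i \<noteq> j \<longrightarrow>
      {\<phi> \<in> prim_homs E d L M. quot (ker_lat \<phi>) L.pM \<in> Gr E i L} \<inter>
      {\<phi> \<in> prim_homs E d L M. quot (ker_lat \<phi>) L.pM \<in> Gr E j L} = {}" by blast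
  qed (use fin in auto)
  finally have 1: "card (prim_homs E d L M) =
    (\<Sum>i\<le>n. card {\<phi> \<in> prim_homs E d L M. quot (ker_lat \<phi>) L.pM \<in> Gr E i L})" .
  have "card {\<phi> \<in> prim_homs E d L M. quot (ker_lat \<phi>) L.pM \<in> Gr E i L} =
      (\<Sum>V\<in>Gr E i L. card {\<phi> \<in> prim_homs E d L M. quot (ker_lat \<phi>) L.pM = V})" for i
  proof -
    have "{\<phi> \<in> prim_homs E d L M. quot (ker_lat \<phi>) L.pM \<in> Gr E i L} =
      (\<Union>V\<in>Gr E i L. {\<phi> \<in> prim_homs E d L M. quot (ker_lat \<phi>) L.pM = V})" by blast
    moreover have "card (\<Union>V\<in>Gr E i L. {\<phi> \<in> prim_homs E d L M. quot (ker_lat \<phi>) L.pM = V}) =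
      (\<Sum>V\<in>Gr E i L. card {\<phi> \<in> prim_homs E d L M. quot (ker_lat \<phi>) L.pM = V})"
      by (rule card_UN_disjoint) (use L.finite_Gr[OF basis] fin in auto)
    ultimately show ?thesis by simp
  qed
  then show ?thesis using 1 by simp
qed

end

section \<open>Sums, powers and the hyperbolic plane\<close>

context herm_module
begin

lemma rank_of_basis:
  assumes b: "lat_basis E M n e"
  shows "lat_rank M = n"
proof -
  have inj: "inj_on e {..<n}"
  proof (rule inj_onI)
    fix j l assume jl: "j \<in> {..<n}" "l \<in> {..<n}" "e j = e l"
    have "lc {..<n} (\<lambda>i. if i = j then 1 else 0) e = lc {..<n} (\<lambda>i. if i = l then 1 else 0) e"
      using jl basis_delta[of j n e] basis_delta[of l n e] by simp
    then have "(if j = j then 1 else 0 :: 'f) = (if j = l then 1 else 0)"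
      by (rule basis_unique[OF b]) (use jl in simp)
    then show "j = l" by (simp split: if_splits)
  qed
  have "V.dim (pts M) = card (e ` {..<n})"
  proof (rule V.dim_unique)
    show "e ` {..<n} \<subseteq> pts M" using basis_pts[OF b] by auto
    show "pts M \<subseteq> V.span (e ` {..<n})"
      unfolding basis_pts_eq[OF b] by clarify (intro V.span_sum V.span_scale V.span_base, auto)
    show "\<not> V.dependent (e ` {..<n})"
    proof
      assume "V.dependent (e ` {..<n})"
      then obtain u where u: "\<exists>v\<in>e ` {..<n}. u v \<noteq> 0" "(\<Sum>v\<in>e ` {..<n}. smul M (u v) v) = 0"
        using V.dependent_finite[of "e ` {..<n}"] by auto
      then have "lc {..<n} (\<lambda>l. u (e l)) e = 0" by (simp add: sum.reindex[OF inj])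
      then have "u (e l) = 0" if "l < n" for l by (rule basis_zero[OF b _ that])
      then show False using u(1) by auto
    qed
  qed simp
  then show ?thesis using card_image[OF inj] by (simp add: lat_rank_def)
qed

end

context ramified_ext
begin

lemma lattice_module:
  fixes L :: "('f, 'v::ab_group_add) herm"
  assumes L: "hermitian_lattice E L"
  shows "herm_module p E L"
proof -
  have vs: "vector_space (smul L)" using L by (simp add: hermitian_lattice_def)
  interpret V: vector_space "smul L" by (rule vs)
  obtain B where B: "finite B" "pts L = {\<Sum>b\<in>B. smul L (c b) b | c. \<forall>b\<in>B. c b \<in> pw 0}"
    using L unfolding hermitian_lattice_def ringF_eq by blast
  have B_I: "(\<Sum>b\<in>B. smul L (c b) b) \<in> pts L" if "\<forall>b\<in>B. c b \<in> pw 0" for c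
    unfolding B(2) using that by (intro CollectI exI[of _ c] conjI refl)
  show ?thesis
  proof (rule herm_module.intro[OF ramified_ext_axioms], rule herm_module_axioms.intro)
    show "0 \<in> pts L" using B_I[of "\<lambda>_. 0"] by simp
    show "x + y \<in> pts L" if xy: "x \<in> pts L" "y \<in> pts L" for x y
    proof -
      obtain c c' where "x = (\<Sum>b\<in>B. smul L (c b) b)" "y = (\<Sum>b\<in>B. smul L (c' b) b)"
        "\<forall>b\<in>B. c b \<in> pw 0" "\<forall>b\<in>B. c' b \<in> pw 0" using xy unfolding B(2) by blast
      then show ?thesis using B_I[of "\<lambda>b. c b + c' b"]
        by (simp add: pw_add V.scale_left_distrib sum.distrib)
    qed
    show "smul L a x \<in> pts L" if a: "a \<in> pw 0" and x: "x \<in> pts L" for a x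
    proof -
      obtain c where "x = (\<Sum>b\<in>B. smul L (c b) b)" "\<forall>b\<in>B. c b \<in> pw 0" using x unfolding B(2) by blast
      then show ?thesis using B_I[of "\<lambda>b. a * c b"] pw_mult[OF a, of _ 0]
        by (simp add: V.scale_sum_right)
    qed
    show "vector_space (smul L)" by (rule vs)
    show "form L (x + y) z = form L x z + form L y z" "form L (smul L a x) y = a * form L x y"
      "form L y x = cj (form L x y)" for a x y z
      using L unfolding hermitian_lattice_def by blast+
  qed
qed

lemma lattice_basis:
  fixes L :: "('f, 'v::ab_group_add) herm"
  assumes L: "hermitian_lattice E L"
  shows "\<exists>e. lat_basis E L (lat_rank L) e"
proof -
  interpret herm_module p E L by (rule lattice_module[OF L])
  obtain B where B: "finite B" "\<not> V.dependent B" "pts L = {\<Sum>b\<in>B. smul L (c b) b | c. \<forall>b\<in>B. c b \<in> pw 0}"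
    using L unfolding hermitian_lattice_def ringF_eq by blast
  obtain e where e: "bij_betw e {..<card B} B"
    using ex_bij_betw_nat_finite[OF B(1)] by (auto simp: atLeast0LessThan)
  have re: "(\<Sum>b\<in>B. smul L (c b) b) = lc {..<card B} (\<lambda>l. c (e l)) e" for c
    using sum.reindex_bij_betw[OF e, of "\<lambda>b. smul L (c b) b"] by simp
  define f where "f = inv_into {..<card B} e"
  have f: "f (e l) = l" if "l < card B" for l
    using e that by (simp add: f_def bij_betw_def inv_into_f_f)
  have eB: "e l \<in> B" if "l < card B" for l using bij_betwE[OF e] that by simp
  have fB: "f b < card B" if "b \<in> B" for b
    using inv_into_into[of b e "{..<card B}"] e that by (simp add: f_def bij_betw_def)
  have re': "lc {..<card B} c e = (\<Sum>b\<in>B. smul L (c (f b)) b)" for c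
    unfolding re by (rule sum.cong) (simp_all add: f)
  have b: "lat_basis E L (card B) e" unfolding lat_basis_def ringF_eq
  proof (intro conjI allI impI equalityI subsetI)
    fix y assume "y \<in> pts L"
    then obtain c where "y = lc {..<card B} (\<lambda>l. c (e l)) e" "\<forall>b\<in>B. c b \<in> pw 0"
      unfolding B(3) re by blast
    then show "y \<in> {lc {..<card B} c e | c. \<forall>l<card B. c l \<in> pw 0}"
      using eB by (intro CollectI exI[of _ "\<lambda>l. c (e l)"]) simp
  next
    fix y assume "y \<in> {lc {..<card B} c e | c. \<forall>l<card B. c l \<in> pw 0}"
    then obtain c where "y = (\<Sum>b\<in>B. smul L (c (f b)) b)" "\<forall>l<card B. c l \<in> pw 0" unfolding re' by blast
    then show "y \<in> pts L" unfolding B(3) using fB by (intro CollectI exI[of _ "\<lambda>b. c (f b)"]) simp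
  next
    fix c l assume "lc {..<card B} c e = 0" and l: "l < card B"
    then have "(\<Sum>b\<in>B. smul L (c (f b)) b) = 0" by (simp add: re')
    then have "c (f (e l)) = 0" using V.independentD[OF B(2,1) subset_refl, of "\<lambda>b. c (f b)"] eB[OF l] by blast
    then show "c l = 0" using f[OF l] by simp
  qed
  show ?thesis using b unfolding rank_of_basis[OF b] by blast
qed

lemma gram_module:
  assumes G: "\<And>i j. i < r \<Longrightarrow> j < r \<Longrightarrow> G j i = cj (G i j)"
  shows "herm_module p E (gram_lattice E r G)"
proof unfold_locales
  fix x y z :: "nat \<Rightarrow> 'f" and a b :: 'f
  let ?L = "gram_lattice E r G"
  show "smul ?L a (x + y) = smul ?L a x + smul ?L a y" "smul ?L (a + b) x = smul ?L a x + smul ?L b x"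
    "smul ?L a (smul ?L b x) = smul ?L (a * b) x" "smul ?L 1 x = x"
    by (simp_all add: gram_lattice_def fun_eq_iff algebra_simps)
  show "form ?L (x + y) z = form ?L x z + form ?L y z"
    by (simp add: gram_lattice_def algebra_simps sum.distrib)
  show "form ?L (smul ?L a x) y = a * form ?L x y"
    by (simp add: gram_lattice_def sum_distrib_left mult.assoc)
  have "form ?L y x = (\<Sum>i<r. \<Sum>j<r. y j * G j i * cj (x i))"
    unfolding gram_lattice_def by simp (rule sum.swap)
  also have "\<dots> = (\<Sum>i<r. \<Sum>j<r. cj (x i * G i j * cj (y j)))"
  proof (intro sum.cong refl)
    fix i j assume "i \<in> {..<r}" "j \<in> {..<r}"
    then have "G j i = cj (G i j)" by (intro G) auto
    then show "y j * G j i * cj (x i) = cj (x i * G i j * cj (y j))" by (simp add: cj_mult)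
  qed
  also have "\<dots> = cj (form ?L x y)" by (simp add: gram_lattice_def cj_sum)
  finally show "form ?L y x = cj (form ?L x y)" .
  show "0 \<in> pts ?L" by (simp add: gram_lattice_def ringF_eq)
  show "x + y \<in> pts ?L" if "x \<in> pts ?L" "y \<in> pts ?L"
    using that by (simp add: gram_lattice_def ringF_eq pw_add)
  show "smul ?L a x \<in> pts ?L" if "a \<in> pw 0" "x \<in> pts ?L"
    using that pw_mult[of a 0 _ 0] by (simp add: gram_lattice_def ringF_eq)
qed

lemma gram_basis: "lat_basis E (gram_lattice E r G) r (\<lambda>l i. if i = l then 1 else 0)"
proof -
  let ?e = "\<lambda>l i. if i = l then 1 else 0 :: 'f"
  have eq: "(\<Sum>l<r. smul (gram_lattice E r G) (c l) (?e l)) = (\<lambda>i. if i < r then c i else 0)" for c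
  proof
    fix i
    have "(\<Sum>l<r. smul (gram_lattice E r G) (c l) (?e l)) i = (\<Sum>l<r. if i = l then c l else 0)"
      by (induction r) (auto simp: gram_lattice_def)
    then show "(\<Sum>l<r. smul (gram_lattice E r G) (c l) (?e l)) i = (if i < r then c i else 0)" by simp
  qed
  show ?thesis unfolding lat_basis_def eq
  proof (intro conjI allI impI)
    show "pts (gram_lattice E r G) = {\<lambda>i. if i < r then c i else 0 | c. \<forall>l<r. c l \<in> ringF E}"
    proof (intro equalityI subsetI)
      fix x assume x: "x \<in> pts (gram_lattice E r G)"
      then have "x = (\<lambda>i. if i < r then x i else 0)" by (auto simp: gram_lattice_def)
      then show "x \<in> {\<lambda>i. if i < r then c i else 0 | c. \<forall>l<r. c l \<in> ringF E}"
        using x by (intro CollectI exI[of _ x]) (simp add: gram_lattice_def)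
    qed (auto simp: gram_lattice_def)
    fix c l assume "(\<lambda>i. if i < r then c i else (0::'f)) = 0" "l < r"
    then show "c l = 0" by (simp add: fun_eq_iff) metis
  qed
qed

lemma power_module:
  fixes L :: "('f, 'v::ab_group_add) herm"
  assumes "herm_module p E L"
  shows "herm_module p E (herm_power k L)"
proof -
  interpret L: herm_module p E L by fact
  show ?thesis
  proof unfold_locales
    fix x y z :: "nat \<Rightarrow> 'v" and a b :: 'f
    let ?L = "herm_power k L"
    show "smul ?L a (x + y) = smul ?L a x + smul ?L a y" "smul ?L (a + b) x = smul ?L a x + smul ?L b x"
      "smul ?L a (smul ?L b x) = smul ?L (a * b) x" "smul ?L 1 x = x"
      by (simp_all add: herm_power_def fun_eq_iff L.V.scale_right_distrib L.V.scale_left_distrib)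
    show "form ?L (x + y) z = form ?L x z + form ?L y z"
      by (simp add: herm_power_def L.form_add_left sum.distrib)
    show "form ?L (smul ?L a x) y = a * form ?L x y"
      by (simp add: herm_power_def L.form_smul_left sum_distrib_left)
    show "form ?L y x = cj (form ?L x y)"
      unfolding herm_power_def by (simp add: cj_sum) (rule sum.cong, simp, rule L.form_conj)
    show "0 \<in> pts ?L" by (simp add: herm_power_def L.pts_0)
    show "x + y \<in> pts ?L" if "x \<in> pts ?L" "y \<in> pts ?L"
      using that by (simp add: herm_power_def L.pts_add)
    show "smul ?L a x \<in> pts ?L" if "a \<in> pw 0" "x \<in> pts ?L"
      using that L.pts_smul by (simp add: herm_power_def)
  qed
qed

lemma sum_module:
  fixes I :: "('f, 'v::ab_group_add) herm" and H :: "('f, 'w::ab_group_add) herm"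
  assumes "herm_module p E I" "herm_module p E H"
  shows "herm_module p E (herm_sum I H)"
proof -
  interpret I: herm_module p E I by fact
  interpret H: herm_module p E H by fact
  show ?thesis
  proof unfold_locales
    fix x y z :: "'v \<times> 'w" and a b :: 'f
    let ?L = "herm_sum I H"
    show "smul ?L a (x + y) = smul ?L a x + smul ?L a y" "smul ?L (a + b) x = smul ?L a x + smul ?L b x"
      "smul ?L a (smul ?L b x) = smul ?L (a * b) x" "smul ?L 1 x = x"
      by (simp_all add: herm_sum_def I.V.scale_right_distrib I.V.scale_left_distrib
          H.V.scale_right_distrib H.V.scale_left_distrib)
    show "form ?L (x + y) z = form ?L x z + form ?L y z"
      by (simp add: herm_sum_def I.form_add_left H.form_add_left)
    show "form ?L (smul ?L a x) y = a * form ?L x y"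
      by (simp add: herm_sum_def I.form_smul_left H.form_smul_left algebra_simps)
    show "form ?L y x = cj (form ?L x y)"
      using I.form_conj[of "fst y" "fst x"] H.form_conj[of "snd y" "snd x"]
      by (simp add: herm_sum_def cj_add)
    show "0 \<in> pts ?L" by (simp add: herm_sum_def I.pts_0 H.pts_0 zero_prod_def)
    show "x + y \<in> pts ?L" if "x \<in> pts ?L" "y \<in> pts ?L"
      using that by (auto simp: herm_sum_def I.pts_add H.pts_add)
    show "smul ?L a x \<in> pts ?L" if "a \<in> pw 0" "x \<in> pts ?L"
      using that I.pts_smul H.pts_smul by (auto simp: herm_sum_def)
  qed
qed

lemma scaled_sum: "scaled a (herm_sum I H) = scaled a I \<times> scaled a H"
  by (auto simp: scaled_def herm_sum_def image_iff)

lemma sum_split_module: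
  fixes I :: "('f, 'v::ab_group_add) herm" and H :: "('f, 'w::ab_group_add) herm"
  assumes I: "herm_module p E I" and H: "herm_module p E H"
    and fI: "\<And>x y. x \<in> pts I \<Longrightarrow> y \<in> pts I \<Longrightarrow> form I x y \<in> pw 0"
    and mI: "\<And>x. x \<in> pts I \<Longrightarrow> x \<notin> scaled \<pi> I \<Longrightarrow> \<exists>y\<in>pts I. form I y x = 1"
    and fH: "\<And>x y. x \<in> pts H \<Longrightarrow> y \<in> pts H \<Longrightarrow> form H x y \<in> pw (- 1)"
    and mH: "\<And>x. x \<in> pts H \<Longrightarrow> x \<notin> scaled \<pi> H \<Longrightarrow> \<exists>y\<in>pts H. form H y x = inverse \<pi>"
    and cI: "card (quot (pts I) (scaled \<pi> I)) = q ^ m"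
    and cH: "card (quot (pts H) (scaled \<pi> H)) = q ^ h"
  shows "split_module p E (herm_sum I H) (\<lambda>z. (fst z, 0)) m h"
proof -
  interpret I: herm_module p E I by fact
  interpret H: herm_module p E H by fact
  interpret S: herm_module p E "herm_sum I H" by (rule sum_module[OF I H])
  let ?L = "herm_sum I H"
  let ?P = "\<lambda>z :: 'v \<times> 'w. (fst z, 0 :: 'w)"
  have pts: "z \<in> pts ?L \<longleftrightarrow> fst z \<in> pts I \<and> snd z \<in> pts H" for z by (auto simp: herm_sum_def mem_Times_iff)
  have form: "form ?L z w = form I (fst z) (fst w) + form H (snd z) (snd w)" for z w
    by (simp add: herm_sum_def)
  have smul: "smul ?L a z = (smul I a (fst z), smul H a (snd z))" for a z by (simp add: herm_sum_def)
  have I0: "0 \<in> scaled \<pi> I" and H0: "0 \<in> scaled \<pi> H" using subgrp_0 I.subgrp_pM H.subgrp_pM by auto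
  show ?thesis
  proof unfold_locales
    fix x y :: "'v \<times> 'w" and a :: 'f
    show "?P (x + y) = ?P x + ?P y" "?P (smul ?L a x) = smul ?L a (?P x)" "?P (?P x) = ?P x"
      by (simp_all add: smul)
    show "?P x \<in> pts ?L" if "x \<in> pts ?L" using that by (simp add: pts H.pts_0)
    show "form ?L (?P x) (y - ?P y) = 0" by (simp add: form)
    show "form ?L (?P x) (?P y) \<in> pw 0" if "x \<in> pts ?L" "y \<in> pts ?L"
      using that fI by (simp add: form pts)
    show "form ?L x y \<in> pw (- 1)" if "x \<in> pts ?L" "y \<in> pts ?L"
      unfolding form using that by (intro pw_add pw_mono[OF fI] fH) (auto simp: pts)
    show "\<exists>y\<in>pts ?L. form ?L (?P y) (?P x) = 1" if x: "x \<in> pts ?L" "?P x \<notin> scaled \<pi> ?L"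
    proof -
      obtain y where "y \<in> pts I" "form I y (fst x) = 1"
        using mI[of "fst x"] x by (auto simp: pts scaled_sum H0)
      then show ?thesis by (intro bexI[of _ "(y, 0)"]) (simp_all add: pts form H.pts_0)
    qed
    show "\<exists>y\<in>pts ?L. form ?L (y - ?P y) (x - ?P x) = inverse \<pi>" if x: "x \<in> pts ?L" "x - ?P x \<notin> scaled \<pi> ?L"
    proof -
      have "x - ?P x = (0, snd x)" by (simp add: prod_eq_iff)
      then obtain y where "y \<in> pts H" "form H y (snd x) = inverse \<pi>"
        using mH[of "snd x"] x by (auto simp: pts scaled_sum I0)
      then show ?thesis by (intro bexI[of _ "(0, y)"]) (simp_all add: pts form I.pts_0)
    qed
  next
    have "{x \<in> pts ?L. ?P x = x} = pts I \<times> {0}" "{x \<in> pts ?L. ?P x = x} \<inter> scaled \<pi> ?L = scaled \<pi> I \<times> {0}"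
      using H.pts_0 H0 I.pM_subset_pts by (auto simp: pts scaled_sum prod_eq_iff)
    moreover have "subgrp {0 :: 'w}" by (simp add: subgrp_def)
    ultimately show "card (quot {x \<in> pts ?L. ?P x = x} ({x \<in> pts ?L. ?P x = x} \<inter> scaled \<pi> ?L)) = q ^ m"
      using card_quot_Times[OF I.subgrp_pM, of "{0 :: 'w}" "pts I" "{0}"] card_quot_self[of "{0 :: 'w}"] cI by simp
  next
    have "{x \<in> pts ?L. ?P x = 0} = {0} \<times> pts H" "{x \<in> pts ?L. ?P x = 0} \<inter> scaled \<pi> ?L = {0} \<times> scaled \<pi> H"
      using I.pts_0 I0 H.pM_subset_pts by (auto simp: pts scaled_sum prod_eq_iff)
    moreover have "subgrp {0 :: 'v}" by (simp add: subgrp_def)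
    ultimately show "card (quot {x \<in> pts ?L. ?P x = 0} ({x \<in> pts ?L. ?P x = 0} \<inter> scaled \<pi> ?L)) = q ^ h"
      using card_quot_Times[OF _ H.subgrp_pM, of "{0 :: 'v}" "{0}" "pts H"] card_quot_self[of "{0 :: 'v}"] cH by simp
  qed
qed

lemma zero_split_module:
  fixes H :: "('f, 'w::ab_group_add) herm"
  assumes H: "herm_module p E H"
    and fH: "\<And>x y. x \<in> pts H \<Longrightarrow> y \<in> pts H \<Longrightarrow> form H x y \<in> pw (- 1)"
    and mH: "\<And>x. x \<in> pts H \<Longrightarrow> x \<notin> scaled \<pi> H \<Longrightarrow> \<exists>y\<in>pts H. form H y x = inverse \<pi>"
    and cH: "card (quot (pts H) (scaled \<pi> H)) = q ^ h"
  shows "split_module p E H (\<lambda>_. 0) 0 h"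
proof -
  interpret H: herm_module p E H by fact
  have 0: "0 \<in> scaled \<pi> H" using subgrp_0 H.subgrp_pM by auto
  show ?thesis
  proof unfold_locales
    have "{x \<in> pts H. 0 = x} = {0}" "{x \<in> pts H. 0 = x} \<inter> scaled \<pi> H = {0}" using H.pts_0 0 by auto
    then show "card (quot {x \<in> pts H. 0 = x} ({x \<in> pts H. 0 = x} \<inter> scaled \<pi> H)) = q ^ 0"
      by (simp only:) (simp add: card_quot_self subgrp_def)
    have "{x \<in> pts H. (0::'w) = 0} = pts H" "pts H \<inter> scaled \<pi> H = scaled \<pi> H" using H.pM_subset_pts by auto
    then show "card (quot {x \<in> pts H. (0::'w) = 0} ({x \<in> pts H. (0::'w) = 0} \<inter> scaled \<pi> H)) = q ^ h"
      using cH by (simp only:)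
  qed (use fH mH 0 H.pts_0 in auto)
qed

lemma unimodular_integral:
  fixes I :: "('f, 'v::ab_group_add) herm"
  assumes "unimodular E I" "x \<in> pts I" "y \<in> pts I"
  shows "form I x y \<in> pw 0"
  using assms unfolding unimodular_def dual_lattice_def ringF_eq by blast

text \<open>If all values (x, y) were divisible by \<pi>, then x / \<pi> would lie in the dual
  lattice, which is \<open>I\<close>, and x in \<pi>I. So some value is a unit and can be scaled to
  1.\<close>

lemma unimodular_modular:
  fixes I :: "('f, 'v::ab_group_add) herm"
  assumes I: "herm_module p E I" and u: "unimodular E I" and x: "x \<in> pts I" "x \<notin> scaled \<pi> I"
  shows "\<exists>y\<in>pts I. form I y x = 1"
proof -
  interpret I: herm_module p E I by fact
  have "\<exists>y\<in>pts I. form I x y \<notin> pw 1"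
  proof (rule ccontr)
    assume "\<not> ?thesis"
    then have "form I (smul I (inverse \<pi>) x) y \<in> pw 0" if "y \<in> pts I" for y
      using that pw_mult_iff[of "inverse \<pi>" "form I x y" 0] by (simp add: I.form_smul_left val_inverse val_pi)
    moreover have "smul I (inverse \<pi>) x \<in> I.V.span (pts I)"
      using x(1) by (intro I.V.span_scale I.V.span_base)
    ultimately have "smul I (inverse \<pi>) x \<in> dual_lattice E I" by (simp add: dual_lattice_def ringF_eq)
    then have "smul I (inverse \<pi>) x \<in> pts I" using u by (simp add: unimodular_def)
    then show False using x(2) I.mem_scaled[of \<pi> x] by simp
  qed
  then obtain y where y: "y \<in> pts I" "form I x y \<notin> pw 1" by blast
  then have "form I y x \<notin> pw 1" "form I y x \<in> pw 0"
    using I.form_conj[of y x] unimodular_integral[OF u y(1) x(1)] by (simp_all add: cj_pw)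
  then have "form I y x \<noteq> 0" "inverse (form I y x) \<in> pw 0" using pw_nonunit by auto
  then show ?thesis using y(1)
    by (intro bexI[of _ "smul I (inverse (form I y x)) y"]) (simp_all add: I.form_smul_left I.pts_smul)
qed

lemma plane_module: "herm_module p E (hyp_plane E)"
  unfolding hyp_plane_def by (rule gram_module) (auto simp: cj_0 cj_inverse cj_pi cj_uminus)

lemma hyp_module: "herm_module p E (hyp_power E k)"
  by (rule power_module[OF plane_module])

lemma plane_form: "form (hyp_plane E) x y = inverse \<pi> * (x 0 * cj (y 1) - x 1 * cj (y 0))"
  by (simp add: hyp_plane_def gram_lattice_def numeral_2_eq_2 algebra_simps)

lemma hyp_form: "form (hyp_power E k) x y =
    (\<Sum>j<k. inverse \<pi> * (x j 0 * cj (y j 1) - x j 1 * cj (y j 0)))"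
  by (simp add: herm_power_def plane_form)

lemma hyp_pts: "pts (hyp_power E k) = FS {..<k} (\<lambda>_. FS {..<2} (\<lambda>_. pw 0))"
  by (auto simp: herm_power_def hyp_plane_def gram_lattice_def FS_def ringF_eq)

lemma hyp_smul: "smul (hyp_power E k) a x j i = a * x j i"
  by (simp add: herm_power_def hyp_plane_def gram_lattice_def)

lemma hyp_scaled: "scaled \<pi> (hyp_power E k) = FS {..<k} (\<lambda>_. FS {..<2} (\<lambda>_. pw 1))"
proof -
  interpret H: herm_module p E "hyp_power E k" by (rule hyp_module)
  have "inverse \<pi> * a \<in> pw 0 \<longleftrightarrow> a \<in> pw 1" for a
    using pw_mult_iff[of "inverse \<pi>" a 0] by (simp add: val_inverse val_pi)
  then have "x \<in> scaled \<pi> (hyp_power E k) \<longleftrightarrow> x \<in> FS {..<k} (\<lambda>_. FS {..<2} (\<lambda>_. pw 1))" for x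
    unfolding H.mem_scaled[OF pi_nz] hyp_pts by (simp add: FS_def hyp_smul fun_eq_iff)
  then show ?thesis by blast
qed

lemma hyp_card: "card (quot (pts (hyp_power E k)) (scaled \<pi> (hyp_power E k))) = q ^ (2 * k)"
  unfolding hyp_pts hyp_scaled using card_quot_pw[of 0]
  by (subst card_quot_FS, simp, intro subgrp_FS subgrp_pw) (subst card_quot_FS, simp_all add: subgrp_pw power_mult)

lemma hyp_integral: "x \<in> pts (hyp_power E k) \<Longrightarrow> y \<in> pts (hyp_power E k) \<Longrightarrow> form (hyp_power E k) x y \<in> pw (- 1)"
proof -
  assume x: "x \<in> pts (hyp_power E k)" and y: "y \<in> pts (hyp_power E k)"
  have "x j i \<in> pw 0" "y j i \<in> pw 0" if "j < k" "i < 2" for i j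
    using x y that unfolding hyp_pts by (auto simp: FS_def)
  then show ?thesis unfolding hyp_form
    by (intro pw_sum pw_mult_le[of _ "- 1" _ 0] pi_inverse_pw pw_diff pw_mult_le[of _ 0 _ 0]) (auto simp: cj_pw)
qed

lemma hyp_modular:
  assumes x: "x \<in> pts (hyp_power E k)" "x \<notin> scaled \<pi> (hyp_power E k)"
  shows "\<exists>y\<in>pts (hyp_power E k). form (hyp_power E k) y x = inverse \<pi>"
proof -
  obtain j i where ji: "j < k" "i < 2" "x j i \<notin> pw 1" "x j i \<in> pw 0"
    using x unfolding hyp_pts hyp_scaled by (auto simp: FS_def)
  define u where "u = inverse (cj (x j i))"
  have u: "u \<in> pw 0" "u * cj (x j i) = 1"
    using pw_nonunit[of "cj (x j i)"] ji by (auto simp: u_def cj_pw)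
  \<comment> \<open>Supported on the coordinate paired with \<open>x j i\<close>, namely 1 - i in
    the same plane; the sign undoes that of the Gram matrix.\<close>
  define y where "y j' i' = (if j' = j \<and> i' = 1 - i then if i = 1 then u else - u else 0)" for j' i' :: nat
  have "y \<in> pts (hyp_power E k)" unfolding hyp_pts y_def using ji u by (auto simp: FS_def fun_eq_iff)
  moreover have "form (hyp_power E k) y x = (\<Sum>j'<k. if j' = j then inverse \<pi> else 0)"
    unfolding hyp_form
  proof (rule sum.cong)
    fix j' assume "j' \<in> {..<k}"
    have "i = 0 \<or> i = 1" using ji by auto
    then show "inverse \<pi> * (y j' 0 * cj (x j' 1) - y j' 1 * cj (x j' 0)) = (if j' = j then inverse \<pi> else 0)"
      using u(2) by (auto simp: y_def)
  qed simp
  ultimately show ?thesis using ji(1) by (intro bexI[of _ y]) auto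
qed

lemmas hyp_split = zero_split_module[OF hyp_module hyp_integral hyp_modular hyp_card]

end

section \<open>Densities\<close>

context ramified_ext
begin

text \<open>The normalised number of isotropic r-frames in dimension h. For h = 2k it is the density
  of a null lattice of rank r in \<open>H\<^sup>k\<close>, by \<open>null_density\<close>.\<close>

definition isotropic_factor :: "nat \<Rightarrow> nat \<Rightarrow> real" where
  "isotropic_factor r h = (\<Prod>s<r. 1 - real q ^ (2 * s) / real q ^ h)"

lemma q_pos: "real q > 0"
  using q_gt_1 by simp

lemma prod_isotropic_factor:
  "(\<Prod>s<r. real q ^ h / real q ^ s - real q ^ s) * real q ^ (\<Sum>s<r. s) = isotropic_factor r h * real q ^ (h * r)"
proof -
  have "(\<Prod>s<r. real q ^ h / real q ^ s - real q ^ s) * real q ^ (\<Sum>s<r. s) =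
    (\<Prod>s<r. (real q ^ h / real q ^ s - real q ^ s) * real q ^ s)"
    by (simp add: prod.distrib power_sum)
  also have "\<dots> = (\<Prod>s<r. (1 - real q ^ (2 * s) / real q ^ h) * real q ^ h)"
  proof (rule prod.cong)
    fix s
    show "(real q ^ h / real q ^ s - real q ^ s) * real q ^ s = (1 - real q ^ (2 * s) / real q ^ h) * real q ^ h"
      unfolding mult_2 power_add using q_pos by (simp add: field_simps)
  qed simp
  finally show ?thesis by (simp add: prod.distrib isotropic_factor_def power_mult)
qed

end

text \<open>With r = n - i this is r(r-1)/2 + r(r+1)/2 = r^2: the power of q that normalises
  isotropic frames and the number of Gram conditions in the last block combine to a square.\<close>

lemma sum_lessThan_card_upper: "i \<le> n \<Longrightarrow> (\<Sum>s<n - i. s) + card (upper_pairs i n) = (n - i)\<^sup>2"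
proof -
  assume i: "i \<le> n"
  have "2 * (\<Sum>s<r. s) + r = r * r" for r :: nat by (induction r) auto
  from this[of "n - i"] card_upper_pairs[OF i] show ?thesis
    by (simp add: power2_eq_square algebra_simps)
qed

context split_module
begin

text \<open>The right-hand side is free of d: n^2 d from the normalisation meets n^2 (d - 1) from
  lifting, and 2d (m + h) n meets the number of all n-tuples modulo
  \<open>\<pi>\<^sub>0\<^sup>d\<close>.\<close>

lemma density_gram_frames:
  assumes i: "i \<le> n" and T: "\<And>j l. j < n \<Longrightarrow> l < n \<Longrightarrow> T j l \<in> pw 0"
    and Tb: "\<And>j. j < n \<Longrightarrow> T j j \<in> base E" and d: "1 \<le> d"
  shows "real q powi (- (int d * int n * (2 * int (m + h) - int n))) *
      real (card (quot (gram_frames i n T (2 * int d - 1) (2 * int d - 1) (2 * int d - 1)) (KM n (2 * d)))) =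
    real (card (quot (P_frames i T) (KP i))) * real q ^ i\<^sup>2 / real q ^ (m * i) / real q ^ (h * i) *
      real q ^ ((n - i) * i) * isotropic_factor (n - i) h"
proof -
  define r where "r = n - i"
  have n: "n = i + r" using i by (simp add: r_def)
  define U where "U = card (upper_pairs i n)"
  define S where "S = (\<Sum>s<r. s)"
  have SU: "S + U = r\<^sup>2" using sum_lessThan_card_upper[OF i] by (simp add: S_def U_def r_def)
  define c where "c = real q"
  have c: "c > 0" using q_pos by (simp add: c_def)
  define N where "N = real (card (quot (gram_frames i n T (2 * int d - 1) (2 * int d - 1) (2 * int d - 1)) (KM n (2 * d))))"
  define F where "F = real (card (quot (P_frames i T) (KP i)))"
  define G where "G = real (card (quot (Q_frames {i..<n}) (KQ {i..<n})))"
  define b where "b = 2 * d * (m + h) * n"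
  define a where "a = i * r + U + n\<^sup>2 * (d - 1) + (m + h) * i + h * r"
  have "N * c ^ a = F * G * c ^ b"
    using arg_cong[OF card_gram_frames[where T = T, OF i T Tb d], of real]
    by (simp only: N_def F_def G_def b_def a_def U_def c_def r_def of_nat_mult of_nat_power)
  then have N: "N = F * G * c ^ b / c ^ a" using c by (simp add: field_simps)
  have "G * c ^ S = isotropic_factor r h * c ^ (h * r)"
    using card_Q_frames[of "{i..<n}"] prod_isotropic_factor[of h r] by (simp add: G_def c_def S_def r_def)
  then have G: "G = isotropic_factor r h * c ^ (h * r) / c ^ S" using c by (simp add: field_simps)
  have eq: "- (int d * int n * (2 * int (m + h) - int n)) = int (d * n\<^sup>2) - int b"
    by (simp add: b_def power2_eq_square algebra_simps)
  have "c powi (int (d * n\<^sup>2) - int b) = c powi int (d * n\<^sup>2) / c powi int b"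
    by (rule power_int_diff) (use c in simp)
  then have pre: "c powi (- (int d * int n * (2 * int (m + h) - int n))) = c ^ (d * n\<^sup>2) / c ^ b"
    by (simp only: eq power_int_of_nat)
  have dn: "d * n\<^sup>2 = n\<^sup>2 * (d - 1) + n\<^sup>2" using d by (cases d) auto
  \<comment> \<open>The comparison of all exponents of q; \<open>SU\<close> supplies the quadratic
    contribution of the last block.\<close>
  have "d * n\<^sup>2 + h * r + (m * i + h * i) = i\<^sup>2 + r * i + (S + a)"
    unfolding a_def dn using SU by (simp add: n power2_eq_square algebra_simps)
  then have ex: "c ^ (d * n\<^sup>2) * c ^ (h * r) * (c ^ (m * i) * c ^ (h * i)) = c ^ i\<^sup>2 * c ^ (r * i) * (c ^ S * c ^ a)"
    by (simp only: power_add[symmetric])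
  have "c ^ (d * n\<^sup>2) / c ^ b * N = F * isotropic_factor r h * ((c ^ (d * n\<^sup>2) * c ^ (h * r)) / (c ^ S * c ^ a))"
    unfolding N G using c by simp
  also have "(c ^ (d * n\<^sup>2) * c ^ (h * r)) / (c ^ S * c ^ a) = c ^ i\<^sup>2 * c ^ (r * i) / (c ^ (m * i) * c ^ (h * i))"
    using ex c by (simp add: frac_eq_eq)
  finally have "c ^ (d * n\<^sup>2) / c ^ b * N =
      F * isotropic_factor r h * (c ^ i\<^sup>2 * c ^ (r * i) / (c ^ (m * i) * c ^ (h * i)))" .
  then show ?thesis
    unfolding c_def[symmetric] pre N_def[symmetric] F_def[symmetric] r_def[symmetric] by simp
qed

end

section \<open>From frame counts to local densities\<close>

locale herm_pair = ramified_ext p E + M: split_module p E M P m h + L: herm_module p E L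
  for p and E :: "'f::field_char_0 quad_ext" and M :: "('f, 'm::ab_group_add) herm"
    and P m h and L :: "('f, 'l::ab_group_add) herm" +
  fixes n :: nat
  assumes rank_M: "lat_rank M = m + h" and rank_L: "lat_rank L = n"
    and integral: "\<And>x y. x \<in> pts L \<Longrightarrow> y \<in> pts L \<Longrightarrow> form L x y \<in> pw 0"
begin

text \<open>The contribution of the unimodular part. Its powers of q are those of the case d = 1
  with that part alone as target: a residual frame has q^(m i) lifts modulo
  \<open>\<pi>\<^sub>0\<close>, against the normalisation q^(i (2m - i)).\<close>

definition "local_factor i e = real (card (quot (M.P_frames i (\<lambda>j l. form L (e j) (e l))) (M.KP i))) *
  real q ^ i\<^sup>2 / real q ^ (m * i)"

lemma hom_locale: "lat_basis E L n e \<Longrightarrow> 1 \<le> d \<Longrightarrow> herm_hom p E M P m h L n e d"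
  by unfold_locales

lemma density_frames:
  assumes e: "lat_basis E L n e" and i: "i \<le> n" and d: "1 \<le> d"
  shows "real q powi (- (int d * int n * (2 * int (m + h) - int n))) *
      real (card (quot (M.gram_frames i n (\<lambda>j l. form L (e j) (e l)) (2 * int d - 1) (2 * int d - 1) (2 * int d - 1)) (M.KM n (2 * d)))) =
    local_factor i e / real q ^ (h * i) * real q ^ ((n - i) * i) * isotropic_factor (n - i) h"
  unfolding local_factor_def
  by (rule M.density_gram_frames[OF i _ _ d]) (use integral L.form_diag_base L.basis_pts[OF e] in auto)

lemma prim_seq_sum:
  assumes d: "1 \<le> d" and e0: "lat_basis E L n e0"
    and e: "\<And>i V. i \<le> n \<Longrightarrow> V \<in> Gr E i L \<Longrightarrow> lat_basis E L n (e i V) \<and>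
      V = {coset L.pM (L.lc {..<i} c (e i V)) | c. \<forall>l<i. c l \<in> pw 0}"
  shows "prim_seq E M L d = (\<Sum>i\<le>n. \<Sum>V\<in>Gr E i L.
    local_factor i (e i V) / real q ^ (h * i) * real q ^ ((n - i) * i) * isotropic_factor (n - i) h)"
proof -
  interpret h0: herm_hom p E M P m h L n e0 d by (rule hom_locale[OF e0 d])
  let ?c = "real q powi (- (int d * int n * (2 * int (m + h) - int n)))"
  have "?c * real (card {\<phi> \<in> prim_homs E d L M. quot (h0.ker_lat \<phi>) L.pM = V}) =
      local_factor i (e i V) / real q ^ (h * i) * real q ^ ((n - i) * i) * isotropic_factor (n - i) h"
    if i: "i \<le> n" and V: "V \<in> Gr E i L" for i V
  proof -
    have b: "lat_basis E L n (e i V)" using e[OF i V] by blast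
    interpret h: herm_hom p E M P m h L n "e i V" d by (rule hom_locale[OF b d])
    \<comment> \<open>As \<open>ker_lat\<close> does not involve the basis, the count in a basis
      adapted to \<open>V\<close> applies to the stratum defined with \<open>e0\<close>.\<close>
    have "card {\<phi> \<in> prim_homs E d L M. quot (h0.ker_lat \<phi>) L.pM = V} = card (quot (M.gram_frames i n
        (\<lambda>j l. form L (e i V j) (e i V l)) (2 * int d - 1) (2 * int d - 1) (2 * int d - 1)) (M.KM n (2 * d)))"
      using e[OF i V] by (intro h.card_prim_ker[OF rank_L i]) blast
    then show ?thesis using density_frames[OF b i d] by simp
  qed
  then have "?c * real (card (prim_homs E d L M)) = (\<Sum>i\<le>n. \<Sum>V\<in>Gr E i L.
    local_factor i (e i V) / real q ^ (h * i) * real q ^ ((n - i) * i) * isotropic_factor (n - i) h)"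
    unfolding h0.card_prim_homs_sum of_nat_sum sum_distrib_left by (intro sum.cong refl) auto
  then show ?thesis by (simp add: prim_seq_def rank_M rank_L)
qed

text \<open>For the situations in which only one kernel dimension is possible: i = n when there is
  no \<open>Q\<close>-part, i = 0 when there is no \<open>P\<close>-part.\<close>

lemma prim_seq_degenerate:
  assumes e: "lat_basis E L n e" and i: "i \<le> n" and d: "1 \<le> d"
    and deg: "\<And>x. (\<And>l. l < n \<Longrightarrow> x l \<in> pts M) \<Longrightarrow> M.rind {..<n} x \<Longrightarrow>
      (\<forall>l<i. M.Q (x l) \<in> M.pM) \<and> M.rind {i..<n} (\<lambda>l. M.Q (x l))"
  shows "prim_seq E M L d = local_factor i e / real q ^ (h * i) * real q ^ ((n - i) * i) * isotropic_factor (n - i) h"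
proof -
  interpret h: herm_hom p E M P m h L n e d by (rule hom_locale[OF e d])
  have "prim_homs E d L M = {\<phi> \<in> herm_homs E d L M. \<phi> \<in> prim_homs E d L M}" by (auto simp: prim_homs_def)
  then have "card (prim_homs E d L M) = card (quot {x \<in> h.gram_tuples. M.rind {..<n} x} h.K)"
    using h.card_homs_filter[of "\<lambda>\<phi>. \<phi> \<in> prim_homs E d L M" "M.rind {..<n}"] h.prim_homs_iff[OF _ _ rank_L] by simp
  also have "{x \<in> h.gram_tuples. M.rind {..<n} x} =
    {x \<in> h.gram_tuples. M.rind {..<n} x \<and> (\<forall>l<i. M.Q (x l) \<in> M.pM) \<and> M.rind {i..<n} (\<lambda>l. M.Q (x l))}"
  proof (intro Collect_cong)
    fix x
    have "x l \<in> pts M" if "x \<in> h.gram_tuples" "l < n" for l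
      using that by (auto simp: h.gram_tuples_def dest: FS_D)
    then show "x \<in> h.gram_tuples \<and> M.rind {..<n} x \<longleftrightarrow> x \<in> h.gram_tuples \<and> M.rind {..<n} x \<and>
        (\<forall>l<i. M.Q (x l) \<in> M.pM) \<and> M.rind {i..<n} (\<lambda>l. M.Q (x l))"
      using deg[of x] by blast
  qed
  also note h.gram_tuples_frames[OF i]
  finally show ?thesis
    using density_frames[OF e i d] by (simp add: prim_seq_def rank_M rank_L)
qed

end

context herm_module
begin

lemma Gr_basis:
  assumes b: "lat_basis E M n e0" and V: "V \<in> Gr E i M"
  shows "\<exists>e. lat_basis E M n e \<and> V = {coset pM (lc {..<i} c e) | c. \<forall>l<i. c l \<in> pw 0}"
proof -
  obtain x where x: "\<forall>l<i. x l \<in> pts M" "rind {..<i} x" "V = {coset pM (lc {..<i} c x) | c. \<forall>l<i. c l \<in> pw 0}"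
    using V unfolding Gr_def has_residue_dim_iff by blast
  obtain e where e: "lat_basis E M n e" "\<forall>l<i. e l = x l" using basis_extension[OF b _ x(2)] x(1) by blast
  have "lc {..<i} c e = lc {..<i} c x" for c using e(2) by simp
  then show ?thesis using e(1) x(3) by (intro exI[of _ e]) simp
qed

text \<open>A basis of the sublattice \<open>N\<close> stays independent modulo \<pi>, because its
  span there is \<open>V\<close> with q^i elements; hence it extends to a basis of the whole
  lattice. One basis then serves both \<open>V\<close> and \<open>N\<close>.\<close>

lemma lift_basis:
  assumes b: "lat_basis E M n e0" and V: "V \<in> Gr E i M" and N: "is_lift E i M V N"
  shows "\<exists>e. lat_basis E M n e \<and> V = {coset pM (lc {..<i} c e) | c. \<forall>l<i. c l \<in> pw 0} \<and>
    lat_basis E (M\<lparr>pts := N\<rparr>) i e"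
proof -
  have NM: "N \<subseteq> pts M" "hermitian_lattice E (M\<lparr>pts := N\<rparr>)" "lat_rank (M\<lparr>pts := N\<rparr>) = i"
    "quot N pM = V" using N by (simp_all add: is_lift_def)
  obtain x where x: "lat_basis E (M\<lparr>pts := N\<rparr>) i x" using lattice_basis[OF NM(2)] NM(3) by auto
  interpret N: herm_module p E "M\<lparr>pts := N\<rparr>" by (rule lattice_module[OF NM(2)])
  have xN: "x l \<in> N" if "l < i" for l using N.basis_pts[OF x that] by simp
  have "N = {lc {..<i} c x | c. \<forall>l<i. c l \<in> pw 0}" using N.basis_pts_eq[OF x] by simp
  then have Vx: "V = {coset pM (lc {..<i} c x) | c. \<forall>l<i. c l \<in> pw 0}"
    using NM(4) by (auto simp: quot_def)
  have "card V = q ^ i" using V card_of_residue_dim by (simp add: Gr_def)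
  then have "rind {..<i} x" unfolding Vx using xN NM(1) by (intro rind_of_card) auto
  then obtain e where e: "lat_basis E M n e" "\<forall>l<i. e l = x l"
    using basis_extension[OF b] xN NM(1) by blast
  have lc: "lc {..<i} c e = lc {..<i} c x" for c using e(2) by simp
  have "lat_basis E (M\<lparr>pts := N\<rparr>) i e" using x lc unfolding lat_basis_def by simp
  then show ?thesis using e(1) Vx lc by (intro exI[of _ e]) simp
qed

end

section \<open>Rational polynomials interpolating at the points q^(-2k)\<close>

lemma poly_map_of_rat: "poly (map_poly of_rat P) (of_rat x :: real) = of_rat (poly P x)"
proof (induction P)
  case (pCons a P)
  then show ?case by (simp add: map_poly_pCons of_rat_add of_rat_mult)
qed simp

context ramified_ext
begin

text \<open>The interpolation point q^(-2k), kept rational because the polynomials are rational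
  while the limits defining them are real.\<close>

definition "node k = 1 / (of_nat q :: rat) ^ (2 * k)"

lemma powi_node: "real q powi (- 2 * int k) = of_rat (node k)"
proof -
  have "- 2 * int k = - int (2 * k)" by simp
  then show ?thesis
    by (simp only: power_int_minus power_int_of_nat) (simp add: node_def of_rat_divide of_rat_power of_rat_inverse divide_inverse)
qed

lemma poly_node: "poly (map_poly of_rat P) (real q powi (- 2 * int k)) = of_rat (poly P (node k))"
  unfolding powi_node by (rule poly_map_of_rat)

lemma inj_node: "inj node"
proof (rule injI)
  fix k l assume "node k = node l"
  then have "(of_nat q :: rat) ^ (2 * k) = of_nat q ^ (2 * l)" by (simp add: node_def)
  then have "q ^ (2 * k) = q ^ (2 * l)" by (metis of_nat_eq_iff of_nat_power)
  then show "k = l" using q_gt_1 by (simp add: power_inject_exp)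
qed

lemma poly_eq_nodes:
  assumes "\<And>k. poly P (node k) = poly P' (node k)"
  shows "P = P'"
proof (rule ccontr)
  assume "P \<noteq> P'"
  then have "finite {x. poly (P - P') x = 0}" by (intro poly_roots_finite) simp
  moreover have "range node \<subseteq> {x. poly (P - P') x = 0}" using assms by auto
  ultimately have "finite (range node)" by (rule finite_subset[rotated])
  then show False using inj_node finite_imageD by (metis infinite_UNIV_nat)
qed

text \<open>In the variable X = q^(-2k), each factor of \<open>isotropic_factor r (2 * k)\<close>
  becomes linear.\<close>

definition "iso_poly r = (\<Prod>s<r. [:1, - (of_nat q ^ (2 * s)):] :: rat poly)"

lemma poly_iso: "of_rat (poly (iso_poly r) (node k)) = isotropic_factor r (2 * k)"
proof -
  have "poly (iso_poly r) (node k) = (\<Prod>s<r. 1 - of_nat q ^ (2 * s) / of_nat q ^ (2 * k))"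
    unfolding iso_poly_def poly_prod by (rule prod.cong) (simp_all add: node_def)
  moreover have "of_rat (\<Prod>s<r. 1 - of_nat q ^ (2 * s) / of_nat q ^ (2 * k)) = isotropic_factor r (2 * k)"
    unfolding isotropic_factor_def by (induction r) (simp_all add: of_rat_mult of_rat_diff of_rat_divide of_rat_power)
  ultimately show ?thesis by simp
qed

end

text \<open>Counted inside \<open>I\<close> alone, so that independence of k is visible. Conjugation
  acts trivially on the residue field, so the form of a unimodular lattice becomes symmetric modulo
  \<pi>, whence the name.\<close>

definition sym_count :: "'f::field quad_ext \<Rightarrow> ('f, 'v::ab_group_add) herm \<Rightarrow> nat \<Rightarrow> (nat \<Rightarrow> nat \<Rightarrow> 'f) \<Rightarrow> nat" where
  "sym_count E I i T = card (quot {a \<in> FS {..<i} (\<lambda>_. pts I). residue_indep E I {..<i} a \<and>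
     (\<forall>(j, l)\<in>upper_pairs 0 i. form I (a j) (a l) - T j l \<in> val_ideal UNIV (val E) 1)}
     (FS {..<i} (\<lambda>_. scaled (unif E) I)))"

locale sum_pair = ramified_ext p E + I: herm_module p E I + H: herm_module p E H +
    S: split_module p E "herm_sum I H" "\<lambda>z. (fst z, 0)" m h
  for p and E :: "'f::field_char_0 quad_ext" and I :: "('f, 'v::ab_group_add) herm"
    and H :: "('f, 'w::ab_group_add) herm" and m h
begin

lemma MP_iff: "z \<in> S.MP \<longleftrightarrow> fst z \<in> pts I \<and> snd z = 0"
  unfolding S.MP_def using H.pts_0 by (auto simp: herm_sum_def prod_eq_iff mem_Times_iff)

lemma sum_fst: "S.lc J c (\<lambda>j. (a j, 0)) = (I.lc J c a, 0)"
  by (simp add: prod_eq_iff fst_sum snd_sum herm_sum_def)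

lemma mem_pM: "(x, 0) \<in> S.pM \<longleftrightarrow> x \<in> I.pM"
  using subgrp_0[OF H.subgrp_pM] by (simp add: scaled_sum)

lemma card_P_frames: "card (quot (S.P_frames i T) (S.KP i)) = sym_count E I i T"
  unfolding sym_count_def
proof (rule card_quot_eqI[where f = "\<lambda>a j. (a j, 0)", symmetric])
  have rind: "S.rind {..<i} (\<lambda>j. (a j, 0)) \<longleftrightarrow> I.rind {..<i} a" for a
    unfolding residue_indep_def sum_fst mem_pM ..
  have form: "form (herm_sum I H) (x, 0) (y, 0) = form I x y" for x y
    by (simp add: herm_sum_def)
  show "subgrp (FS {..<i} (\<lambda>_. I.pM))" by (simp add: subgrp_FS I.subgrp_pM)
  show "subgrp (S.KP i)" by (rule S.subgrp_KP)
  show "(\<lambda>j. (a j, 0)) \<in> S.P_frames i T"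
    if "a \<in> {a \<in> FS {..<i} (\<lambda>_. pts I). I.rind {..<i} a \<and> (\<forall>(j, l)\<in>upper_pairs 0 i. form I (a j) (a l) - T j l \<in> pw 1)}" for a
    using that unfolding S.P_frames_def by (simp add: rind form FS_def MP_iff zero_prod_def)
  show "\<exists>a\<in>{a \<in> FS {..<i} (\<lambda>_. pts I). I.rind {..<i} a \<and> (\<forall>(j, l)\<in>upper_pairs 0 i. form I (a j) (a l) - T j l \<in> pw 1)}.
      (\<lambda>j. (a j, 0)) - y \<in> S.KP i" if y: "y \<in> S.P_frames i T" for y
  proof -
    define a where "a j = fst (y j)" for j
    have "snd (y j) = 0" for j
      using y by (cases "j < i") (auto simp: S.P_frames_def FS_def MP_iff)
    then have ya: "y = (\<lambda>j. (a j, 0))" by (simp add: a_def fun_eq_iff prod_eq_iff)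
    have "a \<in> {a \<in> FS {..<i} (\<lambda>_. pts I). I.rind {..<i} a \<and> (\<forall>(j, l)\<in>upper_pairs 0 i. form I (a j) (a l) - T j l \<in> pw 1)}"
      using y unfolding ya S.P_frames_def by (simp add: rind form FS_def MP_iff zero_prod_def)
    moreover have "(\<lambda>j. (a j, 0)) - y \<in> S.KP i" unfolding ya using subgrp_0[OF S.subgrp_KP] by simp
    ultimately show ?thesis by (intro bexI[of _ a])
  qed
  show "(\<lambda>j. (a j, 0)) - (\<lambda>j. (b j, 0)) \<in> S.KP i \<longleftrightarrow> a - b \<in> FS {..<i} (\<lambda>_. I.pM)" for a b
    using I.pM_subset_pts by (auto simp: FS_def MP_iff mem_pM zero_prod_def fun_diff_def)
qed

end

lemma sum_apply: "(sum f A) x = (\<Sum>a\<in>A. f a x)"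
  by (induction A rule: infinite_finite_induct) auto

context ramified_ext
begin

lemma sum_basis:
  fixes I :: "('f, 'v::ab_group_add) herm" and H :: "('f, 'w::ab_group_add) herm"
  assumes I: "herm_module p E I" and H: "herm_module p E H"
    and e: "lat_basis E I m e" and f: "lat_basis E H n f"
  shows "lat_basis E (herm_sum I H) (m + n) (\<lambda>l. if l < m then (e l, 0) else (0, f (l - m)))"
proof -
  interpret I: herm_module p E I by fact
  interpret H: herm_module p E H by fact
  let ?b = "\<lambda>l. if l < m then (e l, 0) else (0, f (l - m))"
  have lc: "(\<Sum>l<m + n. smul (herm_sum I H) (c l) (?b l)) = (I.lc {..<m} c e, H.lc {..<n} (\<lambda>l. c (m + l)) f)" for c
  proof (induction n)
    case 0
    show ?case by (simp add: prod_eq_iff fst_sum snd_sum herm_sum_def)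
  qed (simp add: herm_sum_def)
  show ?thesis unfolding lat_basis_def lc ringF_eq
  proof (intro conjI allI impI equalityI subsetI)
    fix z assume "z \<in> pts (herm_sum I H)"
    then obtain x y where z: "z = (x, y)" "x \<in> pts I" "y \<in> pts H" by (auto simp: herm_sum_def)
    obtain c where c: "\<forall>l<m. c l \<in> pw 0" "x = I.lc {..<m} c e" using I.basis_expand[OF e z(2)] by blast
    obtain c' where c': "\<forall>l<n. c' l \<in> pw 0" "y = H.lc {..<n} c' f" using H.basis_expand[OF f z(3)] by blast
    show "z \<in> {(I.lc {..<m} c e, H.lc {..<n} (\<lambda>l. c (m + l)) f) | c. \<forall>l<m + n. c l \<in> pw 0}"
      using c c' z by (intro CollectI exI[of _ "\<lambda>l. if l < m then c l else c' (l - m)"]) auto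
  next
    fix z assume "z \<in> {(I.lc {..<m} c e, H.lc {..<n} (\<lambda>l. c (m + l)) f) | c. \<forall>l<m + n. c l \<in> pw 0}"
    then show "z \<in> pts (herm_sum I H)"
      using I.basis_pts[OF e] H.basis_pts[OF f] by (auto simp: herm_sum_def intro!: I.pts_lc H.pts_lc)
  next
    fix c l assume z: "(I.lc {..<m} c e, H.lc {..<n} (\<lambda>l. c (m + l)) f) = 0" and l: "l < m + n"
    then have 1: "I.lc {..<m} c e = 0" and 2: "H.lc {..<n} (\<lambda>l. c (m + l)) f = 0" by (simp_all add: zero_prod_def)
    show "c l = 0"
    proof (cases "l < m")
      case True
      then show ?thesis using I.basis_zero[OF e 1] by blast
    next
      case False
      then show ?thesis using H.basis_zero[OF f 2, of "l - m"] l by simp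
    qed
  qed
qed

text \<open>The index l stands for coordinate l mod 2 of plane l div 2.\<close>

lemma hyp_basis:
  "lat_basis E (hyp_power E k) (2 * k) (\<lambda>l j i. if j = l div 2 \<and> i = l mod 2 then 1 else 0)"
proof -
  let ?b = "\<lambda>l j i. if j = l div 2 \<and> i = l mod 2 then 1 else 0 :: 'f"
  have eq: "(\<Sum>l<2 * k. smul (hyp_power E k) (c l) (?b l)) = (\<lambda>j i. if j < k \<and> i < 2 then c (2 * j + i) else 0)"
    (is "?s c = ?t c") for c
  proof (intro ext)
    fix j i
    have "?s c j i = (\<Sum>l<2 * k. if j = l div 2 \<and> i = l mod 2 then c l else 0)"
      unfolding sum_apply hyp_smul by (rule sum.cong) auto
    also have "\<dots> = (\<Sum>l<2 * k. if l = 2 * j + i then if i < 2 then c (2 * j + i) else 0 else 0)"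
      by (rule sum.cong) (auto simp: mult.commute)
    also have "\<dots> = ?t c j i" by auto
    finally show "?s c j i = ?t c j i" .
  qed
  have mem: "?t c \<in> pts (hyp_power E k) \<longleftrightarrow> (\<forall>j<k. \<forall>i<2. c (2 * j + i) \<in> pw 0)" for c
    unfolding hyp_pts by (auto simp: FS_def fun_eq_iff)
  have idx: "2 * j + i < 2 * k" if "j < k" "i < 2" for i j using that by auto
  show ?thesis unfolding lat_basis_def eq ringF_eq
  proof (intro conjI allI impI equalityI subsetI)
    fix x assume x: "x \<in> pts (hyp_power E k)"
    define c where "c l = x (l div 2) (l mod 2)" for l
    have x0: "x j i = 0" if "\<not> (j < k \<and> i < 2)" for j i
      using x that unfolding hyp_pts by (cases "j < k") (auto simp: FS_def)
    have "x = ?t c" using x0 by (auto simp: c_def fun_eq_iff)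
    moreover have "\<forall>l<2 * k. c l \<in> pw 0" using x unfolding hyp_pts by (auto simp: FS_def c_def)
    ultimately show "x \<in> {?t c | c. \<forall>l<2 * k. c l \<in> pw 0}" by blast
  next
    fix x assume "x \<in> {?t c | c. \<forall>l<2 * k. c l \<in> pw 0}"
    then obtain c where c: "x = ?t c" "\<forall>l<2 * k. c l \<in> pw 0" by blast
    show "x \<in> pts (hyp_power E k)" unfolding c(1) mem using c(2) idx by blast
  next
    fix c l assume z: "?t c = 0" and l: "l < 2 * k"
    then have "l div 2 < k" "l mod 2 < 2" by auto
    then show "c l = 0" using fun_cong[OF fun_cong[OF z, of "l div 2"], of "l mod 2"] by simp
  qed
qed

text \<open>The rational counterpart of \<open>local_factor\<close>; \<open>Pden_value\<close>
  identifies it with the primitive density of the lattice spanned by the first i vectors of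
  \<open>e\<close>.\<close>

definition "mass I m L i e = of_nat (sym_count E I i (\<lambda>j l. form L (e j) (e l))) * of_nat q ^ i\<^sup>2 / (of_nat q :: rat) ^ (m * i)"

text \<open>At the interpolation points \<open>monom 1 i\<close> produces q^(-2ki) and
  \<open>iso_poly\<close> the density of the null lattice of rank n - i; the sum over
  \<open>V\<close> is a constant coefficient.\<close>

definition "part_poly I m L n i e = smult (\<Sum>V\<in>Gr E i L. of_nat q ^ ((n - i) * i) * mass I m L i (e i V)) (monom 1 i * iso_poly (n - i))"

lemma poly_part: "of_rat (poly (part_poly I m L n i e) (node k)) = (\<Sum>V\<in>Gr E i L.
    of_rat (mass I m L i (e i V)) / real q ^ (2 * k * i) * real q ^ ((n - i) * i) * isotropic_factor (n - i) (2 * k))"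
proof -
  have "of_rat (poly (part_poly I m L n i e) (node k)) =
    (\<Sum>V\<in>Gr E i L. real q ^ ((n - i) * i) * of_rat (mass I m L i (e i V))) * (1 / real q ^ (2 * k * i)) * isotropic_factor (n - i) (2 * k)"
    unfolding part_poly_def poly_iso[symmetric]
    by (simp add: of_rat_mult of_rat_sum of_rat_power poly_monom node_def of_rat_divide power_mult power_one_over)
  then show ?thesis unfolding sum_distrib_right by (simp add: field_simps)
qed

context
  fixes I :: "('f, 'm::ab_group_add) herm" and m :: nat
  assumes I: "hermitian_lattice E I" "unimodular E I" "lat_rank I = m"
begin

lemma I_module: "herm_module p E I"
  by (rule lattice_module[OF I(1)])

lemma sum_pair_hyp: "sum_pair p E I (hyp_power E k) m (2 * k)"
proof -
  interpret I: herm_module p E I by (rule I_module)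
  obtain e where "lat_basis E I m e" using lattice_basis[OF I(1)] I(3) by auto
  then have "card (quot (pts I) (scaled \<pi> I)) = q ^ m" by (rule I.basis_card_quot)
  then have "split_module p E (herm_sum I (hyp_power E k)) (\<lambda>z. (fst z, 0)) m (2 * k)"
    by (intro sum_split_module I_module hyp_module unimodular_integral[OF I(2)] unimodular_modular[OF I_module I(2)]
        hyp_integral hyp_modular hyp_card)
  then show ?thesis by (intro sum_pair.intro ramified_ext_axioms I_module hyp_module)
qed

lemma rank_sum_hyp: "lat_rank (herm_sum I (hyp_power E k)) = m + 2 * k"
proof -
  obtain e where e: "lat_basis E I m e" using lattice_basis[OF I(1)] I(3) by auto
  interpret S: herm_module p E "herm_sum I (hyp_power E k)" by (rule sum_module[OF I_module hyp_module])
  show ?thesis by (rule S.rank_of_basis[OF sum_basis[OF I_module hyp_module e hyp_basis]])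
qed

lemma pair_locale:
  assumes L: "herm_module p E L" "integral_lattice E L" "lat_rank L = n"
  shows "herm_pair p E (herm_sum I (hyp_power E k)) (\<lambda>z. (fst z, 0)) m (2 * k) L n"
proof -
  interpret sum_pair p E I "hyp_power E k" m "2 * k" by (rule sum_pair_hyp)
  interpret L: herm_module p E L by fact
  show ?thesis
    using L(2,3) rank_sum_hyp by unfold_locales (auto simp: integral_lattice_def ringF_eq)
qed

lemma prim_seq_formula:
  assumes L: "herm_module p E L" "integral_lattice E L" "lat_rank L = n" and d: "1 \<le> d" and e0: "lat_basis E L n e0"
    and e: "\<And>i V. i \<le> n \<Longrightarrow> V \<in> Gr E i L \<Longrightarrow> lat_basis E L n (e i V) \<and>
      V = {coset (scaled \<pi> L) (\<Sum>l<i. smul L (c l) (e i V l)) | c. \<forall>l<i. c l \<in> pw 0}"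
  shows "prim_seq E (herm_sum I (hyp_power E k)) L d = (\<Sum>i\<le>n. \<Sum>V\<in>Gr E i L.
    of_rat (mass I m L i (e i V)) / real q ^ (2 * k * i) * real q ^ ((n - i) * i) * isotropic_factor (n - i) (2 * k))"
proof -
  interpret sum_pair p E I "hyp_power E k" m "2 * k" by (rule sum_pair_hyp)
  interpret herm_pair p E "herm_sum I (hyp_power E k)" "\<lambda>z. (fst z, 0)" m "2 * k" L n by (rule pair_locale[OF L])
  have "local_factor i b = of_rat (mass I m L i b)" for i b
    unfolding local_factor_def mass_def card_P_frames by (simp add: of_rat_mult of_rat_divide of_rat_power)
  then show ?thesis using prim_seq_sum[OF d e0 e] by simp
qed

text \<open>For k = 0 the hyperbolic summand is zero, every kernel is all of L / \<pi>L, and only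
  the stratum i = n remains.\<close>

lemma prim_seq_unimodular:
  assumes L: "herm_module p E L" "integral_lattice E L" "lat_rank L = n" and d: "1 \<le> d" and e: "lat_basis E L n e"
  shows "prim_seq E (herm_sum I (hyp_power E 0)) L d = of_rat (mass I m L n e)"
proof -
  interpret sum_pair p E I "hyp_power E 0" m "2 * 0" by (rule sum_pair_hyp)
  interpret herm_pair p E "herm_sum I (hyp_power E 0)" "\<lambda>z. (fst z, 0)" m "2 * 0" L n by (rule pair_locale[OF L])
  have "prim_seq E (herm_sum I (hyp_power E 0)) L d =
    local_factor n e / real q ^ (2 * 0 * n) * real q ^ ((n - n) * n) * isotropic_factor (n - n) (2 * 0)"
  proof (rule prim_seq_degenerate[OF e order.refl d])
    fix x assume x: "\<And>l. l < n \<Longrightarrow> x l \<in> pts (herm_sum I (hyp_power E 0))"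
    have "S.Q (x l) = 0" if "l < n" for l
      using x[OF that] by (auto simp: S.Q_def herm_sum_def herm_power_def zero_prod_def fun_eq_iff)
    then show "(\<forall>l<n. S.Q (x l) \<in> S.pM) \<and> S.rind {n..<n} (\<lambda>l. S.Q (x l))"
      using subgrp_0[OF S.subgrp_pM] by (simp add: residue_indep_def)
  qed
  moreover have "local_factor n e = of_rat (mass I m L n e)"
    unfolding local_factor_def mass_def card_P_frames by (simp add: of_rat_mult of_rat_divide of_rat_power)
  ultimately show ?thesis by (simp add: isotropic_factor_def)
qed

text \<open>The sequences already have the asserted value for every d from 1 on, so convergence is
  immediate.\<close>

lemma Pden_poly_formula:
  assumes L: "hermitian_lattice E L" "integral_lattice E L" "lat_rank L = n"
    and e: "\<And>i V. i \<le> n \<Longrightarrow> V \<in> Gr E i L \<Longrightarrow> lat_basis E L n (e i V) \<and>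
      V = {coset (scaled \<pi> L) (\<Sum>l<i. smul L (c l) (e i V l)) | c. \<forall>l<i. c l \<in> pw 0}"
  shows "is_Pden_poly E I L (\<Sum>i\<le>n. part_poly I m L n i e)"
  unfolding is_Pden_poly_def
proof
  fix k
  obtain e0 where e0: "lat_basis E L n e0" using lattice_basis[OF L(1)] L(3) by auto
  have "prim_seq E (herm_sum I (hyp_power E k)) L d = of_rat (poly (\<Sum>i\<le>n. part_poly I m L n i e) (node k))"
    if d: "1 \<le> d" for d
    unfolding poly_sum of_rat_sum poly_part
    by (rule prim_seq_formula[OF lattice_module[OF L(1)] L(2,3) d e0 e])
  then have "eventually (\<lambda>d. prim_seq E (herm_sum I (hyp_power E k)) L d =
      of_rat (poly (\<Sum>i\<le>n. part_poly I m L n i e) (node k))) sequentially"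
    using eventually_sequentially by blast
  then show "prim_seq E (herm_sum I (hyp_power E k)) L \<longlonglongrightarrow>
      poly (map_poly of_rat (\<Sum>i\<le>n. part_poly I m L n i e)) (real q powi (- 2 * int k))"
    unfolding poly_node by (rule tendsto_eventually)
qed

lemma is_Pden_poly_unique: "is_Pden_poly E I L P \<Longrightarrow> is_Pden_poly E I L P' \<Longrightarrow> P = P'"
proof (rule poly_eq_nodes)
  fix k assume "is_Pden_poly E I L P" "is_Pden_poly E I L P'"
  then have "(of_rat (poly P (node k)) :: real) = of_rat (poly P' (node k))"
    unfolding is_Pden_poly_def poly_node using LIMSEQ_unique by blast
  then show "poly P (node k) = poly P' (node k)" by simp
qed

lemma Pden_poly_eq: "is_Pden_poly E I L P \<Longrightarrow> Pden_poly E I L = P"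
  unfolding Pden_poly_def using is_Pden_poly_unique by (intro the_equality)

text \<open>X = 1 is the interpolation point for k = 0. The limit there is computed twice, from the
  polynomial and directly by \<open>prim_seq_unimodular\<close>, which avoids a sum over all
  subspaces.\<close>

lemma Pden_value:
  assumes L: "hermitian_lattice E L" "integral_lattice E L" and e: "lat_basis E L n e"
  shows "Pden E I L = mass I m L n e"
proof -
  interpret L: herm_module p E L by (rule lattice_module[OF L(1)])
  have n: "lat_rank L = n" by (rule L.rank_of_basis[OF e])
  \<comment> \<open>Any adapted bases serve here, their purpose being the existence of the
    polynomial.\<close>
  define b where "b i V = (SOME b. lat_basis E L n b \<and> V = {coset L.pM (L.lc {..<i} c b) | c. \<forall>l<i. c l \<in> pw 0})" for i V
  have "lat_basis E L n (b i V) \<and> V = {coset L.pM (L.lc {..<i} c (b i V)) | c. \<forall>l<i. c l \<in> pw 0}" if "V \<in> Gr E i L" for i V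
    unfolding b_def by (rule someI_ex[OF L.Gr_basis[OF e that]])
  then have P: "is_Pden_poly E I L (\<Sum>i\<le>n. part_poly I m L n i b)" by (intro Pden_poly_formula L n)
  have "prim_seq E (herm_sum I (hyp_power E 0)) L \<longlonglongrightarrow> of_rat (poly (\<Sum>i\<le>n. part_poly I m L n i b) (node 0))"
    using P unfolding is_Pden_poly_def poly_node by blast
  moreover have "eventually (\<lambda>d. prim_seq E (herm_sum I (hyp_power E 0)) L d = of_rat (mass I m L n e)) sequentially"
    using prim_seq_unimodular[OF L.herm_module_axioms L(2) n _ e] eventually_sequentially by blast
  then have "prim_seq E (herm_sum I (hyp_power E 0)) L \<longlonglongrightarrow> of_rat (mass I m L n e)"
    by (rule tendsto_eventually)
  ultimately have "(of_rat (poly (\<Sum>i\<le>n. part_poly I m L n i b) (node 0)) :: real) = of_rat (mass I m L n e)"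
    by (rule LIMSEQ_unique)
  then show ?thesis unfolding Pden_def Pden_poly_eq[OF P] by (simp add: node_def)
qed

end

text \<open>With projection 0 every vector is its own \<open>Q\<close>-part, so an independent tuple
  has kernel zero and only i = 0 remains.\<close>

lemma null_density: "prim_density E (hyp_power E k) (null_lattice E r) = isotropic_factor r (2 * k)"
proof -
  let ?L = "null_lattice E r"
  have L: "herm_module p E ?L" unfolding null_lattice_def by (rule gram_module) (simp add: cj_0)
  have e: "lat_basis E ?L r (\<lambda>l i. if i = l then 1 else 0)" unfolding null_lattice_def by (rule gram_basis)
  interpret L: herm_module p E ?L by (rule L)
  interpret S: split_module p E "hyp_power E k" "\<lambda>_. 0" 0 "2 * k" by (rule hyp_split)
  interpret herm_pair p E "hyp_power E k" "\<lambda>_. 0" 0 "2 * k" ?L r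
  proof unfold_locales
    show "lat_rank (hyp_power E k) = 0 + 2 * k" using S.rank_of_basis[OF hyp_basis] by simp
    show "lat_rank ?L = r" by (rule L.rank_of_basis[OF e])
    show "form ?L x y \<in> pw 0" for x y by (simp add: null_lattice_def gram_lattice_def)
  qed
  have "prim_seq E (hyp_power E k) ?L d = isotropic_factor r (2 * k)" if d: "1 \<le> d" for d
  proof -
    have "prim_seq E (hyp_power E k) ?L d = local_factor 0 (\<lambda>l i. if i = l then 1 else 0) / real q ^ (2 * k * 0) *
        real q ^ ((r - 0) * 0) * isotropic_factor (r - 0) (2 * k)"
      by (rule prim_seq_degenerate[OF e _ d]) (simp_all add: S.Q_def lessThan_atLeast0)
    moreover have "S.P_frames 0 (\<lambda>j l. form ?L ((\<lambda>i. if i = j then 1 else 0)) (\<lambda>i. if i = l then 1 else 0)) = {0}"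
      "S.KP (0 :: nat) = {0}"
      by (auto simp: S.P_frames_def FS_def residue_indep_def upper_pairs_def)
    ultimately show ?thesis by (simp add: local_factor_def quot_def)
  qed
  then have "eventually (\<lambda>d. prim_seq E (hyp_power E k) ?L d = isotropic_factor r (2 * k)) sequentially"
    using eventually_sequentially by blast
  then have "prim_seq E (hyp_power E k) ?L \<longlonglongrightarrow> isotropic_factor r (2 * k)" by (rule tendsto_eventually)
  then show ?thesis unfolding prim_density_def by (rule limI)
qed

end

theorem theorem6p1:
  fixes p n m :: nat
    and E :: "'f::field_char_0 quad_ext"
    and L :: "('f, 'l::ab_group_add) herm"
    and I :: "('f, 'm::ab_group_add) herm"
    and S :: "'l set set \<Rightarrow> 'l set"
  assumes "ramified_quadratic_ext p E"
    and "hermitian_lattice E L" and "integral_lattice E L" and "lat_rank L = n"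
    and "hermitian_lattice E I" and "unimodular E I" and "lat_rank I = m"
    and "\<And>i V. i \<le> n \<Longrightarrow> V \<in> Gr E i L \<Longrightarrow> is_lift E i L V (S V)"
  shows "(\<exists>!P. is_Pden_poly E I L P) \<and>
         (\<forall>i\<le>n. \<exists>!P. is_Pden_part E I L S i P) \<and>
         Pden_poly E I L = (\<Sum>i=0..n. Pden_part E I L S i)"
proof -
  interpret ramified_ext p E by (rule ramified_ext.intro[OF assms(1)])
  note L = assms(2-4) and I = assms(5-7)
  interpret L: herm_module p E L by (rule lattice_module[OF L(1)])
  obtain e0 where e0: "lat_basis E L n e0" using lattice_basis[OF L(1)] L(3) by auto
  \<comment> \<open>Adapted to the prescribed lift \<open>S V\<close> and not merely to
    \<open>V\<close>, so that the same vectors also compute the density of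
    \<open>S V\<close>.\<close>
  define e where "e i V = (SOME e. lat_basis E L n e \<and>
    V = {coset L.pM (L.lc {..<i} c e) | c. \<forall>l<i. c l \<in> pw 0} \<and> lat_basis E (L\<lparr>pts := S V\<rparr>) i e)" for i V
  have e: "lat_basis E L n (e i V) \<and> V = {coset L.pM (L.lc {..<i} c (e i V)) | c. \<forall>l<i. c l \<in> pw 0} \<and>
    lat_basis E (L\<lparr>pts := S V\<rparr>) i (e i V)" if "i \<le> n" "V \<in> Gr E i L" for i V
    unfolding e_def by (rule someI_ex[OF L.lift_basis[OF e0 that(2) assms(8)[OF that]]])
  let ?P = "\<lambda>i. part_poly I m L n i e"
  have P: "is_Pden_poly E I L (\<Sum>i\<le>n. ?P i)"
    using e by (intro Pden_poly_formula[OF I L]) blast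
  have Pden: "Pden E I (L\<lparr>pts := S V\<rparr>) = mass I m L i (e i V)" if iV: "i \<le> n" "V \<in> Gr E i L" for i V
  proof -
    have lift: "S V \<subseteq> pts L" "hermitian_lattice E (L\<lparr>pts := S V\<rparr>)"
      using assms(8)[OF iV] by (simp_all add: is_lift_def)
    have "integral_lattice E (L\<lparr>pts := S V\<rparr>)" using L(2) lift(1) by (auto simp: integral_lattice_def)
    then have "Pden E I (L\<lparr>pts := S V\<rparr>) = mass I m (L\<lparr>pts := S V\<rparr>) i (e i V)"
      using e[OF iV] lift(2) by (intro Pden_value[OF I]) blast+
    \<comment> \<open>Changing \<open>pts\<close> leaves the form alone, and \<open>mass\<close>
      sees the lattice only through the Gram matrix of the chosen vectors.\<close>
    then show ?thesis by (simp add: mass_def)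
  qed
  \<comment> \<open>Agreement at the infinitely many points q^(-2k) yields existence and uniqueness
    together.\<close>
  have part: "is_Pden_part E I L S i P \<longleftrightarrow> P = ?P i" if i: "i \<le> n" for i P
  proof -
    have "real q powi (- 2 * int k * int i) * isotropic_factor (n - i) (2 * k) *
        (\<Sum>V\<in>Gr E i L. real q ^ ((n - i) * i) * of_rat (Pden E I (L\<lparr>pts := S V\<rparr>))) =
      of_rat (poly (?P i) (node k))" for k
    proof -
      have "- 2 * int k * int i = - int (2 * k * i)" by simp
      then have "real q powi (- 2 * int k * int i) = 1 / real q ^ (2 * k * i)"
        by (simp only: power_int_minus power_int_of_nat) (simp add: divide_inverse)
      then show ?thesis
        using Pden[OF i] by (simp add: poly_part sum_distrib_left field_simps)
    qed
    then have "is_Pden_part E I L S i P \<longleftrightarrow> (\<forall>k. (of_rat (poly P (node k)) :: real) = of_rat (poly (?P i) (node k)))"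
      unfolding is_Pden_part_def poly_node null_density L(3) by simp
    then show ?thesis using poly_eq_nodes[of P "?P i"] by auto
  qed
  have "Pden_part E I L S i = ?P i" if "i \<le> n" for i
    unfolding Pden_part_def using part[OF that] by (intro the_equality) auto
  then have "Pden_poly E I L = (\<Sum>i=0..n. Pden_part E I L S i)"
    using Pden_poly_eq[OF I P] by (simp add: atLeast0AtMost)
  moreover have "\<exists>!P. is_Pden_poly E I L P" using P is_Pden_poly_unique[OF I] by blast
  ultimately show ?thesis using part by simp
qed

end
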